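(* Let $m\ge1$ and let $\nu_m$, $Q$, $M_p$, $M_p^*$ be as in the context (with $R=Q^{1/2}$). The function $g(x)=\|x\|^2$ satisfies: for every $p>1$, $g\in W^{1,p}(X,\nu_m)$ and $Mg\,\|Mg\|^{-2}\in D(M_p^* )$. Moreover $Mg\in W^{1,q}(X,\nu_m;X)$ for every $q>1$.
   Context: $X$ is a separable infinite-dimensional real Hilbert space with norm $\|\cdot\|$ and a fixed orthonormal basis $\{e_h\}_{h\in\mathbb{N}}$; $x_h=\langle x,e_h\rangle$, and $X$ is identified with $\ell^2$ via $x\mapsto(x_h)$. For $\mu>0$, $\nu_{m,\mu}(d\xi)=a_m\mu^{-1/(2m)}e^{-|\xi|^{2m}/(2m\mu)}\,d\xi$ on $\mathbb{R}$, with $a_m=(2m)^{1-1/(2m)}/(2\Gamma(1/(2m)))$ the normalization constant making it a probability measure. $(\mu_h)_{h\in\mathbb{N}}$ is a sequence of positive numbers with $\sum_{h=1}^\infty\mu_h^{1/m}<\infty$, and $\nu_m=\prod_{h=1}^\infty\nu_{m,\mu_h}$, a product measure on $\mathbb{R}^\infty$ concentrated on $\ell^2\cong X$. Its covariance is $Qe_h=b_{m,1}\mu_h^{1/m}e_h$, $h\in\mathbb{N}$, with $b_{m,1}=(2m)^{1/m}\,\Gamma(3/(2m))/\Gamma(1/(2m))$. $C_b^1(X)$: bounded continuously Fréchet differentiable functions with bounded gradient. For $p\in(1,\infty)$, the operator $Q^{1/2}\nabla:C_b^1(X)\subset L^p(X,\nu_m)\to L^p(X,\nu_m;X)$ is closable;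 $M_p$ is its closure and $W^{1,p}(X,\nu_m)$ its domain. With $p'=p/(p-1)$, $M_p^*:D(M_p^* )\subset L^{p'}(X,\nu_m;X)\to L^{p'}(X,\nu_m)$ is the adjoint: $\int\langle M_p\varphi,F\rangle\,d\nu_m=\int\varphi\,M_p^*F\,d\nu_m$ for $\varphi\in W^{1,p}(X,\nu_m)$, $F\in D(M_p^* )$. The operators $M_p$ agree on common domains; $M$ denotes $M_p$ on $\bigcap_{p>1}W^{1,p}(X,\nu_m)$. For $p>1$, $W^{1,p}(X,\nu_m;X)$ is the space of vector fields $F:X\to X$ such that $f_i:=\langle F,e_i\rangle\in W^{1,p}(X,\nu_m)$ for every $i$ and $(\sum_i\|M_pf_i\|^2)^{1/2}\in L^p(X,\nu_m)$. *)

theory Defs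
  imports "HOL-Probability.Probability"
begin

definition a_const :: "real \<Rightarrow> real" where
  "a_const m = (2 * m) powr (1 - 1 / (2 * m)) / (2 * Gamma (1 / (2 * m)))"

definition b_const :: "real \<Rightarrow> real" where
  "b_const m = (2 * m) powr (1 / m) * Gamma (3 / (2 * m)) / Gamma (1 / (2 * m))"

definition nu1 :: "real \<Rightarrow> real \<Rightarrow> real measure" where
  "nu1 m \<mu> = density lborel (\<lambda>\<xi>. ennreal
     (a_const m * \<mu> powr (- (1 / (2 * m))) * exp (- (\<bar>\<xi>\<bar> powr (2 * m)) / (2 * m * \<mu>))))"

text \<open>The product measure on sequences is transported to the Hilbert space by the inverse of
  \<open>x \<mapsto> (\<langle>x, e\<^sub>h\<rangle>)\<^sub>h\<close>. The series below converges exactly for square-summable \<open>\<xi>\<close>, which form a set of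
  full measure when \<open>\<Sum>h. \<mu>\<^sub>h powr (1/m)\<close> is finite; elsewhere its value is an irrelevant constant.\<close>

definition nu ::
  "real \<Rightarrow> (nat \<Rightarrow> real) \<Rightarrow> (nat \<Rightarrow> 'a::{real_inner, banach, second_countable_topology}) \<Rightarrow> 'a measure" where
  "nu m \<mu> e = distr (\<Pi>\<^sub>M h\<in>UNIV. nu1 m (\<mu> h)) borel (\<lambda>\<xi>. \<Sum>h. \<xi> h *\<^sub>R e h)"

definition cov_op ::
  "real \<Rightarrow> (nat \<Rightarrow> real) \<Rightarrow> (nat \<Rightarrow> 'a::{real_inner, banach}) \<Rightarrow> 'a \<Rightarrow> 'a" where
  "cov_op m \<mu> e x = (\<Sum>h. (b_const m * \<mu> h powr (1 / m) * (x \<bullet> e h)) *\<^sub>R e h)"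

definition sqrt_op :: "('a::real_inner \<Rightarrow> 'a) \<Rightarrow> 'a \<Rightarrow> 'a" where
  "sqrt_op Q = (THE R. bounded_linear R \<and> (\<forall>x y. R x \<bullet> y = x \<bullet> R y) \<and>
                       (\<forall>x. 0 \<le> R x \<bullet> x) \<and> (\<forall>x. R (R x) = Q x))"

text \<open>Elements of \<open>L\<^sup>p\<close> are represented by functions; membership in the spaces below is invariant under Borel
  modification on null sets.\<close>

definition Lp :: "real \<Rightarrow> 'a measure \<Rightarrow> ('a \<Rightarrow> 'b::{real_normed_vector, second_countable_topology}) set" where
  "Lp p \<nu> = {f \<in> borel_measurable \<nu>. integrable \<nu> (\<lambda>x. norm (f x) powr p)}"

definition Lp_tendsto ::
  "real \<Rightarrow> 'a measure \<Rightarrow> (nat \<Rightarrow> 'a \<Rightarrow> 'b::{real_normed_vector, second_countable_topology}) \<Rightarrow> ('a \<Rightarrow> 'b) \<Rightarrow> bool" where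
  "Lp_tendsto p \<nu> f g \<longleftrightarrow> (\<forall>n. f n \<in> Lp p \<nu>) \<and> g \<in> Lp p \<nu> \<and>
     (\<lambda>n. \<integral>x. norm (f n x - g x) powr p \<partial>\<nu>) \<longlonglongrightarrow> 0"

definition grad :: "('a::real_inner \<Rightarrow> real) \<Rightarrow> 'a \<Rightarrow> 'a" where
  "grad \<phi> x = (THE v. GDERIV \<phi> x :> v)"

definition Cb1 :: "('a::real_inner \<Rightarrow> real) set" where
  "Cb1 = {\<phi>. bounded (range \<phi>) \<and> (\<forall>x. GDERIV \<phi> x :> grad \<phi> x) \<and>
             continuous_on UNIV (grad \<phi>) \<and> bounded (range (grad \<phi>))}"

text \<open>The graph of the closure of \<open>R \<circ> \<nabla>\<close>, with domain \<open>Cb1\<close>, from \<open>L\<^sup>p(X)\<close> to \<open>L\<^sup>p(X; X)\<close>.\<close>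

definition M_graph ::
  "'a::{real_inner, second_countable_topology} measure \<Rightarrow> ('a \<Rightarrow> 'a) \<Rightarrow> real \<Rightarrow> ('a \<Rightarrow> real) \<Rightarrow> ('a \<Rightarrow> 'a) \<Rightarrow> bool" where
  "M_graph \<nu> R p \<phi> F \<longleftrightarrow> (\<exists>\<psi>. (\<forall>n. \<psi> n \<in> Cb1) \<and> Lp_tendsto p \<nu> \<psi> \<phi> \<and>
     Lp_tendsto p \<nu> (\<lambda>n x. R (grad (\<psi> n) x)) F)"

definition W1 ::
  "'a::{real_inner, second_countable_topology} measure \<Rightarrow> ('a \<Rightarrow> 'a) \<Rightarrow> real \<Rightarrow> ('a \<Rightarrow> real) set" where
  "W1 \<nu> R p = {\<phi>. \<exists>F. M_graph \<nu> R p \<phi> F}"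

text \<open>By closability the value of the closed operator is determined up to null sets; a
  representative is chosen. In \<open>M_op\<close> it is one that serves for all exponents simultaneously, which
  exists because the operators agree on common domains.\<close>

definition Mp ::
  "'a::{real_inner, second_countable_topology} measure \<Rightarrow> ('a \<Rightarrow> 'a) \<Rightarrow> real \<Rightarrow> ('a \<Rightarrow> real) \<Rightarrow> 'a \<Rightarrow> 'a" where
  "Mp \<nu> R p \<phi> = (SOME F. M_graph \<nu> R p \<phi> F)"

definition M_op ::
  "'a::{real_inner, second_countable_topology} measure \<Rightarrow> ('a \<Rightarrow> 'a) \<Rightarrow> ('a \<Rightarrow> real) \<Rightarrow> 'a \<Rightarrow> 'a" where
  "M_op \<nu> R \<phi> = (SOME F. \<forall>p>1. M_graph \<nu> R p \<phi> F)"

definition adj_dom ::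
  "'a::{real_inner, second_countable_topology} measure \<Rightarrow> ('a \<Rightarrow> 'a) \<Rightarrow> real \<Rightarrow> ('a \<Rightarrow> 'a) set" where
  "adj_dom \<nu> R p = {F \<in> Lp (p / (p - 1)) \<nu>. \<exists>\<psi> \<in> Lp (p / (p - 1)) \<nu>. \<forall>\<phi> \<in> W1 \<nu> R p.
     (\<integral>x. Mp \<nu> R p \<phi> x \<bullet> F x \<partial>\<nu>) = (\<integral>x. \<phi> x * \<psi> x \<partial>\<nu>)}"

text \<open>The summability clause states that the square function is finite almost everywhere, which the
  junk value of a divergent \<open>suminf\<close> would otherwise hide.\<close>

definition W1_vec ::
  "'a::{real_inner, second_countable_topology} measure \<Rightarrow> ('a \<Rightarrow> 'a) \<Rightarrow> (nat \<Rightarrow> 'a) \<Rightarrow> real \<Rightarrow> ('a \<Rightarrow> 'a) set" where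
  "W1_vec \<nu> R e p = {F. (\<forall>i. (\<lambda>x. F x \<bullet> e i) \<in> W1 \<nu> R p) \<and>
     (AE x in \<nu>. summable (\<lambda>i. (norm (Mp \<nu> R p (\<lambda>y. F y \<bullet> e i) x))\<^sup>2)) \<and>
     (\<lambda>x. sqrt (\<Sum>i. (norm (Mp \<nu> R p (\<lambda>y. F y \<bullet> e i) x))\<^sup>2)) \<in> Lp p \<nu>}"

end

theory Submission
  imports Defs
begin

text \<open>
  Write \<open>R\<close> for the square root of the covariance; it is diagonal in the basis \<open>e\<close> with entries
  \<open>sqrt (lam h)\<close>, where \<open>lam h\<close> is a multiple of \<open>\<mu> h powr (1 / m)\<close> and hence summable. The
  gradient of \<open>g = \<parallel>x\<parallel>\<^sup>2\<close> is \<open>2 x\<close>, so \<open>Mg\<close> should be \<open>2 R x\<close>, and its \<open>i\<close>-th coordinate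
  \<open>2 sqrt (lam i) (x \<bullet> e i)\<close> is linear with constant image \<open>2 lam i e i\<close> under \<open>M\<close>. Saturating \<open>g\<close>
  and the linear functionals to bounded smooth functions, and using that all moments of the norm are
  finite, puts both into the Sobolev spaces for every exponent; the square function of \<open>Mg\<close> is a
  finite constant because \<open>lam\<close> is square summable.

  The core is the vector field \<open>Mg / \<parallel>Mg\<parallel>\<^sup>2 = R x / (2 \<parallel>R x\<parallel>\<^sup>2)\<close>. Integration by parts in
  the direction \<open>e h\<close> against the density \<open>exp (- \<bar>t\<bar> powr (2 m) / (2 m \<mu>))\<close> produces the factor
  \<open>sgn t \<bar>t\<bar> powr (2 m - 1) / \<mu>\<close>; summing over \<open>h\<close> gives the candidate for the adjoint:
  \<open>((\<Sum>h. lam h * \<bar>x \<bullet> e h\<bar> powr (2 m) / \<mu> h) - (\<Sum>h. lam h)) / (2 \<parallel>R x\<parallel>\<^sup>2) + \<parallel>R (R x)\<parallel>\<^sup>2 / \<parallel>R x\<parallel>\<^sup>4\<close>.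
  Three points have to be settled.

  \<^item> The series in the numerator converges almost everywhere and has all moments. It has the form
    \<open>\<Sum>h. w h * Y h\<close> with summable weights and identically distributed \<open>Y h\<close>, so Jensen's inequality
    for the normalised weights bounds its powers (\<open>integrable_power_weighted_sum\<close>).

  \<^item> All negative moments of \<open>\<parallel>R x\<parallel>\<close> are finite. The measure has infinitely many independent
    coordinates with bounded densities, and \<open>\<parallel>R x\<parallel>\<close> dominates each \<open>sqrt (lam j) \<bar>x \<bullet> e j\<bar>\<close>;
    hence \<open>\<parallel>R x\<parallel> powr (- k / 2)\<close> is at most a multiple of the product of the first \<open>k\<close> factors
    \<open>\<bar>x \<bullet> e j\<bar> powr (- 1 / 2)\<close>, which are independent and integrable
    (\<open>integrable_norm_R_inverse_powr\<close>).

  \<^item> Division by \<open>\<parallel>R x\<parallel>\<^sup>2\<close> and summation over infinitely many directions are not covered by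
    integration by parts for bounded functions. Replacing \<open>\<parallel>R x\<parallel>\<^sup>2\<close> by \<open>\<epsilon> + \<parallel>R x\<parallel>\<^sup>2\<close> and
    truncating the sum makes everything bounded, and the first two points supply the integrable
    majorants for the passage to the limit (\<open>divergence_formula\<close>).

  Since \<open>M\<close> is defined as a closure and its values are chosen representatives, they can be
  identified with \<open>2 R x\<close> only through closability. This follows from the same integration by parts,
  applied to test functions that approximate indicators of cylinders (\<open>M_graph_unique\<close>).
\<close>

section \<open>The one-dimensional factor measures\<close>

text \<open>The substitution \<open>u = t powr (2 * m) / (2 * m * \<mu>)\<close> turns the integrand into that of the Gamma
  integral. Admitting every \<open>r > - 1\<close> covers at once the normalisation (\<open>r = 0\<close>), the positive
  moments, and the moment of order \<open>- 1 / 2\<close> that controls the behaviour near the origin.\<close>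

lemma exp_power_has_integral_Ioi:
  fixes m \<mu> r :: real
  assumes "m > 0" "\<mu> > 0" "r > -1"
  shows "((\<lambda>t. t powr r * exp (- (t powr (2 * m)) / (2 * m * \<mu>))) has_integral
           (2 * m * \<mu>) powr ((r + 1) / (2 * m)) * Gamma ((r + 1) / (2 * m)) / (2 * m)) {0<..}"
proof -
  define a where "a = (r + 1) / (2 * m)"
  define K where "K = 2 * m * \<mu>"
  have a: "a > 0" and K: "K > 0" using assms by (auto simp: a_def K_def)
  define g where "g = (\<lambda>s. s powr (2 * m) / K)"
  define g' where "g' = (\<lambda>s. 2 * m * s powr (2 * m - 1) / K)"
  define f where "f = (\<lambda>t. t powr (a - 1) / exp t)"
  have f_int0: "(f has_integral Gamma a) {0..}"
    unfolding f_def by (rule Gamma_integral_real[OF a])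
  have f_int: "(f has_integral Gamma a) {0<..}"
  proof (rule has_integral_spike_set_eq[THEN iffD1, OF _ _ f_int0])
    show "negligible {x \<in> {0..} - {0<..}. f x \<noteq> 0}"
      by (rule negligible_subset[of "{0}"]) auto
    show "negligible {x \<in> {0<..} - {0..}. f x \<noteq> 0}"
      by (rule negligible_subset[of "{}"]) auto
  qed
  have f_abs: "f absolutely_integrable_on {0<..}"
    by (rule nonnegative_absolutely_integrable_1) (use f_int in \<open>auto simp: f_def\<close>)
  have gim: "g ` {0<..} = {0<..}"
  proof (intro set_eqI iffI)
    fix y assume y: "y \<in> {(0::real)<..}"
    have "y = g ((K * y) powr (1 / (2 * m)))"
      using y K assms by (simp add: g_def powr_powr)
    thus "y \<in> g ` {0<..}" using y K by (intro image_eqI[of _ _ "(K * y) powr (1 / (2 * m))"]) auto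
  qed (use K in \<open>auto simp: g_def\<close>)
  have inj: "inj_on g {0<..}"
  proof (rule inj_on_inverseI)
    show "(K * g s) powr (1 / (2 * m)) = s" if "s \<in> {0<..}" for s
      using that assms K by (simp add: g_def powr_powr)
  qed
  have der: "(g has_field_derivative g' x) (at x within {0<..})" if "x \<in> {0<..}" for x
    unfolding g_def g'_def using that K
    by (auto intro!: derivative_eq_intros)
  have "(\<lambda>x. \<bar>g' x\<bar> * f (g x)) absolutely_integrable_on {0<..} \<and>
        integral {0<..} (\<lambda>x. \<bar>g' x\<bar> * f (g x)) = Gamma a"
    using has_absolute_integral_change_of_variables_1'[OF _ der inj, of f "Gamma a"]
      f_abs f_int by (auto simp: gim has_integral_iff)
  hence *: "((\<lambda>x. \<bar>g' x\<bar> * f (g x)) has_integral Gamma a) {0<..}"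
    by (auto simp: has_integral_iff absolutely_integrable_on_def)
  have eq: "\<bar>g' x\<bar> * f (g x) = (2 * m / K powr a) * (x powr r * exp (- (x powr (2*m)) / K))"
    if "x \<in> {0<..}" for x
  proof -
    have x: "x > 0" using that by simp
    have "f (g x) = x powr (2 * m * (a - 1)) / K powr (a - 1) * exp (- (x powr (2*m)) / K)"
      using x K by (simp add: f_def g_def powr_divide powr_powr exp_minus field_simps)
    hence "\<bar>g' x\<bar> * f (g x) = 2 * m / (K * K powr (a - 1)) *
            ((x powr (2 * m - 1) * x powr (2 * m * (a - 1))) * exp (- (x powr (2*m)) / K))"
      using x K assms by (simp add: g'_def field_simps)
    also have "x powr (2 * m - 1) * x powr (2 * m * (a - 1)) = x powr r"
      using assms x by (simp add: powr_add[symmetric] a_def field_simps)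
    also have "K * K powr (a - 1) = K powr a"
      using K by (simp add: powr_mult_base)
    finally show ?thesis by simp
  qed
  have "((\<lambda>x. (2 * m / K powr a) * (x powr r * exp (- (x powr (2*m)) / K)))
           has_integral Gamma a) {0<..}"
    using has_integral_eq[OF _ *] eq by auto
  from has_integral_mult_right[OF this, of "K powr a / (2 * m)"]
  show ?thesis using K assms by (simp add: a_def[symmetric] K_def mult.assoc)
qed

lemma has_bochner_integral_exp_power:
  fixes m \<mu> r :: real
  assumes "m > 0" "\<mu> > 0" "r > -1"
  shows "has_bochner_integral lborel (\<lambda>t. \<bar>t\<bar> powr r * exp (- (\<bar>t\<bar> powr (2 * m)) / (2 * m * \<mu>)))
           ((2 * m * \<mu>) powr ((r + 1) / (2 * m)) * Gamma ((r + 1) / (2 * m)) / m)"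
proof -
  define I where "I = (2 * m * \<mu>) powr ((r + 1) / (2 * m)) * Gamma ((r + 1) / (2 * m)) / (2 * m)"
  define f where "f = (\<lambda>t. \<bar>t\<bar> powr r * exp (- (\<bar>t\<bar> powr (2 * m)) / (2 * m * \<mu>)))"
  have I0: "I \<ge> 0" using assms by (auto simp: I_def intro!: mult_nonneg_nonneg divide_nonneg_nonneg Gamma_real_nonneg)
  have hi: "(f has_integral I) {0<..}"
    using has_integral_eq[OF _ exp_power_has_integral_Ioi[OF assms]]
    by (auto simp: f_def I_def)
  have meas [measurable]: "f \<in> borel_measurable borel" by (simp add: f_def)
  have "(\<integral>\<^sup>+x. indicator {0..} x *\<^sub>R f x \<partial>lborel) = (\<integral>\<^sup>+x. indicator {0<..} x * f x \<partial>lborel)"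
    by (rule nn_integral_cong) (auto simp: f_def indicator_def split: if_splits)
  also have "\<dots> = I"
    using nn_integral_has_integral_lebesgue[OF _ hi] by (simp add: f_def)
  finally have "has_bochner_integral lborel (\<lambda>x. indicator {0..} x *\<^sub>R f x) I"
    by (intro has_bochner_integral_nn_integral I0) (auto simp: f_def)
  from has_bochner_integral_even_function[OF this] show ?thesis
    by (simp add: f_def I_def)
qed

definition nu1_density :: "real \<Rightarrow> real \<Rightarrow> real \<Rightarrow> real" where
  "nu1_density m \<mu> t = a_const m * \<mu> powr (- (1 / (2 * m))) * exp (- (\<bar>t\<bar> powr (2 * m)) / (2 * m * \<mu>))"

lemma nu1_eq_density: "nu1 m \<mu> = density lborel (\<lambda>t. ennreal (nu1_density m \<mu> t))"
  by (simp add: nu1_def nu1_density_def)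

lemma a_const_pos: "m > 0 \<Longrightarrow> a_const m > 0"
  by (auto simp: a_const_def intro!: Gamma_real_pos divide_pos_pos mult_pos_pos)

lemma b_const_pos: "m > 0 \<Longrightarrow> b_const m > 0"
  by (auto simp: b_const_def intro!: Gamma_real_pos divide_pos_pos mult_pos_pos)

lemma nu1_density_pos: "m > 0 \<Longrightarrow> \<mu> > 0 \<Longrightarrow> nu1_density m \<mu> t > 0"
  using a_const_pos[of m] by (simp add: nu1_density_def)

lemma nu1_density_measurable [measurable]: "nu1_density m \<mu> \<in> borel_measurable borel"
  by (simp add: nu1_density_def[abs_def])

lemma sets_nu1 [simp, measurable_cong]: "sets (nu1 m \<mu>) = sets borel"
  by (simp add: nu1_def)

lemma space_nu1 [simp]: "space (nu1 m \<mu>) = UNIV"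
  by (simp add: nu1_def)

definition abs_moment :: "real \<Rightarrow> real \<Rightarrow> real" where
  "abs_moment m r = (2 * m) powr (r / (2 * m)) * Gamma ((r + 1) / (2 * m)) / Gamma (1 / (2 * m))"

text \<open>The point is the scaling: only the power of \<open>\<mu>\<close> depends on \<open>\<mu>\<close>, so after dividing by it the
  moments of all coordinates are bounded by one constant.\<close>

lemma nu1_moment:
  assumes "m > 0" "\<mu> > 0" "r > -1"
  shows "has_bochner_integral (nu1 m \<mu>) (\<lambda>t. \<bar>t\<bar> powr r) (\<mu> powr (r / (2 * m)) * abs_moment m r)"
proof -
  have G: "Gamma (1 / (2 * m)) > 0" using assms by (intro Gamma_real_pos) auto
  let ?c = "a_const m * \<mu> powr (- (1 / (2 * m)))"
  have "has_bochner_integral lborel (\<lambda>t. nu1_density m \<mu> t *\<^sub>R \<bar>t\<bar> powr r)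
     (?c * ((2 * m * \<mu>) powr ((r + 1) / (2 * m)) * Gamma ((r + 1) / (2 * m)) / m))"
    using has_bochner_integral_mult_right[OF has_bochner_integral_exp_power[OF assms], of ?c]
    by (simp add: nu1_density_def mult_ac)
  also have "?c * ((2 * m * \<mu>) powr ((r + 1) / (2 * m)) * Gamma ((r + 1) / (2 * m)) / m)
      = \<mu> powr (r / (2 * m)) * abs_moment m r"
  proof -
    have "(2 * m * \<mu>) powr ((r + 1) / (2 * m)) =
        ((2 * m) powr (r / (2 * m)) * (2 * m) powr (1 / (2 * m))) *
        (\<mu> powr (r / (2 * m)) * \<mu> powr (1 / (2 * m)))"
      using assms by (simp add: powr_mult add_divide_distrib powr_add)
    moreover have "a_const m = (2 * m) / (2 * m) powr (1 / (2 * m)) / (2 * Gamma (1 / (2 * m)))"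
      using assms by (simp add: a_const_def powr_diff)
    moreover have "(2 * m) / A / (2 * g) * inverse C * (D * A * (E * C) * k / m) = E * (D * k / g)"
      if "A > 0" "C > 0" "g > 0" for A C D E g k :: real
      using that assms by (simp add: field_simps)
    ultimately show ?thesis
      using assms G by (simp add: abs_moment_def powr_minus)
  qed
  finally show ?thesis unfolding nu1_eq_density
    by (intro has_bochner_integral_density) (use nu1_density_pos[of m \<mu>] assms in \<open>auto intro!: less_imp_le\<close>)
qed

lemma abs_moment_0:
  assumes "m > 0" shows "abs_moment m 0 = 1"
proof -
  have "Gamma (1 / (2 * m)) > 0" using assms by (intro Gamma_real_pos) auto
  hence "Gamma (1 / (2 * m)) \<noteq> 0" by (rule less_imp_neq[symmetric])
  thus ?thesis using assms by (simp add: abs_moment_def)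
qed

lemma prob_space_nu1:
  assumes "m > 0" "\<mu> > 0"
  shows "prob_space (nu1 m \<mu>)"
proof
  have "has_bochner_integral (nu1 m \<mu>) (\<lambda>t. \<bar>t\<bar> powr 0) 1"
    using nu1_moment[OF assms, of 0] assms by (simp add: abs_moment_0)
  hence I: "(\<integral>\<^sup>+t. ennreal (\<bar>t\<bar> powr 0) \<partial>nu1 m \<mu>) = 1"
    by (subst nn_integral_eq_integral) (auto simp: has_bochner_integral_iff)
  have "AE t in nu1 m \<mu>. t \<noteq> 0"
    unfolding nu1_eq_density by (subst AE_density) (auto intro: AE_mp[OF AE_lborel_singleton])
  hence "(\<integral>\<^sup>+t. 1 \<partial>nu1 m \<mu>) = (\<integral>\<^sup>+t. ennreal (\<bar>t\<bar> powr 0) \<partial>nu1 m \<mu>)"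
    by (intro nn_integral_cong_AE) auto
  thus "emeasure (nu1 m \<mu>) (space (nu1 m \<mu>)) = 1" using I by simp
qed

text \<open>The negative logarithmic derivative of the density, which is the factor that integration by parts
  produces.\<close>

definition score :: "real \<Rightarrow> real \<Rightarrow> real \<Rightarrow> real" where
  "score m \<mu> t = sgn t * \<bar>t\<bar> powr (2 * m - 1) / \<mu>"

lemma DERIV_abs_sgn:
  fixes t :: real assumes "t \<noteq> 0"
  shows "(abs has_real_derivative sgn t) (at t)"
proof -
  have "(norm :: real \<Rightarrow> real) = abs" by auto
  thus ?thesis using GDERIV_norm[OF assms] by simp
qed

text \<open>At the origin the difference quotient has modulus \<open>\<bar>h\<bar> powr (p - 1)\<close>, which tends to zero because
  \<open>p > 1\<close>.\<close>

lemma abs_powr_has_derivative: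
  fixes p :: real assumes "p > 1"
  shows "((\<lambda>t. \<bar>t\<bar> powr p) has_real_derivative p * (sgn t * \<bar>t\<bar> powr (p - 1))) (at t)"
proof (cases "t = 0")
  case False
  have "((\<lambda>t. \<bar>t\<bar> powr p) has_real_derivative p * \<bar>t\<bar> powr (p - 1) * sgn t) (at t)"
    using False by (auto intro!: derivative_eq_intros DERIV_abs_sgn)
  thus ?thesis by (simp add: mult_ac)
next
  case True
  have "((\<lambda>h. \<bar>h\<bar> powr p / h) \<longlongrightarrow> 0) (at 0)"
  proof (rule tendsto_rabs_zero_cancel, rule Lim_transform_eventually)
    show "((\<lambda>h::real. \<bar>h\<bar> powr (p - 1)) \<longlongrightarrow> 0) (at 0)"
      using assms by (auto intro!: tendsto_eq_intros)
    show "\<forall>\<^sub>F h::real in at 0. \<bar>h\<bar> powr (p - 1) = \<bar>\<bar>h\<bar> powr p / h\<bar>"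
      by (auto simp: eventually_at_filter powr_diff abs_divide)
  qed
  thus ?thesis using True assms by (simp add: has_field_derivative_iff)
qed

lemma continuous_score: 
  assumes "m \<ge> 1"
  shows "continuous_on UNIV (score m \<mu>)"
proof -
  have "isCont (\<lambda>t::real. sgn t * \<bar>t\<bar> powr (2 * m - 1)) t" for t
  proof (cases "t = 0")
    case False
    thus ?thesis by (auto intro!: continuous_intros)
  next
    case True
    have "((\<lambda>t::real. sgn t * \<bar>t\<bar> powr (2 * m - 1)) \<longlongrightarrow> 0) (at 0)"
    proof (rule tendsto_rabs_zero_cancel, rule Lim_transform_eventually)
      show "((\<lambda>h::real. \<bar>h\<bar> powr (2 * m - 1)) \<longlongrightarrow> 0) (at 0)"
        using assms by (auto intro!: tendsto_eq_intros)
      show "\<forall>\<^sub>F h::real in at 0. \<bar>h\<bar> powr (2 * m - 1) = \<bar>sgn h * \<bar>h\<bar> powr (2 * m - 1)\<bar>"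
        by (auto simp: eventually_at_filter abs_mult)
    qed
    thus ?thesis using True by (simp add: isCont_def)
  qed
  hence "continuous_on UNIV (\<lambda>t::real. sgn t * \<bar>t\<bar> powr (2 * m - 1))"
    by (simp add: continuous_at_imp_continuous_on)
  thus ?thesis unfolding score_def[abs_def] divide_inverse
    by (rule continuous_on_mult_right)
qed

lemma nu1_density_has_derivative:
  assumes "m \<ge> 1" "\<mu> > 0"
  shows "(nu1_density m \<mu> has_real_derivative - score m \<mu> t * nu1_density m \<mu> t) (at t)"
proof -
  have "((\<lambda>t. - (\<bar>t\<bar> powr (2 * m)) / (2 * m * \<mu>)) has_real_derivative - score m \<mu> t) (at t)"
    using DERIV_cmult[OF abs_powr_has_derivative[of "2 * m" t], of "- 1 / (2 * m * \<mu>)"] assms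
    by (simp add: score_def)
  from DERIV_cmult[OF DERIV_fun_exp[OF this], of "a_const m * \<mu> powr (- (1 / (2 * m)))"]
  show ?thesis by (simp add: nu1_density_def[abs_def] mult_ac)
qed

lemma nu1_density_tendsto_0:
  assumes "m \<ge> 1" "\<mu> > 0"
  shows "(nu1_density m \<mu> \<longlongrightarrow> 0) at_top" "(nu1_density m \<mu> \<longlongrightarrow> 0) at_bot"
proof -
  have a: "((\<lambda>s. a_const m * \<mu> powr (- (1 / (2 * m))) * exp (- (s powr (2 * m)) / (2 * m * \<mu>))) \<longlongrightarrow> 0) at_top"
  proof -
    have "filterlim (\<lambda>s. s powr (2 * m) * (1 / (2 * m * \<mu>))) at_top at_top"
    proof (rule filterlim_at_top_mono)
      show "filterlim (\<lambda>s::real. s * (1 / (2 * m * \<mu>))) at_top at_top"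
        using assms by (intro filterlim_at_top_mult_tendsto_pos[OF tendsto_const _ filterlim_ident]) auto
      have "s \<le> s powr (2 * m)" if "s \<ge> 1" for s
        using powr_mono[of 1 "2 * m" s] that assms by simp
      thus "\<forall>\<^sub>F s in at_top. s * (1 / (2 * m * \<mu>)) \<le> s powr (2 * m) * (1 / (2 * m * \<mu>))"
        using assms by (intro eventually_mono[OF eventually_ge_at_top[of 1]] mult_right_mono) auto
    qed
    hence "((\<lambda>s. exp (- (s powr (2 * m) * (1 / (2 * m * \<mu>))))) \<longlongrightarrow> 0) at_top"
      by (intro filterlim_compose[OF exp_at_bot] filterlim_uminus_at_bot[THEN iffD2]) simp
    from tendsto_mult_right_zero[OF this] show ?thesis by simp
  qed
  have "filterlim (abs::real \<Rightarrow> real) at_top at_top" "filterlim (abs::real \<Rightarrow> real) at_top at_bot"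
    using filterlim_abs_real by (auto simp: filterlim_at_bot_mirror)
  from this[THEN filterlim_compose[OF a]]
  show "(nu1_density m \<mu> \<longlongrightarrow> 0) at_top" "(nu1_density m \<mu> \<longlongrightarrow> 0) at_bot"
    by (simp_all add: nu1_density_def[abs_def])
qed

lemma integrable_score:
  assumes "m \<ge> 1" "\<mu> > 0"
  shows "integrable (nu1 m \<mu>) (score m \<mu>)"
proof (rule Bochner_Integration.integrable_bound)
  show "integrable (nu1 m \<mu>) (\<lambda>t. \<bar>t\<bar> powr (2 * m - 1) / \<mu>)"
    using nu1_moment[of m \<mu> "2 * m - 1"] assms by (auto simp: has_bochner_integral_iff)
  show "score m \<mu> \<in> borel_measurable (nu1 m \<mu>)"
    by (simp add: score_def[abs_def])
qed (use assms in \<open>auto simp: score_def abs_mult abs_sgn_eq\<close>)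

text \<open>The derivative of \<open>u\<close> times the density is the density times \<open>u' - u * score\<close>. As \<open>u\<close> is bounded
  and the density decays, the fundamental theorem of calculus on the whole line leaves no boundary
  term.\<close>

lemma nu1_integration_by_parts:
  fixes u u' :: "real \<Rightarrow> real"
  assumes "m \<ge> 1" "\<mu> > 0"
    and der: "\<And>t. (u has_real_derivative u' t) (at t)"
    and cont: "continuous_on UNIV u'"
    and bu: "\<And>t. \<bar>u t\<bar> \<le> B" and bu': "\<And>t. \<bar>u' t\<bar> \<le> B"
  shows "(\<integral>t. u' t \<partial>nu1 m \<mu>) = (\<integral>t. u t * score m \<mu> t \<partial>nu1 m \<mu>)"
proof -
  interpret prob_space "nu1 m \<mu>" using prob_space_nu1 assms by auto
  have contu: "continuous_on UNIV u"
    using der by (intro DERIV_continuous_on) (auto intro: DERIV_subset)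
  have [measurable]: "u \<in> borel_measurable borel" "u' \<in> borel_measurable borel"
    using contu cont by (auto intro: borel_measurable_continuous_onI)
  have score_meas [measurable]: "score m \<mu> \<in> borel_measurable borel"
    by (simp add: score_def[abs_def])
  have d0: "0 \<le> nu1_density m \<mu> t" for t using nu1_density_pos[of m \<mu> t] assms by simp
  have B: "0 \<le> B" using bu[of 0] by linarith
  have i1: "integrable (nu1 m \<mu>) u'"
    by (rule integrable_const_bound[where B=B]) (auto simp: bu')
  have i2: "integrable (nu1 m \<mu>) (\<lambda>t. u t * score m \<mu> t)"
  proof (rule Bochner_Integration.integrable_bound)
    show "integrable (nu1 m \<mu>) (\<lambda>t. B * score m \<mu> t)"
      using integrable_score assms by (intro integrable_mult_right) auto
    show "AE t in nu1 m \<mu>. norm (u t * score m \<mu> t) \<le> norm (B * score m \<mu> t)"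
      using B by (auto simp: abs_mult intro!: mult_right_mono bu)
  qed simp
  have I: "integrable (nu1 m \<mu>) (\<lambda>t. u' t - u t * score m \<mu> t)"
    using i1 i2 by auto
  hence I': "integrable lborel (\<lambda>t. nu1_density m \<mu> t * (u' t - u t * score m \<mu> t))"
    unfolding nu1_eq_density using d0 by (subst (asm) integrable_density) auto
  have bd: "((\<lambda>t. u t * nu1_density m \<mu> t) \<longlongrightarrow> 0) F" if "(nu1_density m \<mu> \<longlongrightarrow> 0) F" for F
  proof (rule Lim_null_comparison)
    show "\<forall>\<^sub>F t in F. norm (u t * nu1_density m \<mu> t) \<le> B * nu1_density m \<mu> t"
      using d0 bu by (intro always_eventually allI) (auto simp: abs_mult intro!: mult_right_mono)
    show "((\<lambda>t. B * nu1_density m \<mu> t) \<longlongrightarrow> 0) F"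
      using that by (rule tendsto_mult_right_zero)
  qed
  have "(LBINT t=-\<infinity>..\<infinity>. nu1_density m \<mu> t * (u' t - u t * score m \<mu> t)) = 0 - 0"
  proof (rule interval_integral_FTC_integrable[where F="\<lambda>t. u t * nu1_density m \<mu> t"])
    fix t :: real
    show "((\<lambda>t. u t * nu1_density m \<mu> t) has_vector_derivative nu1_density m \<mu> t * (u' t - u t * score m \<mu> t)) (at t)"
      unfolding has_real_derivative_iff_has_vector_derivative[symmetric]
      using assms by (auto intro!: derivative_eq_intros der nu1_density_has_derivative simp: algebra_simps)
    have "continuous_on UNIV (nu1_density m \<mu>)"
      using assms by (intro DERIV_continuous_on) (auto intro: DERIV_subset nu1_density_has_derivative)
    hence "continuous_on UNIV (\<lambda>t. nu1_density m \<mu> t * (u' t - u t * score m \<mu> t))"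
      by (intro continuous_intros contu cont continuous_score assms)
    thus "isCont (\<lambda>t. nu1_density m \<mu> t * (u' t - u t * score m \<mu> t)) t"
      by (simp add: continuous_on_eq_continuous_at)
  next
    show "set_integrable lborel (einterval (-\<infinity>) \<infinity>) (\<lambda>t. nu1_density m \<mu> t * (u' t - u t * score m \<mu> t))"
      using I' by (simp add: set_integrable_def)
    show "(((\<lambda>t. u t * nu1_density m \<mu> t) \<circ> real_of_ereal) \<longlongrightarrow> 0) (at_right (-\<infinity>))"
      unfolding ereal_tendsto_simps using bd nu1_density_tendsto_0 assms by blast
    show "(((\<lambda>t. u t * nu1_density m \<mu> t) \<circ> real_of_ereal) \<longlongrightarrow> 0) (at_left \<infinity>)"
      unfolding ereal_tendsto_simps using bd nu1_density_tendsto_0 assms by blast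
  qed simp
  hence "(\<integral>t. nu1_density m \<mu> t * (u' t - u t * score m \<mu> t) \<partial>lborel) = 0"
    by (simp add: interval_lebesgue_integral_def set_lebesgue_integral_def)
  hence "(\<integral>t. u' t - u t * score m \<mu> t \<partial>nu1 m \<mu>) = 0"
    unfolding nu1_eq_density using d0 by (subst integral_density) auto
  thus ?thesis using i1 i2 by simp
qed

section \<open>Orthonormal bases and diagonal operators\<close>

locale orthonormal_basis =
  fixes e :: "nat \<Rightarrow> 'a::{real_inner, banach, second_countable_topology}"
  assumes orth: "\<And>i j. e i \<bullet> e j = (if i = j then 1 else 0)"
    and dense: "closure (span (range e)) = UNIV"
begin

definition ell2 :: "(nat \<Rightarrow> real) set" where
  "ell2 = {\<xi>. summable (\<lambda>h. (\<xi> h)\<^sup>2)}"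

text \<open>The inverse of the coordinate map; outside \<open>ell2\<close> the series diverges and the value is arbitrary.\<close>

definition synth :: "(nat \<Rightarrow> real) \<Rightarrow> 'a" where
  "synth \<xi> = (\<Sum>h. \<xi> h *\<^sub>R e h)"

lemma norm_e [simp]: "norm (e i) = 1"
  by (simp add: norm_eq_sqrt_inner orth)

lemma norm_sum_e:
  assumes "finite I"
  shows "(norm (\<Sum>h\<in>I. \<xi> h *\<^sub>R e h))\<^sup>2 = (\<Sum>h\<in>I. (\<xi> h)\<^sup>2)"
  unfolding power2_norm_eq_inner using assms
  by (simp add: inner_sum_left inner_sum_right orth power2_eq_square if_distrib cong: if_cong)

text \<open>By orthogonality the squared norm of a block of the series is the corresponding block of
  \<open>\<Sum>h. (\<xi> h)\<^sup>2\<close>, so the Cauchy criterion carries over.\<close>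

lemma summable_synth:
  assumes "\<xi> \<in> ell2"
  shows "summable (\<lambda>h. \<xi> h *\<^sub>R e h)"
  unfolding summable_Cauchy
proof (intro allI impI)
  fix \<epsilon> :: real assume "\<epsilon> > 0"
  hence "\<epsilon>\<^sup>2 > 0" by simp
  with assms obtain N where N: "\<forall>m\<ge>N. \<forall>n. norm (\<Sum>h=m..<n. (\<xi> h)\<^sup>2) < \<epsilon>\<^sup>2"
    unfolding ell2_def mem_Collect_eq summable_Cauchy by blast
  have "norm (\<Sum>h=m..<n. \<xi> h *\<^sub>R e h) < \<epsilon>" if "m \<ge> N" for m n
  proof -
    have "(norm (\<Sum>h=m..<n. \<xi> h *\<^sub>R e h))\<^sup>2 < \<epsilon>\<^sup>2"
      using N that by (subst norm_sum_e) (auto simp: sum_nonneg)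
    thus ?thesis using \<open>\<epsilon> > 0\<close> by (auto intro: power_less_imp_less_base)
  qed
  thus "\<exists>N. \<forall>m\<ge>N. \<forall>n. norm (\<Sum>h=m..<n. \<xi> h *\<^sub>R e h) < \<epsilon>" by blast
qed

lemma synth_inner:
  assumes "\<xi> \<in> ell2"
  shows "synth \<xi> \<bullet> e i = \<xi> i"
proof -
  have "(\<lambda>h. (\<xi> h *\<^sub>R e h) \<bullet> e i) sums (synth \<xi> \<bullet> e i)"
    unfolding synth_def
    by (rule bounded_linear.sums[OF bounded_linear_inner_left summable_sums[OF summable_synth[OF assms]]])
  moreover have "(\<lambda>h. (\<xi> h *\<^sub>R e h) \<bullet> e i) = (\<lambda>h. if h = i then \<xi> h else 0)"
    by (auto simp: orth)
  ultimately show ?thesis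
    using sums_single[of i \<xi>] by (auto intro: sums_unique2)
qed

lemma eq_0_if_orthogonal:
  assumes "\<And>i. x \<bullet> e i = 0"
  shows "x = 0"
proof -
  have "span (range e) \<subseteq> {y. x \<bullet> y = 0}"
    by (rule span_minimal) (use assms in \<open>auto simp: subspace_def inner_add_right\<close>)
  hence "closure (span (range e)) \<subseteq> {y. x \<bullet> y = 0}"
    by (rule closure_minimal) (intro closed_Collect_eq continuous_intros)
  hence "x \<bullet> x = 0" using dense by blast
  thus ?thesis by simp
qed

lemma eq_if_coords_eq:
  assumes "\<And>i. x \<bullet> e i = y \<bullet> e i"
  shows "x = y"
  using eq_0_if_orthogonal[of "x - y"] assms by (simp add: inner_diff_left)

text \<open>Bessel's inequality.\<close>

lemma coords_ell2: "(\<lambda>h. x \<bullet> e h) \<in> ell2"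
  unfolding ell2_def mem_Collect_eq
proof (rule summableI_nonneg_bounded)
  fix n
  let ?s = "\<Sum>h<n. (x \<bullet> e h) *\<^sub>R e h"
  have "(norm (x - ?s))\<^sup>2 = (norm x)\<^sup>2 - 2 * (x \<bullet> ?s) + (norm ?s)\<^sup>2"
    by (simp add: power2_norm_eq_inner inner_diff_left inner_diff_right inner_commute)
  also have "x \<bullet> ?s = (\<Sum>h<n. (x \<bullet> e h)\<^sup>2)"
    by (simp add: inner_sum_right power2_eq_square)
  also have "(norm ?s)\<^sup>2 = (\<Sum>h<n. (x \<bullet> e h)\<^sup>2)"
    by (rule norm_sum_e) simp
  finally show "(\<Sum>h<n. (x \<bullet> e h)\<^sup>2) \<le> (norm x)\<^sup>2"
    using zero_le_power2[of "norm (x - ?s)"] by linarith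
qed simp

text \<open>Both sides have the same coordinates, and by density of the span a vector orthogonal to every
  \<open>e i\<close> vanishes; this is the completeness half of Parseval's identity.\<close>

lemma synth_coords: "synth (\<lambda>h. x \<bullet> e h) = x"
  by (rule eq_if_coords_eq) (simp add: synth_inner coords_ell2)

lemma expansion: "(\<lambda>h. (x \<bullet> e h) *\<^sub>R e h) sums x"
  using summable_sums[OF summable_synth[OF coords_ell2[of x]]] synth_coords[of x]
  by (simp add: synth_def)

lemma inner_sums: "(\<lambda>h. (x \<bullet> e h) * (y \<bullet> e h)) sums (x \<bullet> y)"
  using bounded_linear.sums[OF bounded_linear_inner_right expansion[of y], of x]
  by (simp add: mult_ac)

lemma norm_sums: "(\<lambda>h. (x \<bullet> e h)\<^sup>2) sums (norm x)\<^sup>2"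
  using inner_sums[of x x] by (simp add: power2_eq_square[of "x \<bullet> _"] power2_norm_eq_inner)

lemma synth_measurable:
  assumes "\<And>h. sets (N h) = sets borel"
  shows "synth \<in> borel_measurable (\<Pi>\<^sub>M h\<in>UNIV. N h)"
proof -
  have [measurable]: "(\<lambda>\<xi>. \<xi> h) \<in> borel_measurable (\<Pi>\<^sub>M h\<in>UNIV. N h)" for h
    by (rule measurable_cong_sets[OF refl assms, THEN equalityD1, THEN subsetD])
       (rule measurable_component_singleton, simp)
  show ?thesis unfolding synth_def[abs_def] by measurable
qed

text \<open>The definite description of the square root denotes something only if a positive root exists and
  is unique. Existence is the diagonal operator with entries \<open>sqrt (lam h)\<close>. Uniqueness is
  elementary: if \<open>T\<close> is another root and \<open>v = T (e h) - sqrt (lam h) *\<^sub>R e h\<close>, then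
  \<open>(T + sqrt (lam h)) v = 0\<close>, that is, \<open>T v\<close> is a negative multiple of \<open>v\<close>; positivity of \<open>T\<close>
  forces \<open>v = 0\<close>.\<close>

lemma sqrt_op_diagonal:
  assumes lam: "\<And>h. lam h > 0" and sm: "summable lam"
    and Q: "\<And>x. Q x = (\<Sum>h. (lam h * (x \<bullet> e h)) *\<^sub>R e h)"
  shows "bounded_linear (sqrt_op Q)" "sqrt_op Q x \<bullet> e h = sqrt (lam h) * (x \<bullet> e h)"
proof -
  define L where "L = suminf lam"
  have lamL: "lam h \<le> L" for h
    unfolding L_def using sum_le_suminf[OF sm, of "{h}"] lam by (auto intro: less_imp_le)
  have L0: "L \<ge> 0" using lamL[of 0] lam[of 0] by linarith
  have bd: "(c h * (x \<bullet> e h))\<^sup>2 \<le> K\<^sup>2 * (x \<bullet> e h)\<^sup>2" if "\<bar>c h\<bar> \<le> K" for c x K h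
    using power_mono[OF that abs_ge_zero, of 2]
    by (simp add: power_mult_distrib mult_right_mono)
  have l2: "(\<lambda>h. c h * (x \<bullet> e h)) \<in> ell2" if "\<And>h. \<bar>c h\<bar> \<le> K" for c x K
  proof -
    have "summable (\<lambda>h. K\<^sup>2 * (x \<bullet> e h)\<^sup>2)"
      using norm_sums by (intro summable_mult) (auto simp: sums_iff)
    thus ?thesis unfolding ell2_def mem_Collect_eq
      by (rule summable_comparison_test'[where N=0]) (use bd[of c _ K] that in auto)
  qed
  have Qc: "Q x \<bullet> e h = lam h * (x \<bullet> e h)" for x h
    using synth_inner[OF l2[of lam L x], of h] lamL lam
    by (simp add: Q synth_def abs_of_pos)
  define R where "R = (\<lambda>x. synth (\<lambda>h. sqrt (lam h) * (x \<bullet> e h)))"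
  have Rl2: "(\<lambda>h. sqrt (lam h) * (x \<bullet> e h)) \<in> ell2" for x
    by (rule l2[where K="sqrt L"]) (use lamL lam in \<open>auto simp: abs_of_nonneg less_imp_le\<close>)
  have Rc: "R x \<bullet> e h = sqrt (lam h) * (x \<bullet> e h)" for x h
    unfolding R_def by (rule synth_inner[OF Rl2])
  have Rbl: "bounded_linear R"
  proof (rule bounded_linear_intro[where K="sqrt L"])
    fix x
    have "(norm (R x))\<^sup>2 \<le> L * (norm x)\<^sup>2"
    proof (rule sums_le)
      show "(\<lambda>h. (R x \<bullet> e h)\<^sup>2) sums (norm (R x))\<^sup>2" by (rule norm_sums)
      show "(\<lambda>h. L * (x \<bullet> e h)\<^sup>2) sums (L * (norm x)\<^sup>2)" by (intro sums_mult norm_sums)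
      show "(R x \<bullet> e h)\<^sup>2 \<le> L * (x \<bullet> e h)\<^sup>2" for h
        using lam[of h] lamL[of h] by (auto simp: Rc power_mult_distrib intro!: mult_right_mono)
    qed
    hence "sqrt ((norm (R x))\<^sup>2) \<le> sqrt (L * (norm x)\<^sup>2)" by (rule real_sqrt_le_mono)
    thus "norm (R x) \<le> norm x * sqrt L" by (simp add: real_sqrt_mult mult.commute)
  qed (rule eq_if_coords_eq; simp add: Rc inner_add_left distrib_left)+
  have Rprops: "bounded_linear R \<and> (\<forall>x y. R x \<bullet> y = x \<bullet> R y) \<and> (\<forall>x. 0 \<le> R x \<bullet> x) \<and> (\<forall>x. R (R x) = Q x)"
  proof (intro conjI allI)
    show "R x \<bullet> y = x \<bullet> R y" for x y
      using inner_sums[of "R x" y] inner_sums[of x "R y"] by (auto simp: Rc mult_ac intro: sums_unique2)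
    show "0 \<le> R x \<bullet> x" for x
      by (rule sums_le[OF _ sums_zero inner_sums[of "R x" x]])
         (use lam in \<open>auto simp: Rc mult.assoc less_imp_le\<close>)
    show "R (R x) = Q x" for x
      by (rule eq_if_coords_eq) (use lam in \<open>auto simp: Rc Qc less_imp_le simp flip: mult.assoc\<close>)
  qed (rule Rbl)
  have uniq: "T = R" if T: "bounded_linear T" "\<forall>x y. T x \<bullet> y = x \<bullet> T y" "\<forall>x. 0 \<le> T x \<bullet> x" "\<forall>x. T (T x) = Q x" for T
  proof -
    interpret T: bounded_linear T by fact
    have Te: "T (e h) = sqrt (lam h) *\<^sub>R e h" for h
    proof -
      define s where "s = sqrt (lam h)"
      have s: "s > 0" "s * s = lam h" using lam[of h] by (auto simp: s_def less_imp_le)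
      \<comment> \<open>The defect of \<open>e h\<close> as an eigenvector of \<open>T\<close> is an eigenvector for \<open>- s\<close>.\<close>
      define v where "v = T (e h) - s *\<^sub>R e h"
      have "Q (e h) = lam h *\<^sub>R e h"
        by (rule eq_if_coords_eq) (auto simp: Qc orth)
      hence "T v = - s *\<^sub>R v"
        using T(4) s by (simp add: v_def T.diff T.scaleR scaleR_diff_right)
      hence "0 \<le> - s * (v \<bullet> v)" using T(3) by (metis inner_scaleR_left)
      hence "v \<bullet> v \<le> 0" using s by (simp add: mult_le_0_iff zero_le_mult_iff)
      hence "v = 0" using inner_ge_zero[of v] by (metis antisym inner_eq_zero_iff)
      thus ?thesis by (simp add: v_def s_def)
    qed
    show "T = R"
    proof (rule ext, rule eq_if_coords_eq)
      show "T x \<bullet> e i = R x \<bullet> e i" for x i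
        using T(2) by (simp add: Te Rc)
    qed
  qed
  have "sqrt_op Q = R"
    unfolding sqrt_op_def by (rule the_equality) (use Rprops uniq in blast)+
  thus "bounded_linear (sqrt_op Q)" "sqrt_op Q x \<bullet> e h = sqrt (lam h) * (x \<bullet> e h)"
    using Rbl Rc by auto
qed

definition coord_cylinders :: "'a set set" where
  "coord_cylinders = {{x. \<forall>k\<in>K. a k < x \<bullet> e k} |K a. finite K}"

lemma Int_stable_coord_cylinders: "Int_stable coord_cylinders"
  unfolding Int_stable_def
proof (intro ballI)
  fix A B assume "A \<in> coord_cylinders" "B \<in> coord_cylinders"
  then obtain K a L b where A: "A = {x. \<forall>k\<in>K. a k < x \<bullet> e k}" "finite K"
    and B: "B = {x. \<forall>k\<in>L. b k < x \<bullet> e k}" "finite L"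
    unfolding coord_cylinders_def by blast
  define c where "c k = (if k \<in> K then if k \<in> L then max (a k) (b k) else a k else b k)" for k
  have "c k < t \<longleftrightarrow> (k \<in> K \<longrightarrow> a k < t) \<and> (k \<in> L \<longrightarrow> b k < t)" if "k \<in> K \<union> L" for k t
    using that by (auto simp: c_def)
  hence "A \<inter> B = {x. \<forall>k\<in>K \<union> L. c k < x \<bullet> e k}"
    unfolding A B by blast
  thus "A \<inter> B \<in> coord_cylinders"
    using A B unfolding coord_cylinders_def by blast
qed

text \<open>The identity is the pointwise limit of the partial sums of the basis expansion, hence measurable
  with respect to the sigma-algebra generated by the coordinates.\<close>

lemma sets_borel_eq_coord_cylinders: "sets (borel :: 'a measure) = sigma_sets UNIV coord_cylinders"
proof
  have "A \<in> sets borel" if "A \<in> coord_cylinders" for A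
  proof -
    from that obtain K a where A: "A = {x. \<forall>k\<in>K. a k < x \<bullet> e k}" "finite K"
      unfolding coord_cylinders_def by blast
    have "open (\<Inter>k\<in>K. {x. a k < x \<bullet> e k})"
      using A(2) by (intro open_INT ballI open_Collect_less continuous_intros)
    also have "(\<Inter>k\<in>K. {x. a k < x \<bullet> e k}) = A" using A(1) by auto
    finally show ?thesis by (rule borel_open)
  qed
  thus "sigma_sets UNIV coord_cylinders \<subseteq> sets (borel :: 'a measure)"
    using sets.sigma_sets_subset[of coord_cylinders "borel :: 'a measure"] by auto
  define S where "S = sigma UNIV coord_cylinders"
  have S: "space S = UNIV" "sets S = sigma_sets UNIV coord_cylinders"
    by (auto simp: S_def)
  have coord_meas: "(\<lambda>x. x \<bullet> e k) \<in> borel_measurable S" for k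
    unfolding borel_measurable_iff_greater
  proof
    fix a
    have "{w. a < w \<bullet> e k} = {w. \<forall>j\<in>{k}. (\<lambda>_. a) j < w \<bullet> e j} \<and> finite {k}" by simp
    hence "{w. a < w \<bullet> e k} \<in> coord_cylinders"
      unfolding coord_cylinders_def by (intro CollectI exI[of _ "{k}"] exI[of _ "\<lambda>_. a"])
    thus "{w \<in> space S. a < w \<bullet> e k} \<in> sets S" unfolding S by auto
  qed
  have "(\<lambda>x. \<Sum>h. (x \<bullet> e h) *\<^sub>R e h) \<in> borel_measurable S"
    by (intro borel_measurable_suminf borel_measurable_scaleR borel_measurable_const coord_meas)
  also have "(\<lambda>x. \<Sum>h. (x \<bullet> e h) *\<^sub>R e h) = (\<lambda>x. x)"
    using expansion by (auto simp: sums_iff)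
  finally have id: "(\<lambda>x. x) \<in> borel_measurable S" .
  show "sets (borel :: 'a measure) \<subseteq> sigma_sets UNIV coord_cylinders"
  proof
    fix A assume "A \<in> sets (borel :: 'a measure)"
    from measurable_sets[OF id this] show "A \<in> sigma_sets UNIV coord_cylinders"
      by (simp add: S)
  qed
qed

text \<open>The sets over which \<open>D\<close> integrates to zero form a Dynkin system containing an intersection-stable
  generator of the Borel sets. Testing with the sets where \<open>D\<close> is positive or negative finishes the
  argument.\<close>

lemma AE_eq_0_if_cylinder_integrals:
  fixes D :: "'a \<Rightarrow> real"
  assumes int: "integrable \<nu> D" and sets: "sets \<nu> = sets borel"
    and cyl: "\<And>A. A \<in> coord_cylinders \<Longrightarrow> (\<integral>x. indicator A x * D x \<partial>\<nu>) = 0"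
  shows "AE x in \<nu>. D x = 0"
proof -
  have D_meas [measurable]: "D \<in> borel_measurable borel"
    using borel_measurable_integrable[OF int] measurable_cong_sets[OF sets refl] by blast
  have intA: "integrable \<nu> (\<lambda>x. indicator A x * D x)" if "A \<in> sets borel" for A
    using integrable_mult_indicator[of A \<nu> D] that int by (simp add: sets)
  have UN: "UNIV \<in> coord_cylinders" unfolding coord_cylinders_def by (rule CollectI, rule exI[of _ "{}"]) auto
  have sub: "coord_cylinders \<subseteq> Pow UNIV" by auto
  have all: "(\<integral>x. indicator A x * D x \<partial>\<nu>) = 0" if "A \<in> sigma_sets UNIV coord_cylinders" for A
    using Int_stable_coord_cylinders sub that
  proof (induction rule: sigma_sets_induct_disjoint)
    case (basic A) thus ?case by (rule cyl)
  next
    case empty thus ?case by simp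
  next
    case (compl A)
    hence A: "A \<in> sets borel" using sets_borel_eq_coord_cylinders by auto
    have "(\<lambda>x. indicator (UNIV - A) x * D x) = (\<lambda>x. D x - indicator A x * D x)"
      by (auto simp: indicator_def)
    thus ?case using compl intA[OF A] int cyl[OF UN] by simp
  next
    case (union A)
    hence A: "A i \<in> sets borel" for i using sets_borel_eq_coord_cylinders by auto
    have "(\<lambda>n. \<integral>x. indicator (\<Union>i<n. A i) x * D x \<partial>\<nu>) \<longlonglongrightarrow> (\<integral>x. indicator (\<Union>i. A i) x * D x \<partial>\<nu>)"
    proof (rule integral_dominated_convergence)
      show "integrable \<nu> (\<lambda>x. norm (D x))" using int by simp
      show "AE x in \<nu>. (\<lambda>n. indicator (\<Union>i<n. A i) x * D x) \<longlonglongrightarrow> indicator (\<Union>i. A i) x * D x"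
        by (intro AE_I2 tendsto_mult_right LIMSEQ_indicator_UN)
      show "AE x in \<nu>. norm (indicator (\<Union>i<n. A i) x * D x) \<le> norm (D x)" for n
        by (auto simp: indicator_def)
      show "(\<lambda>x. indicator (\<Union>i. A i) x * D x) \<in> borel_measurable \<nu>"
        using A by (intro borel_measurable_integrable intA) auto
      show "(\<lambda>x. indicator (\<Union>i<n. A i) x * D x) \<in> borel_measurable \<nu>" for n
        using A by (intro borel_measurable_integrable intA) auto
    qed
    moreover have "(\<integral>x. indicator (\<Union>i<n. A i) x * D x \<partial>\<nu>) = 0" for n
    proof -
      have "(\<lambda>x. indicator (\<Union>i<n. A i) x * D x) = (\<lambda>x. \<Sum>i<n. indicator (A i) x * D x)"
      proof
        fix x
        have "disjoint_family_on A {..<n}"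
          using union by (auto simp: disjoint_family_on_def)
        thus "indicator (\<Union>i<n. A i) x * D x = (\<Sum>i<n. indicator (A i) x * D x)"
          by (subst indicator_UN_disjoint) (auto simp: sum_distrib_right)
      qed
      hence "(\<integral>x. indicator (\<Union>i<n. A i) x * D x \<partial>\<nu>) = (\<integral>x. (\<Sum>i<n. indicator (A i) x * D x) \<partial>\<nu>)"
        by (simp only:)
      also have "\<dots> = (\<Sum>i<n. \<integral>x. indicator (A i) x * D x \<partial>\<nu>)"
        by (rule Bochner_Integration.integral_sum) (rule intA[OF A])
      also have "\<dots> = 0" using union by simp
      finally show ?thesis .
    qed
    ultimately show ?case by (simp add: LIMSEQ_const_iff)
  qed
  have all': "(\<integral>x. indicator A x * D x \<partial>\<nu>) = 0" if "A \<in> sets borel" for A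
    using all that sets_borel_eq_coord_cylinders by auto
  define P where "P = {x \<in> space borel. D x > 0}"
  define N where "N = {x \<in> space borel. D x < 0}"
  have PN [measurable]: "P \<in> sets borel" "N \<in> sets borel" unfolding P_def N_def by measurable
  have "AE x in \<nu>. indicator P x * D x = 0"
  proof (rule integral_nonneg_eq_0_iff_AE[THEN iffD1, OF intA[OF PN(1)] _ all'[OF PN(1)]])
    show "AE x in \<nu>. 0 \<le> indicator P x * D x" by (rule AE_I2) (simp add: P_def indicator_def)
  qed
  moreover have "AE x in \<nu>. - (indicator N x * D x) = 0"
  proof (rule integral_nonneg_eq_0_iff_AE[THEN iffD1])
    show "integrable \<nu> (\<lambda>x. - (indicator N x * D x))" using intA[OF PN(2)] by simp
    show "AE x in \<nu>. 0 \<le> - (indicator N x * D x)" by (rule AE_I2) (simp add: N_def indicator_def)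
    show "(\<integral>x. - (indicator N x * D x) \<partial>\<nu>) = 0" using all'[OF PN(2)] by simp
  qed
  ultimately show ?thesis
    by eventually_elim (auto simp: P_def N_def indicator_def split: if_splits)
qed

end

section \<open>Moments of the product measure\<close>

text \<open>Jensen's inequality for a convergent weighted series. Using the tangent of \<open>t ^ k\<close> at the weighted
  mean \<open>a\<close>, which Bernoulli's inequality provides, the comparison can be summed termwise over the infinite
  index set.\<close>

lemma power_mean_le:
  fixes w y :: "nat \<Rightarrow> real"
  assumes w: "\<And>h. w h \<ge> 0" "summable w" "suminf w > 0" and y: "\<And>h. y h \<ge> 0"
    and sm: "summable (\<lambda>h. w h * y h)" "summable (\<lambda>h. w h * y h ^ k)"
  shows "(\<Sum>h. w h * y h) ^ k * suminf w \<le> suminf w ^ k * (\<Sum>h. w h * y h ^ k)"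
proof -
  define W where "W = suminf w"
  define a where "a = (\<Sum>h. w h * y h) / W"
  have W: "W > 0" using w(3) by (simp add: W_def)
  have B: "(\<Sum>h. w h * y h) = a * W" using W by (simp add: a_def)
  have a: "a \<ge> 0" unfolding a_def using W w y sm(1) by (intro divide_nonneg_pos suminf_nonneg) auto
  have "a ^ k * W \<le> (\<Sum>h. w h * y h ^ k)"
  proof (cases "a = 0")
    case True
    show ?thesis
    proof (cases "k = 0")
      case False
      have "0 \<le> (\<Sum>h. w h * y h ^ k)" using w y sm(2) by (intro suminf_nonneg) auto
      thus ?thesis using True False by (simp add: zero_power)
    qed (simp add: W_def)
  next
    case False
    hence a0: "a > 0" using a by simp
    \<comment> \<open>The slope \<open>k * a ^ (k - 1)\<close> is written as \<open>k * a ^ k / a\<close>, which is free of truncated subtraction.\<close>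
    have tangent: "a ^ k + k * a ^ k / a * (t - a) \<le> t ^ k" if "t \<ge> 0" for t
    proof -
      have "1 + k * (t / a - 1) \<le> (1 + (t / a - 1)) ^ k"
        using that a0 by (intro Bernoulli_inequality) auto
      hence "a ^ k * (1 + k * (t / a - 1)) \<le> a ^ k * (t / a) ^ k"
        using a0 by (intro mult_left_mono) auto
      also have "a ^ k * (t / a) ^ k = t ^ k" using a0 by (simp add: power_divide)
      also have "a ^ k * (1 + k * (t / a - 1)) = a ^ k + k * a ^ k / a * (t - a)"
        using a0 by (simp add: field_simps)
      finally show ?thesis .
    qed
    define c where "c = k * a ^ k / a"
    have "(\<lambda>h. w h * a ^ k + c * (w h * y h - w h * a)) sums (W * a ^ k + c * (a * W - W * a))"
      using sm(1) w(2) B unfolding W_def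
      by (intro sums_add sums_mult sums_diff sums_mult2 summable_sums) (auto simp: sums_iff)
    moreover have "(\<lambda>h. w h * y h ^ k) sums (\<Sum>h. w h * y h ^ k)" using sm(2) by (rule summable_sums)
    moreover have "w h * a ^ k + c * (w h * y h - w h * a) \<le> w h * y h ^ k" for h
    proof -
      have "w h * (a ^ k + c * (y h - a)) \<le> w h * y h ^ k"
        unfolding c_def by (rule mult_left_mono[OF tangent[OF y] w(1)])
      also have "w h * (a ^ k + c * (y h - a)) = w h * a ^ k + c * (w h * y h - w h * a)"
        by algebra
      finally show ?thesis .
    qed
    ultimately have "W * a ^ k + c * (a * W - W * a) \<le> (\<Sum>h. w h * y h ^ k)"
      by (rule sums_le[rotated])
    thus ?thesis by (simp only: mult.commute[of a W] mult.commute[of "a ^ k" W] diff_self mult_zero_right add_0_right)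
  qed
  hence "W ^ k * (a ^ k * W) \<le> W ^ k * (\<Sum>h. w h * y h ^ k)"
    using W by (intro mult_left_mono) auto
  moreover have "(\<Sum>h. w h * y h) ^ k * W = W ^ k * (a ^ k * W)"
    unfolding B by (simp only: power_mult_distrib mult_ac)
  ultimately show ?thesis by (simp only: W_def)
qed

text \<open>Tonelli: the expectation of the series is at most \<open>K\<close> times the sum of the weights.\<close>

lemma AE_summable_weighted:
  fixes w :: "nat \<Rightarrow> real" and Y :: "nat \<Rightarrow> 'b \<Rightarrow> real"
  assumes w: "\<And>h. w h \<ge> 0" "summable w" and Y: "\<And>h x. Y h x \<ge> 0"
    and int: "\<And>h. integrable M (Y h)" and bd: "\<And>h. (\<integral>x. Y h x \<partial>M) \<le> K"
  shows "AE x in M. summable (\<lambda>h. w h * Y h x)"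
    and "integrable M (\<lambda>x. \<Sum>h. w h * Y h x)"
proof -
  have [measurable]: "Y h \<in> borel_measurable M" for h using int by auto
  have smK: "summable (\<lambda>h. w h * (\<integral>x. Y h x \<partial>M))"
  proof (rule summable_comparison_test'[where N=0])
    show "summable (\<lambda>h. w h * K)" using w(2) by (rule summable_mult2)
    show "norm (w h * (\<integral>x. Y h x \<partial>M)) \<le> w h * K" for h
      using w Y bd by (auto simp: abs_mult intro!: mult_left_mono)
  qed
  have "(\<integral>\<^sup>+x. (\<Sum>h. ennreal (w h * Y h x)) \<partial>M) = (\<Sum>h. \<integral>\<^sup>+x. ennreal (w h * Y h x) \<partial>M)"
    by (rule nn_integral_suminf) measurable
  also have "\<dots> = (\<Sum>h. ennreal (w h * (\<integral>x. Y h x \<partial>M)))"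
    using int w Y by (subst nn_integral_eq_integral) auto
  also have "\<dots> = ennreal (\<Sum>h. w h * (\<integral>x. Y h x \<partial>M))"
    using smK w Y by (intro suminf_ennreal2) auto
  finally have "(\<integral>\<^sup>+x. (\<Sum>h. ennreal (w h * Y h x)) \<partial>M) \<noteq> \<infinity>" by simp
  hence "AE x in M. (\<Sum>h. ennreal (w h * Y h x)) \<noteq> \<infinity>"
    by (intro nn_integral_noteq_infinite) auto
  thus *: "AE x in M. summable (\<lambda>h. w h * Y h x)"
    by eventually_elim (rule summable_suminf_not_top, use w Y in auto)
  show "integrable M (\<lambda>x. \<Sum>h. w h * Y h x)"
  proof (rule integrable_suminf)
    show "AE x in M. summable (\<lambda>h. norm (w h * Y h x))"
      using * w Y by (simp add: abs_mult)
    show "summable (\<lambda>h. \<integral>x. norm (w h * Y h x) \<partial>M)"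
      using smK w Y by (simp add: abs_mult)
  qed (use int in auto)
qed

text \<open>By \<open>power_mean_le\<close> the power of the sum is dominated by the weighted sum of the powers, which is
  integrable as soon as the powers have uniformly bounded expectations.\<close>

lemma integrable_power_weighted_sum:
  fixes w :: "nat \<Rightarrow> real" and Y :: "nat \<Rightarrow> 'b \<Rightarrow> real" and K :: "nat \<Rightarrow> real"
  assumes w: "\<And>h. w h > 0" "summable w" and Y: "\<And>h x. Y h x \<ge> 0"
    and meas [measurable]: "\<And>h. Y h \<in> borel_measurable M"
    and int: "\<And>h k::nat. k > 0 \<Longrightarrow> integrable M (\<lambda>x. Y h x ^ k)"
    and bd: "\<And>h k. k > 0 \<Longrightarrow> (\<integral>x. Y h x ^ k \<partial>M) \<le> K k"
    and k: "k > 0"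
  shows "integrable M (\<lambda>x. (\<Sum>h. w h * Y h x) ^ k)"
proof -
  have w0: "w h \<ge> 0" for h using w(1)[of h] by simp
  have W: "suminf w > 0" by (rule suminf_pos[OF w(2,1)])
  have Yk: "Y h x ^ k \<ge> 0" for h x using Y by simp
  have 1: "AE x in M. summable (\<lambda>h. w h * Y h x)"
    using AE_summable_weighted(1)[OF w0 w(2) Y, where M=M and K="K 1"] int[of 1] bd[of 1] by simp
  have 2: "AE x in M. summable (\<lambda>h. w h * Y h x ^ k)"
    using AE_summable_weighted(1)[OF w0 w(2) Yk int[OF k] bd[OF k]] .
  have 3: "integrable M (\<lambda>x. \<Sum>h. w h * Y h x ^ k)"
    using AE_summable_weighted(2)[OF w0 w(2) Yk int[OF k] bd[OF k]] .
  show ?thesis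
  proof (rule Bochner_Integration.integrable_bound)
    show "integrable M (\<lambda>x. suminf w ^ k / suminf w * (\<Sum>h. w h * Y h x ^ k))"
      using 3 by (rule integrable_mult_right)
    show "AE x in M. norm ((\<Sum>h. w h * Y h x) ^ k)
            \<le> norm (suminf w ^ k / suminf w * (\<Sum>h. w h * Y h x ^ k))"
      using 1 2
    proof eventually_elim
      case (elim x)
      have nn: "(\<Sum>h. w h * Y h x) \<ge> 0" "(\<Sum>h. w h * Y h x ^ k) \<ge> 0"
        using elim w0 Y by (auto intro!: suminf_nonneg)
      have "(\<Sum>h. w h * Y h x) ^ k * suminf w \<le> suminf w ^ k * (\<Sum>h. w h * Y h x ^ k)"
        using elim by (intro power_mean_le w0 w(2) W Y)
      hence "(\<Sum>h. w h * Y h x) ^ k \<le> suminf w ^ k / suminf w * (\<Sum>h. w h * Y h x ^ k)"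
        using W by (simp add: field_simps)
      moreover have "0 \<le> suminf w ^ k / suminf w * (\<Sum>h. w h * Y h x ^ k)"
        using nn W by simp
      ultimately show ?case using nn by (simp only: real_norm_def abs_of_nonneg zero_le_power)
    qed
  qed measurable
qed

lemma powr_le_1_plus_power:
  fixes z p :: real
  assumes "z \<ge> 0" "0 \<le> p" "p \<le> real k"
  shows "z powr p \<le> 1 + z ^ k"
proof (cases "z \<le> 1")
  case True
  hence "z powr p \<le> 1 powr p" using assms by (intro powr_mono2) auto
  thus ?thesis using assms by (simp add: add_increasing2)
next
  case False
  hence "z powr p \<le> z powr real k" using assms by (intro powr_mono) auto
  also have "\<dots> = z ^ k" using False by (simp add: powr_realpow)
  finally show ?thesis by simp
qed

lemma (in prob_space) integrable_powr_if_powers: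
  assumes [measurable]: "f \<in> borel_measurable M" and f: "\<And>x. f x \<ge> (0::real)"
    and int: "\<And>k::nat. k > 0 \<Longrightarrow> integrable M (\<lambda>x. f x ^ k)" and p: "p \<ge> 0"
  shows "integrable M (\<lambda>x. f x powr p)"
proof -
  obtain k :: nat where "p + 1 \<le> real k" using real_arch_simple by blast
  hence k: "p \<le> real k" "k > 0" using p by (auto intro: gr0I)
  show ?thesis
  proof (rule Bochner_Integration.integrable_bound)
    show "integrable M (\<lambda>x. 1 + f x ^ k)" using int[OF k(2)] by simp
    show "AE x in M. norm (f x powr p) \<le> norm (1 + f x ^ k)"
      using powr_le_1_plus_power[OF f p k(1)] f by (auto simp: abs_of_nonneg add_nonneg_nonneg)
  qed measurable
qed

locale exp_power_product = orthonormal_basis e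
  for e :: "nat \<Rightarrow> 'a::{real_inner, banach, second_countable_topology}" +
  fixes m :: real and \<mu> :: "nat \<Rightarrow> real"
  assumes m: "m \<ge> 1" and \<mu>: "\<And>h. \<mu> h > 0" and sum_\<mu>: "summable (\<lambda>h. \<mu> h powr (1 / m))"
begin

definition P :: "(nat \<Rightarrow> real) measure" where
  "P = (\<Pi>\<^sub>M h\<in>UNIV. nu1 m (\<mu> h))"

definition \<nu> :: "'a measure" where "\<nu> = nu m \<mu> e"

definition lam :: "nat \<Rightarrow> real" where "lam h = b_const m * \<mu> h powr (1 / m)"

definition R :: "'a \<Rightarrow> 'a" where "R = sqrt_op (cov_op m \<mu> e)"

lemma m_pos [simp]: "m > 0" using m by simp

lemma prob_nu1: "prob_space (nu1 m (\<mu> h))"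
  by (rule prob_space_nu1[OF m_pos \<mu>])

lemma prob_P: "prob_space P"
  unfolding P_def by (rule prob_space_PiM) (rule prob_nu1)

lemma synth_meas [measurable]: "synth \<in> borel_measurable P"
  unfolding P_def by (rule synth_measurable) simp

lemma nu_distr: "\<nu> = distr P borel synth"
  by (simp add: \<nu>_def nu_def P_def synth_def[abs_def])

lemma sets_nu [simp, measurable_cong]: "sets \<nu> = sets borel" by (simp add: nu_distr)
lemma space_nu [simp]: "space \<nu> = UNIV" by (simp add: nu_distr)

sublocale prob_space \<nu>
  unfolding nu_distr by (rule prob_space.prob_space_distr[OF prob_P synth_meas])

lemma lam_pos: "lam h > 0"
  using b_const_pos[OF m_pos] \<mu>[of h] by (simp add: lam_def)

lemma summable_lam: "summable lam"
  unfolding lam_def[abs_def] by (rule summable_mult[OF sum_\<mu>])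

lemma bounded_linear_R: "bounded_linear R"
  and R_coord: "R x \<bullet> e h = sqrt (lam h) * (x \<bullet> e h)"
  unfolding R_def using sqrt_op_diagonal[OF lam_pos summable_lam, of "cov_op m \<mu> e"]
  by (auto simp: cov_op_def lam_def)

lemma measurable_component_P [measurable]: "(\<lambda>\<xi>. \<xi> h) \<in> borel_measurable P"
proof -
  have "(\<lambda>\<xi>. \<xi> h) \<in> measurable P (nu1 m (\<mu> h))"
    unfolding P_def by (rule measurable_component_singleton) simp
  thus ?thesis using measurable_cong_sets[OF refl sets_nu1, of P] by blast
qed

lemma distr_P_component: "distr P borel (\<lambda>\<xi>. \<xi> h) = nu1 m (\<mu> h)"
proof -
  have "distr P (nu1 m (\<mu> h)) (\<lambda>\<xi>. \<xi> h) = nu1 m (\<mu> h)"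
    unfolding P_def by (rule distr_PiM_component) (auto intro: prob_nu1)
  thus ?thesis by (metis distr_cong sets_nu1)
qed

lemma P_moment:
  assumes "r > -1"
  shows "has_bochner_integral P (\<lambda>\<xi>. \<bar>\<xi> h\<bar> powr r) (\<mu> h powr (r / (2 * m)) * abs_moment m r)"
proof -
  have *: "has_bochner_integral (distr P borel (\<lambda>\<xi>. \<xi> h)) (\<lambda>t. \<bar>t\<bar> powr r) (\<mu> h powr (r / (2 * m)) * abs_moment m r)"
    unfolding distr_P_component by (rule nu1_moment[OF m_pos \<mu> assms])
  thus ?thesis by (simp add: has_bochner_integral_iff integrable_distr_eq integral_distr)
qed

text \<open>The second moments of the coordinates are a constant times \<open>\<mu> h powr (1 / m)\<close>, hence summable. From
  here on the coordinates of \<open>synth \<xi>\<close> are \<open>\<xi>\<close> up to a null set.\<close>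

lemma AE_ell2: "AE \<xi> in P. \<xi> \<in> ell2"
proof -
  have "AE \<xi> in P. summable (\<lambda>h. \<mu> h powr (1 / m) * (\<bar>\<xi> h\<bar> powr 2 / \<mu> h powr (1 / m)))"
  proof (rule AE_summable_weighted(1)[OF _ sum_\<mu>])
    show "integrable P (\<lambda>\<xi>. \<bar>\<xi> h\<bar> powr 2 / \<mu> h powr (1 / m))" for h
      using P_moment[of 2 h] by (auto simp: has_bochner_integral_iff)
    show "(\<integral>\<xi>. \<bar>\<xi> h\<bar> powr 2 / \<mu> h powr (1 / m) \<partial>P) \<le> abs_moment m 2" for h
      using P_moment[of 2 h] \<mu>[of h] by (simp add: has_bochner_integral_iff)
  qed auto
  thus ?thesis
  proof eventually_elim
    case (elim \<xi>)
    have "\<mu> h powr (1 / m) * (\<bar>\<xi> h\<bar> powr 2 / \<mu> h powr (1 / m)) = (\<xi> h)\<^sup>2" for h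
      using \<mu>[of h] by (cases "\<xi> h = 0") (auto simp: powr_numeral)
    thus ?case using elim by (simp add: ell2_def)
  qed
qed

lemma distr_nu_coord: "distr \<nu> borel (\<lambda>x. x \<bullet> e h) = nu1 m (\<mu> h)"
proof -
  have "distr \<nu> borel (\<lambda>x. x \<bullet> e h) = distr P borel (\<lambda>\<xi>. synth \<xi> \<bullet> e h)"
    unfolding nu_distr by (subst distr_distr) (auto simp: o_def)
  also have "\<dots> = distr P borel (\<lambda>\<xi>. \<xi> h)"
    by (rule distr_cong_AE) (use AE_ell2 in \<open>auto simp: synth_inner elim: eventually_mono\<close>)
  finally show ?thesis by (simp add: distr_P_component)
qed

lemma coord_moment:
  assumes "r > -1"
  shows "has_bochner_integral \<nu> (\<lambda>x. \<bar>x \<bullet> e h\<bar> powr r) (\<mu> h powr (r / (2 * m)) * abs_moment m r)"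
proof -
  have *: "has_bochner_integral (distr \<nu> borel (\<lambda>x. x \<bullet> e h)) (\<lambda>t. \<bar>t\<bar> powr r) (\<mu> h powr (r / (2 * m)) * abs_moment m r)"
    unfolding distr_nu_coord by (rule nu1_moment[OF m_pos \<mu> assms])
  thus ?thesis by (simp add: has_bochner_integral_iff integrable_distr_eq integral_distr)
qed

text \<open>With \<open>r = 2\<close> this is the squared norm, and with \<open>r = 2 * m\<close> it is, up to a constant, the series in
  the adjoint. In both cases the weights \<open>\<mu> h powr (1 / m)\<close> are summable and the remaining factors are
  identically distributed.\<close>

definition power_sum :: "real \<Rightarrow> 'a \<Rightarrow> real" where
  "power_sum r x = (\<Sum>h. \<mu> h powr (1 / m) * (\<bar>x \<bullet> e h\<bar> powr r / \<mu> h powr (r / (2 * m))))"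

lemma power_sum_moments:
  assumes r: "r > 0"
  shows "AE x in \<nu>. summable (\<lambda>h. \<mu> h powr (1 / m) * (\<bar>x \<bullet> e h\<bar> powr r / \<mu> h powr (r / (2 * m))))"
    and "k > 0 \<Longrightarrow> integrable \<nu> (\<lambda>x. power_sum r x ^ k)"
proof -
  define Y where "Y = (\<lambda>h x. \<bar>x \<bullet> e h\<bar> powr r / \<mu> h powr (r / (2 * m)))"
  have Yk: "Y h x ^ k = \<bar>x \<bullet> e h\<bar> powr (r * k) / \<mu> h powr (r * k / (2 * m))" if "k > 0" for h x k
    using \<mu>[of h] r that
    by (cases "x \<bullet> e h = 0") (simp_all add: Y_def power_divide powr_powr flip: powr_realpow)
  have i: "integrable \<nu> (\<lambda>x. Y h x ^ k)" "(\<integral>x. Y h x ^ k \<partial>\<nu>) \<le> abs_moment m (r * k)" if "k > 0" for h k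
  proof -
    have "has_bochner_integral \<nu> (\<lambda>x. \<bar>x \<bullet> e h\<bar> powr (r * k)) (\<mu> h powr (r * k / (2 * m)) * abs_moment m (r * k))"
      by (rule coord_moment) (use r in \<open>auto intro: less_le_trans[of _ 0]\<close>)
    thus "integrable \<nu> (\<lambda>x. Y h x ^ k)" "(\<integral>x. Y h x ^ k \<partial>\<nu>) \<le> abs_moment m (r * k)"
      using \<mu>[of h] by (auto simp: Yk[OF that] has_bochner_integral_iff)
  qed
  have Y0: "Y h x \<ge> 0" for h x by (simp add: Y_def)
  have [measurable]: "Y h \<in> borel_measurable \<nu>" for h unfolding Y_def by measurable
  show "AE x in \<nu>. summable (\<lambda>h. \<mu> h powr (1 / m) * (\<bar>x \<bullet> e h\<bar> powr r / \<mu> h powr (r / (2 * m))))"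
    using AE_summable_weighted(1)[OF _ sum_\<mu> Y0, where M=\<nu> and K="abs_moment m r"] i[of 1] by (simp add: Y_def)
  show "integrable \<nu> (\<lambda>x. power_sum r x ^ k)" if "k > 0"
  proof -
    have "integrable \<nu> (\<lambda>x. (\<Sum>h. \<mu> h powr (1 / m) * Y h x) ^ k)"
      by (rule integrable_power_weighted_sum[OF _ sum_\<mu> Y0 _ i that]) (simp_all add: less_imp_neq[OF \<mu>, symmetric])
    thus ?thesis by (simp only: power_sum_def[abs_def] Y_def)
  qed
qed

lemma norm_moment:
  assumes "p \<ge> 0"
  shows "integrable \<nu> (\<lambda>x. norm x powr p)"
proof -
  have eq: "power_sum 2 x = (norm x)\<^sup>2" for x
  proof -
    have "\<mu> h powr (1 / m) * (\<bar>x \<bullet> e h\<bar> powr 2 / \<mu> h powr (2 / (2 * m))) = (x \<bullet> e h)\<^sup>2" for h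
      using \<mu>[of h] by (cases "x \<bullet> e h = 0") (auto simp: powr_numeral)
    thus ?thesis using norm_sums[of x] by (simp add: power_sum_def sums_iff)
  qed
  have "integrable \<nu> (\<lambda>x. ((norm x)\<^sup>2) powr (p / 2))"
    using power_sum_moments(2)[of 2] assms unfolding eq by (intro integrable_powr_if_powers) auto
  also have "(\<lambda>x::'a. ((norm x)\<^sup>2) powr (p / 2)) = (\<lambda>x. norm x powr p)"
    by (rule ext) (simp add: powr_powr flip: powr_numeral)
  finally show ?thesis .
qed

text \<open>The series arises by summing \<open>lam h * t * score m (\<mu> h) t\<close> over the coordinates \<open>t = x \<bullet> e h\<close>.\<close>

definition score_sum :: "'a \<Rightarrow> real" where
  "score_sum x = (\<Sum>h. lam h * \<bar>x \<bullet> e h\<bar> powr (2 * m) / \<mu> h)"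

lemma score_sum_moments:
  shows "AE x in \<nu>. summable (\<lambda>h. lam h * \<bar>x \<bullet> e h\<bar> powr (2 * m) / \<mu> h)"
    and "p \<ge> 0 \<Longrightarrow> integrable \<nu> (\<lambda>x. \<bar>score_sum x\<bar> powr p)"
proof -
  have eq: "lam h * \<bar>x \<bullet> e h\<bar> powr (2 * m) / \<mu> h =
    b_const m * (\<mu> h powr (1 / m) * (\<bar>x \<bullet> e h\<bar> powr (2 * m) / \<mu> h powr (2 * m / (2 * m))))" for h x
    using \<mu>[of h] m_pos[THEN less_imp_neq] by (simp add: lam_def)
  have m2: "2 * m > 0" by simp
  show sm: "AE x in \<nu>. summable (\<lambda>h. lam h * \<bar>x \<bullet> e h\<bar> powr (2 * m) / \<mu> h)"
    using power_sum_moments(1)[OF m2] unfolding eq by eventually_elim (rule summable_mult)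
  have [measurable]: "power_sum (2 * m) \<in> borel_measurable \<nu>"
    unfolding power_sum_def[abs_def] by measurable
  show "integrable \<nu> (\<lambda>x. \<bar>score_sum x\<bar> powr p)" if p: "p \<ge> 0"
  proof -
    have "integrable \<nu> (\<lambda>x. \<bar>power_sum (2 * m) x\<bar> powr p)"
    proof (rule integrable_powr_if_powers)
      show "integrable \<nu> (\<lambda>x. \<bar>power_sum (2 * m) x\<bar> ^ k)" if "k > 0" for k
        using integrable_abs[OF power_sum_moments(2)[OF m2 that]] by (simp add: power_abs)
    qed (use p in auto)
    hence i: "integrable \<nu> (\<lambda>x. b_const m powr p * \<bar>power_sum (2 * m) x\<bar> powr p)"
      by (rule integrable_mult_right)
    have ae: "AE x in \<nu>. b_const m powr p * \<bar>power_sum (2 * m) x\<bar> powr p = \<bar>score_sum x\<bar> powr p"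
      using power_sum_moments(1)[OF m2]
    proof eventually_elim
      case (elim x)
      have "score_sum x = b_const m * power_sum (2 * m) x"
        unfolding score_sum_def eq power_sum_def by (rule suminf_mult[OF elim])
      thus ?case using b_const_pos[OF m_pos] by (simp add: abs_mult powr_mult)
    qed
    have meas: "(\<lambda>x. \<bar>score_sum x\<bar> powr p) \<in> borel_measurable \<nu>"
      unfolding score_sum_def[abs_def] by measurable
    show ?thesis by (rule integrable_cong_AE_imp[OF i meas ae])
  qed
qed

lemma AE_coord_neq: "AE x in \<nu>. x \<bullet> e h \<noteq> a"
proof -
  have "AE t in distr \<nu> borel (\<lambda>x. x \<bullet> e h). t \<noteq> a"
    unfolding distr_nu_coord nu1_eq_density
    by (subst AE_density) (auto intro: AE_mp[OF AE_lborel_singleton])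
  thus ?thesis by (subst (asm) AE_distr_iff) auto
qed

text \<open>By independence the integral factorises, and each factor is the moment of order \<open>- 1 / 2\<close> of one
  coordinate.\<close>

lemma integrable_prod_inverse_sqrt_coords:
  "integrable \<nu> (\<lambda>x. \<Prod>j<k. \<bar>x \<bullet> e j\<bar> powr (- 1/2))"
proof -
  interpret PP: product_prob_space "\<lambda>h. nu1 m (\<mu> h)" UNIV
    by (simp add: product_prob_space_def product_prob_space_axioms_def product_sigma_finite_def prob_nu1 prob_space_imp_sigma_finite)
  have component: "(\<lambda>\<xi>. ennreal (\<bar>\<xi> j\<bar> powr r)) \<in> borel_measurable (\<Pi>\<^sub>M j\<in>{..<k}. nu1 m (\<mu> j))"
    if "j < k" for j r
    by (rule measurable_compose[OF measurable_component_singleton[of j]])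
       (use that in \<open>simp_all add: measurable_cong_sets[OF sets_nu1 refl]\<close>)
  have "(\<integral>\<^sup>+x. ennreal (\<Prod>j<k. \<bar>x \<bullet> e j\<bar> powr (- 1/2)) \<partial>\<nu>)
      = (\<integral>\<^sup>+\<xi>. ennreal (\<Prod>j<k. \<bar>synth \<xi> \<bullet> e j\<bar> powr (- 1/2)) \<partial>P)"
    unfolding nu_distr by (subst nn_integral_distr) auto
  also have "\<dots> = (\<integral>\<^sup>+\<xi>. (\<Prod>j\<in>{..<k}. ennreal (\<bar>restrict \<xi> {..<k} j\<bar> powr (- 1/2))) \<partial>P)"
    by (rule nn_integral_cong_AE) (use AE_ell2 in eventually_elim, auto simp: synth_inner prod_ennreal)
  also have "\<dots> = (\<integral>\<^sup>+\<xi>. (\<Prod>j\<in>{..<k}. ennreal (\<bar>\<xi> j\<bar> powr (- 1/2))) \<partial>distr P (\<Pi>\<^sub>M j\<in>{..<k}. nu1 m (\<mu> j)) (\<lambda>\<xi>. restrict \<xi> {..<k}))"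
    unfolding P_def
    by (subst nn_integral_distr)
       (auto intro!: measurable_restrict_subset borel_measurable_prod_ennreal component)
  also have "\<dots> = (\<integral>\<^sup>+\<xi>. (\<Prod>j\<in>{..<k}. ennreal (\<bar>\<xi> j\<bar> powr (- 1/2))) \<partial>(\<Pi>\<^sub>M j\<in>{..<k}. nu1 m (\<mu> j)))"
    unfolding P_def by (subst PP.distr_PiM_restrict_finite) auto
  also have "\<dots> = (\<Prod>j\<in>{..<k}. \<integral>\<^sup>+t. ennreal (\<bar>t\<bar> powr (- 1/2)) \<partial>nu1 m (\<mu> j))"
    by (rule PP.product_nn_integral_prod)
       (simp_all add: measurable_cong_sets[OF sets_nu1 refl])
  also have "\<dots> < \<infinity>"
  proof -
    have "(\<integral>\<^sup>+t. ennreal (\<bar>t\<bar> powr (- 1/2)) \<partial>nu1 m (\<mu> j)) \<noteq> \<infinity>" for j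
      using nu1_moment[OF m_pos \<mu>[of j], of "-1/2"]
      by (subst nn_integral_eq_integral) (auto simp: has_bochner_integral_iff)
    hence "(\<Prod>j\<in>{..<k}. \<integral>\<^sup>+t. ennreal (\<bar>t\<bar> powr (- 1/2)) \<partial>nu1 m (\<mu> j)) \<noteq> \<infinity>"
      by (simp add: ennreal_prod_eq_top)
    thus ?thesis by (simp only: infinity_ennreal_def less_top)
  qed
  finally show ?thesis
    by (intro integrableI_nonneg) (auto intro!: prod_nonneg)
qed

lemma abs_coord_le_norm: "\<bar>x \<bullet> e h\<bar> \<le> norm x"
  using Cauchy_Schwarz_ineq2[of x "e h"] by simp

lemma R_measurable [measurable]: "R \<in> borel_measurable borel"
  by (intro borel_measurable_continuous_onI linear_continuous_on bounded_linear_R)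

text \<open>Every one of the first \<open>k\<close> coordinates of \<open>R x\<close> is at most \<open>\<parallel>R x\<parallel>\<close>, so the power \<open>- k / 2\<close> of the
  norm is bounded by the product of the powers \<open>- 1 / 2\<close> of these coordinates. As there are infinitely
  many coordinates, \<open>k\<close> can be taken as large as \<open>q\<close> requires.\<close>

lemma integrable_norm_R_inverse_powr:
  assumes q: "q \<ge> 0"
  shows "integrable \<nu> (\<lambda>x. norm (R x) powr (- q))"
proof -
  obtain k :: nat where k: "2 * q \<le> real k" using real_arch_simple by blast
  define C where "C = (\<Prod>j<k. sqrt (lam j) powr (- 1/2))"
  show ?thesis
  proof (rule Bochner_Integration.integrable_bound)
    show "integrable \<nu> (\<lambda>x. 1 + C * (\<Prod>j<k. \<bar>x \<bullet> e j\<bar> powr (- 1/2)))"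
      using integrable_prod_inverse_sqrt_coords by auto
    have "AE x in \<nu>. \<forall>j. x \<bullet> e j \<noteq> 0" using AE_coord_neq by (simp add: AE_all_countable)
    thus "AE x in \<nu>. norm (norm (R x) powr (- q)) \<le> norm (1 + C * (\<Prod>j<k. \<bar>x \<bullet> e j\<bar> powr (- 1/2)))"
    proof eventually_elim
      case (elim x)
      have pos: "sqrt (lam j) * \<bar>x \<bullet> e j\<bar> > 0" for j using elim lam_pos[of j] by simp
      have le: "sqrt (lam j) * \<bar>x \<bullet> e j\<bar> \<le> norm (R x)" for j
        using abs_coord_le_norm[of "R x" j] lam_pos[of j] by (simp add: R_coord abs_mult)
      have N: "norm (R x) > 0" using pos[of 0] le[of 0] by linarith
      have "norm (R x) powr (- q) = (1 / norm (R x)) powr q"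
        using N by (simp add: powr_minus_divide powr_divide)
      also have "\<dots> = ((1 / norm (R x)) powr (1/2)) powr (2 * q)" using N by (simp add: powr_powr)
      also have "\<dots> \<le> 1 + ((1 / norm (R x)) powr (1/2)) ^ k"
        using q k by (intro powr_le_1_plus_power) auto
      also have "((1 / norm (R x)) powr (1/2)) ^ k = (\<Prod>j<k. norm (R x) powr (- 1/2))"
        using N by (simp add: powr_minus_divide powr_divide)
      also have "\<dots> \<le> (\<Prod>j<k. (sqrt (lam j) * \<bar>x \<bullet> e j\<bar>) powr (- 1/2))"
        using pos le by (intro prod_mono conjI powr_mono2') auto
      also have "\<dots> = C * (\<Prod>j<k. \<bar>x \<bullet> e j\<bar> powr (- 1/2))"
        using lam_pos by (simp add: C_def powr_mult prod.distrib less_imp_le)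
      finally show ?case by simp
    qed
  qed measurable
qed

end

section \<open>Gradients and Lp convergence\<close>

lemma grad_eq:
  assumes "GDERIV \<phi> x :> v"
  shows "grad \<phi> x = v"
  unfolding grad_def
proof (rule the_equality)
  fix w assume "GDERIV \<phi> x :> w"
  hence "(\<lambda>h. h \<bullet> w) = (\<lambda>h. h \<bullet> v)"
    using assms unfolding gderiv_def by (rule has_derivative_unique)
  hence "(w - v) \<bullet> w = (w - v) \<bullet> v" by (rule fun_cong)
  hence "(w - v) \<bullet> (w - v) = 0" by (simp add: inner_diff_right)
  thus "w = v" by simp
qed (rule assms)

lemma Cb1I:
  assumes "\<And>x. GDERIV \<phi> x :> D x" "continuous_on UNIV D"
    and "\<And>x. \<bar>\<phi> x\<bar> \<le> B" "\<And>x. norm (D x) \<le> C"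
  shows "\<phi> \<in> Cb1" "grad \<phi> = D"
proof -
  show *: "grad \<phi> = D" using grad_eq[OF assms(1)] by auto
  have "bounded (range \<phi>)" "bounded (range D)"
    using assms(3,4) by (auto simp: bounded_iff)
  thus "\<phi> \<in> Cb1" using assms(1,2) by (simp add: Cb1_def *)
qed

lemma Cb1_continuous:
  assumes "\<phi> \<in> Cb1"
  shows "continuous_on UNIV \<phi>" "continuous_on UNIV (grad \<phi>)"
proof -
  have "isCont \<phi> x" for x
    using assms unfolding Cb1_def gderiv_def by (blast intro: has_derivative_continuous)
  thus "continuous_on UNIV \<phi>" by (simp add: continuous_at_imp_continuous_on)
  show "continuous_on UNIV (grad \<phi>)" using assms by (simp add: Cb1_def)
qed

lemma Cb1_bounds:
  assumes "\<phi> \<in> Cb1"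
  obtains B where "B \<ge> 0" "\<And>x. \<bar>\<phi> x\<bar> \<le> B" "\<And>x. norm (grad \<phi> x) \<le> B"
proof -
  obtain a b where "\<And>x. norm (\<phi> x) \<le> a" "\<And>x. norm (grad \<phi> x) \<le> b"
    using assms unfolding Cb1_def bounded_iff by auto
  thus ?thesis using that[of "max 0 (max a b)"] by (simp add: le_max_iff_disj)
qed

lemma GDERIV_line:
  assumes "GDERIV \<phi> x :> D"
  shows "((\<lambda>t. \<phi> (x + t *\<^sub>R v)) has_real_derivative D \<bullet> v) (at 0)"
proof -
  have "((\<lambda>t. x + t *\<^sub>R v) has_derivative (\<lambda>t. t *\<^sub>R v)) (at 0)"
    by (auto intro!: derivative_eq_intros)
  moreover have "(\<phi> has_derivative (\<lambda>h. h \<bullet> D)) (at (x + 0 *\<^sub>R v))"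
    using assms by (simp add: gderiv_def)
  ultimately have "((\<lambda>t. \<phi> (x + t *\<^sub>R v)) has_derivative (\<lambda>t. (t *\<^sub>R v) \<bullet> D)) (at 0)"
    by (rule has_derivative_compose)
  moreover have "(\<lambda>t. (t *\<^sub>R v) \<bullet> D) = (*) (D \<bullet> v)"
    by (auto simp: inner_commute mult.commute)
  ultimately show ?thesis by (simp add: has_field_derivative_def)
qed

lemma Cb1_line:
  assumes "\<phi> \<in> Cb1"
  shows "((\<lambda>t. \<phi> (x + t *\<^sub>R v)) has_real_derivative grad \<phi> x \<bullet> v) (at 0)"
  using assms by (intro GDERIV_line) (simp add: Cb1_def)

text \<open>A crude form of Young's inequality, obtained by distinguishing which of \<open>b\<close> and
  \<open>a powr (p - 1)\<close> is larger. It is enough for duality arguments, because a free scaling parameter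
  restores the smallness that Hoelder's inequality would give.\<close>

lemma mult_le_powr_add_powr:
  fixes a b p :: real
  assumes "a \<ge> 0" "b \<ge> 0" "p > 1"
  shows "a * b \<le> a powr p + b powr (p / (p - 1))"
proof (cases "b \<le> a powr (p - 1)")
  case True
  hence "a * b \<le> a * a powr (p - 1)" using assms by (intro mult_left_mono)
  also have "\<dots> = a powr p" using assms by (simp add: powr_mult_base)
  finally show ?thesis by (simp add: add_increasing2)
next
  case False
  hence "(a powr (p - 1)) powr (1 / (p - 1)) \<le> b powr (1 / (p - 1))"
    using assms by (intro powr_mono2) auto
  hence "a \<le> b powr (1 / (p - 1))" using assms by (simp add: powr_powr)
  hence "a * b \<le> b powr (1 / (p - 1)) * b" using assms by (intro mult_right_mono)
  also have "\<dots> = b powr (1 + 1 / (p - 1))" using assms by (simp add: powr_mult_base mult.commute)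
  also have "1 + 1 / (p - 1) = p / (p - 1)" using assms by (simp add: field_simps)
  finally show ?thesis by (simp add: add_increasing)
qed

lemma powr_add_le:
  fixes a b p :: real
  assumes "a \<ge> 0" "b \<ge> 0" "p > 0"
  shows "(a + b) powr p \<le> 2 powr p * (a powr p + b powr p)"
proof -
  have "(a + b) powr p \<le> (2 * max a b) powr p" using assms by (intro powr_mono2) auto
  also have "\<dots> = 2 powr p * max a b powr p" using assms by (simp add: powr_mult)
  also have "max a b powr p \<le> a powr p + b powr p" by (auto simp: max_def)
  finally show ?thesis by simp
qed

lemma Lp_diff:
  fixes f g :: "'a \<Rightarrow> 'b::{real_normed_vector, second_countable_topology}"
  assumes "f \<in> Lp p \<nu>" "g \<in> Lp p \<nu>" "p > 0"
  shows "(\<lambda>x. f x - g x) \<in> Lp p \<nu>"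
proof -
  have [measurable]: "f \<in> borel_measurable \<nu>" "g \<in> borel_measurable \<nu>" using assms by (auto simp: Lp_def)
  have "integrable \<nu> (\<lambda>x. norm (f x - g x) powr p)"
  proof (rule Bochner_Integration.integrable_bound)
    show "integrable \<nu> (\<lambda>x. 2 powr p * (norm (f x) powr p + norm (g x) powr p))"
      using assms by (auto simp: Lp_def)
    have "norm (f x - g x) powr p \<le> 2 powr p * (norm (f x) powr p + norm (g x) powr p)" for x
      by (rule order_trans[OF powr_mono2[OF _ _ norm_triangle_ineq4] powr_add_le]) (use assms in auto)
    thus "AE x in \<nu>. norm (norm (f x - g x) powr p) \<le> norm (2 powr p * (norm (f x) powr p + norm (g x) powr p))"
      by (simp add: abs_of_nonneg)
  qed measurable
  thus ?thesis by (simp add: Lp_def)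
qed

lemma Lp_inner_integrable:
  fixes f g :: "'a \<Rightarrow> 'b::{real_inner, second_countable_topology}"
  assumes "f \<in> Lp p \<nu>" "g \<in> Lp (p / (p - 1)) \<nu>" "p > 1"
  shows "integrable \<nu> (\<lambda>x. f x \<bullet> g x)"
proof (rule Bochner_Integration.integrable_bound)
  have [measurable]: "f \<in> borel_measurable \<nu>" "g \<in> borel_measurable \<nu>" using assms by (auto simp: Lp_def)
  show "(\<lambda>x. f x \<bullet> g x) \<in> borel_measurable \<nu>" by measurable
  show "integrable \<nu> (\<lambda>x. norm (f x) powr p + norm (g x) powr (p / (p - 1)))"
    using assms by (auto simp: Lp_def)
  have "\<bar>f x \<bullet> g x\<bar> \<le> norm (f x) powr p + norm (g x) powr (p / (p - 1))" for x
    by (rule order_trans[OF Cauchy_Schwarz_ineq2 mult_le_powr_add_powr]) (use assms in auto)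
  thus "AE x in \<nu>. norm (f x \<bullet> g x) \<le> norm (norm (f x) powr p + norm (g x) powr (p / (p - 1)))"
    by simp
qed

text \<open>Convergence in \<open>L\<^sup>p\<close> implies weak convergence. Scaling the two factors by \<open>1 / \<delta>\<close> and \<open>\<delta>\<close> before
  applying \<open>mult_le_powr_add_powr\<close> makes the contribution of \<open>g\<close> small, uniformly in \<open>n\<close>.\<close>

lemma Lp_tendsto_inner:
  fixes f :: "nat \<Rightarrow> 'a \<Rightarrow> 'b::{real_inner, second_countable_topology}"
  assumes lim: "Lp_tendsto p \<nu> f f'" and g: "g \<in> Lp (p / (p - 1)) \<nu>" and p: "p > 1"
  shows "(\<lambda>n. \<integral>x. f n x \<bullet> g x \<partial>\<nu>) \<longlonglongrightarrow> (\<integral>x. f' x \<bullet> g x \<partial>\<nu>)"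
proof -
  define q where "q = p / (p - 1)"
  have q: "q > 0" using p by (simp add: q_def)
  have f: "f n \<in> Lp p \<nu>" "f' \<in> Lp p \<nu>" for n using lim by (auto simp: Lp_tendsto_def)
  define d where "d n x = f n x - f' x" for n x
  have d: "d n \<in> Lp p \<nu>" for n unfolding d_def[abs_def] using Lp_diff[OF f] p by simp
  define I where "I n = (\<integral>x. norm (d n x) powr p \<partial>\<nu>)" for n
  have I: "I \<longlonglongrightarrow> 0" using lim by (simp add: I_def[abs_def] d_def Lp_tendsto_def)
  define C where "C = (\<integral>x. norm (g x) powr q \<partial>\<nu>)"
  have C: "C \<ge> 0" unfolding C_def by (intro integral_nonneg_AE) auto
  have dg: "integrable \<nu> (\<lambda>x. d n x \<bullet> g x)" for n by (rule Lp_inner_integrable[OF d g p])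
  have key: "\<bar>\<integral>x. d n x \<bullet> g x \<partial>\<nu>\<bar> \<le> (1 / \<delta>) powr p * I n + \<delta> powr q * C" if \<delta>: "\<delta> > 0" for n \<delta>
  proof -
    have "\<bar>\<integral>x. d n x \<bullet> g x \<partial>\<nu>\<bar> \<le> (\<integral>x. \<bar>d n x \<bullet> g x\<bar> \<partial>\<nu>)" by (rule integral_abs_bound)
    also have "\<dots> \<le> (\<integral>x. (1 / \<delta>) powr p * norm (d n x) powr p + \<delta> powr q * norm (g x) powr q \<partial>\<nu>)"
    proof (rule integral_mono)
      show "integrable \<nu> (\<lambda>x. \<bar>d n x \<bullet> g x\<bar>)" using dg by simp
      show "integrable \<nu> (\<lambda>x. (1 / \<delta>) powr p * norm (d n x) powr p + \<delta> powr q * norm (g x) powr q)"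
        using d g by (auto simp: Lp_def q_def)
      fix x
      have "\<bar>d n x \<bullet> g x\<bar> \<le> norm (d n x) * norm (g x)" by (rule Cauchy_Schwarz_ineq2)
      also have "\<dots> = (1 / \<delta> * norm (d n x)) * (\<delta> * norm (g x))" using \<delta> by simp
      also have "\<dots> \<le> (1 / \<delta> * norm (d n x)) powr p + (\<delta> * norm (g x)) powr q"
        unfolding q_def using \<delta> p by (intro mult_le_powr_add_powr) auto
      also have "\<dots> = (1 / \<delta>) powr p * norm (d n x) powr p + \<delta> powr q * norm (g x) powr q"
        using \<delta> by (simp only: powr_mult)
      finally show "\<bar>d n x \<bullet> g x\<bar> \<le> \<dots>" .
    qed
    also have "\<dots> = (1 / \<delta>) powr p * I n + \<delta> powr q * C"
      using d g by (auto simp: Lp_def q_def I_def C_def)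
    finally show ?thesis .
  qed
  have "(\<lambda>n. \<integral>x. d n x \<bullet> g x \<partial>\<nu>) \<longlonglongrightarrow> 0"
  proof (rule LIMSEQ_I)
    fix \<epsilon> :: real assume \<epsilon>: "\<epsilon> > 0"
    \<comment> \<open>Chosen so that \<open>\<delta> powr q * C\<close>, the part of the bound that does not tend to zero, is at most \<open>\<epsilon> / 2\<close>.\<close>
    define \<delta> where "\<delta> = (\<epsilon> / (2 * (C + 1))) powr (1 / q)"
    have \<delta>: "\<delta> > 0" using \<epsilon> C by (simp add: \<delta>_def)
    have "\<delta> powr q = \<epsilon> / (2 * (C + 1))" using \<epsilon> C q by (simp add: \<delta>_def powr_powr)
    also have "\<dots> * C \<le> \<epsilon> / 2" using \<epsilon> C by (simp add: field_simps)
    finally have b: "\<delta> powr q * C \<le> \<epsilon> / 2" .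
    have "(\<lambda>n. (1 / \<delta>) powr p * I n) \<longlonglongrightarrow> 0" using I by (rule tendsto_mult_right_zero)
    hence "\<forall>\<^sub>F n in sequentially. (1 / \<delta>) powr p * I n < \<epsilon> / 2"
      using \<epsilon> by (intro order_tendstoD) auto
    then obtain N where N: "\<And>n. n \<ge> N \<Longrightarrow> (1 / \<delta>) powr p * I n < \<epsilon> / 2"
      unfolding eventually_sequentially by blast
    have "norm ((\<integral>x. d n x \<bullet> g x \<partial>\<nu>) - 0) < \<epsilon>" if "n \<ge> N" for n
      using key[OF \<delta>, of n] b N[OF that] by simp
    thus "\<exists>N. \<forall>n\<ge>N. norm ((\<integral>x. d n x \<bullet> g x \<partial>\<nu>) - 0) < \<epsilon>" by blast
  qed
  moreover have "(\<integral>x. d n x \<bullet> g x \<partial>\<nu>) = (\<integral>x. f n x \<bullet> g x \<partial>\<nu>) - (\<integral>x. f' x \<bullet> g x \<partial>\<nu>)" for n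
    unfolding d_def inner_diff_left
    by (rule Bochner_Integration.integral_diff) (rule Lp_inner_integrable[OF f(1) g p] Lp_inner_integrable[OF f(2) g p])+
  ultimately show ?thesis by (simp add: LIM_zero_iff)
qed

lemma Lp_tendsto_dominated:
  fixes f :: "nat \<Rightarrow> 'a \<Rightarrow> 'b::{real_normed_vector, second_countable_topology}"
  assumes meas [measurable]: "\<And>n. f n \<in> borel_measurable \<nu>" "g \<in> borel_measurable \<nu>"
    and lim: "\<And>x. (\<lambda>n. f n x) \<longlonglongrightarrow> g x" and bd: "\<And>n x. norm (f n x) \<le> H x"
    and H: "integrable \<nu> (\<lambda>x. H x powr p)" and p: "p > 0"
  shows "Lp_tendsto p \<nu> f g"
proof -
  have bg: "norm (g x) \<le> H x" for x
    by (rule LIMSEQ_le_const2[OF tendsto_norm[OF lim]]) (use bd in auto)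
  have H0: "H x \<ge> 0" for x using bg[of x] norm_ge_zero order_trans by blast
  have Lp: "h \<in> Lp p \<nu>" if [measurable]: "h \<in> borel_measurable \<nu>" and "\<And>x. norm (h x) \<le> H x"
    for h :: "'a \<Rightarrow> 'b"
    unfolding Lp_def
  proof (intro CollectI conjI)
    show "integrable \<nu> (\<lambda>x. norm (h x) powr p)"
      by (rule Bochner_Integration.integrable_bound[OF H])
         (use that p in \<open>auto intro!: powr_mono2\<close>)
  qed fact
  have "(\<lambda>n. \<integral>x. norm (f n x - g x) powr p \<partial>\<nu>) \<longlonglongrightarrow> (\<integral>x. 0 \<partial>\<nu>)"
  proof (rule integral_dominated_convergence)
    show "integrable \<nu> (\<lambda>x. 2 powr p * H x powr p)" using H by simp
    have "(\<lambda>n. norm (f n x - g x) powr p) \<longlonglongrightarrow> 0" for x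
      by (rule tendsto_zero_powrI[OF _ tendsto_const _ p])
         (use tendsto_norm_zero[OF LIM_zero[OF lim[of x]]] in auto)
    thus "AE x in \<nu>. (\<lambda>n. norm (f n x - g x) powr p) \<longlonglongrightarrow> 0" by simp
    have "norm (f n x - g x) powr p \<le> (2 * H x) powr p" for n x
      using norm_triangle_ineq4[of "f n x" "g x"] bd[of n x] bg[of x] p by (intro powr_mono2) auto
    thus "AE x in \<nu>. norm (norm (f n x - g x) powr p) \<le> 2 powr p * H x powr p" for n
      using H0 by (simp add: powr_mult)
  qed measurable
  thus ?thesis unfolding Lp_tendsto_def using Lp bd bg meas by auto
qed

lemma Lp_tendsto_cong_AE:
  fixes f :: "nat \<Rightarrow> 'a \<Rightarrow> 'b::{real_normed_vector, second_countable_topology}"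
  assumes "Lp_tendsto p \<nu> f g" "AE x in \<nu>. g x = g' x" "g' \<in> borel_measurable \<nu>"
  shows "Lp_tendsto p \<nu> f g'"
proof -
  have [measurable]: "g \<in> borel_measurable \<nu>" "g' \<in> borel_measurable \<nu>" "f n \<in> borel_measurable \<nu>" for n
    using assms by (auto simp: Lp_tendsto_def Lp_def)
  have "integrable \<nu> (\<lambda>x. norm (g x) powr p) = integrable \<nu> (\<lambda>x. norm (g' x) powr p)"
    by (rule integrable_cong_AE) (use assms(2) in \<open>auto elim: eventually_mono\<close>)
  moreover have "(\<integral>x. norm (f n x - g x) powr p \<partial>\<nu>) = (\<integral>x. norm (f n x - g' x) powr p \<partial>\<nu>)" for n
    by (rule integral_cong_AE) (use assms(2) in \<open>auto elim: eventually_mono\<close>)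
  ultimately show ?thesis using assms by (simp add: Lp_tendsto_def Lp_def)
qed

section \<open>Integration by parts along a basis vector\<close>

context exp_power_product
begin

text \<open>Disintegration along the line in direction \<open>e h\<close>: the product measure is the product of its
  \<open>h\<close>-th factor and the remaining ones. The indicator is harmless because \<open>ell2\<close> has full measure, and
  membership in \<open>ell2\<close> does not depend on the \<open>h\<close>-th entry; this is why it can be evaluated at
  \<open>X(h := 0)\<close> and moved outside the inner integral.\<close>

lemma integral_along_coord:
  fixes g :: "'a \<Rightarrow> real"
  assumes g: "integrable \<nu> g"
  shows "(\<integral>x. g x \<partial>\<nu>) = (\<integral>X. indicator ell2 (X(h := 0)) *
            (\<integral>t. g (synth (X(h := 0)) + t *\<^sub>R e h) \<partial>nu1 m (\<mu> h)) \<partial>(\<Pi>\<^sub>M i\<in>UNIV - {h}. nu1 m (\<mu> i)))"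
proof -
  define N where "N = nu1 m (\<mu> h)"
  define Q where "Q = (\<Pi>\<^sub>M i\<in>UNIV - {h}. nu1 m (\<mu> i))"
  define T where "T = (\<lambda>(t, X). (X :: nat \<Rightarrow> real)(h := t))"
  interpret N: prob_space N unfolding N_def by (rule prob_nu1)
  interpret Q: prob_space Q unfolding Q_def by (rule prob_space_PiM) (rule prob_nu1)
  interpret NQ: pair_sigma_finite N Q ..
  have ins: "insert h (UNIV - {h}) = UNIV" by auto
  have P_eq: "distr (N \<Otimes>\<^sub>M Q) P T = P"
    using distr_pair_PiM_eq_PiM[of "UNIV - {h}" "\<lambda>i. nu1 m (\<mu> i)" h] prob_nu1
    unfolding ins P_def N_def Q_def T_def by simp
  have T_meas [measurable]: "T \<in> measurable (N \<Otimes>\<^sub>M Q) P"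
  proof -
    have "(\<lambda>z. (\<lambda>(X, t). X(h := t)) ((\<lambda>(t, X). (X, t)) z)) \<in> measurable (N \<Otimes>\<^sub>M Q)
            (\<Pi>\<^sub>M i\<in>insert h (UNIV - {h}). nu1 m (\<mu> i))"
      unfolding N_def Q_def by (rule measurable_compose[OF measurable_pair_swap' measurable_add_dim])
    moreover have "(\<lambda>z. (\<lambda>(X, t). X(h := t)) ((\<lambda>(t, X). (X, t)) z)) = T"
      by (auto simp: T_def fun_eq_iff)
    ultimately show ?thesis unfolding ins P_def by simp
  qed
  have g_meas [measurable]: "g \<in> borel_measurable borel"
    using borel_measurable_integrable[OF g] unfolding measurable_cong_sets[OF sets_nu refl] .
  have ell2_meas [measurable]: "ell2 \<in> sets P"
  proof -
    have "ell2 = {\<xi> \<in> space P. summable (\<lambda>h. (\<xi> h)\<^sup>2)}" by (auto simp: ell2_def P_def space_PiM)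
    also have "\<dots> \<in> sets P"
      unfolding summable_iff_convergent Cauchy_convergent_iff[symmetric]
      by (intro sets_Collect_Cauchy borel_measurable_sum borel_measurable_power measurable_component_P)
    finally show ?thesis .
  qed
  \<comment> \<open>The integrand is cut off outside \<open>ell2\<close>, where \<open>synth\<close> is a junk value that need not be affine in the \<open>h\<close>-th entry.\<close>
  define k where "k = (\<lambda>\<xi>. indicator ell2 \<xi> * g (synth \<xi>))"
  have k_meas [measurable]: "k \<in> borel_measurable P" unfolding k_def
    by (intro borel_measurable_times borel_measurable_indicator ell2_meas
          measurable_compose[OF synth_meas g_meas])
  have kg: "AE \<xi> in P. g (synth \<xi>) = k \<xi>"
    using AE_ell2 by eventually_elim (simp add: k_def)
  have gP: "integrable P (\<lambda>\<xi>. g (synth \<xi>))"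
    using g integrable_distr_eq[OF synth_meas g_meas] by (simp only: nu_distr)
  have kP: "integrable P k"
    by (rule integrable_cong_AE_imp[OF gP k_meas kg])
  have kT: "integrable (N \<Otimes>\<^sub>M Q) (\<lambda>z. k (T z))"
    using kP integrable_distr_eq[OF T_meas k_meas] by (simp only: P_eq)
  have upd: "X(h := t) \<in> ell2 \<longleftrightarrow> X(h := 0) \<in> ell2" for X t
  proof -
    have "summable (\<lambda>i. ((X(h := t)) i)\<^sup>2) \<longleftrightarrow> summable (\<lambda>i. ((X(h := 0)) i)\<^sup>2)"
      by (rule summable_cong, rule eventually_mono[OF eventually_gt_at_top[of h]]) simp
    thus ?thesis unfolding ell2_def mem_Collect_eq .
  qed
  have syn: "synth (X(h := t)) = synth (X(h := 0)) + t *\<^sub>R e h" if X: "X(h := 0) \<in> ell2" for X t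
  proof (rule eq_if_coords_eq)
    fix i
    have "X(h := t) \<in> ell2" using upd X by blast
    thus "synth (X(h := t)) \<bullet> e i = (synth (X(h := 0)) + t *\<^sub>R e h) \<bullet> e i"
      by (simp add: synth_inner X inner_add_left orth)
  qed
  have "(\<integral>x. g x \<partial>\<nu>) = (\<integral>\<xi>. g (synth \<xi>) \<partial>P)"
    unfolding nu_distr by (rule integral_distr[OF synth_meas g_meas])
  also have "\<dots> = (\<integral>\<xi>. k \<xi> \<partial>P)"
    by (rule integral_cong_AE[OF measurable_compose[OF synth_meas g_meas] k_meas kg])
  also have "\<dots> = (\<integral>z. k (T z) \<partial>(N \<Otimes>\<^sub>M Q))"
    using integral_distr[OF T_meas k_meas] by (simp only: P_eq)
  also have "\<dots> = (\<integral>X. \<integral>t. k (T (t, X)) \<partial>N \<partial>Q)"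
    using NQ.integral_snd[of "\<lambda>t X. k (T (t, X))"] kT by (simp add: split_beta')
  also have "\<dots> = (\<integral>X. indicator ell2 (X(h := 0)) *
            (\<integral>t. g (synth (X(h := 0)) + t *\<^sub>R e h) \<partial>N) \<partial>Q)"
  proof (rule Bochner_Integration.integral_cong[OF refl])
    fix X
    show "(\<integral>t. k (T (t, X)) \<partial>N) = indicator ell2 (X(h := 0)) * (\<integral>t. g (synth (X(h := 0)) + t *\<^sub>R e h) \<partial>N)"
    proof (cases "X(h := 0) \<in> ell2")
      case True
      have "k (T (t, X)) = g (synth (X(h := 0)) + t *\<^sub>R e h)" for t
      proof -
        have "X(h := t) \<in> ell2" using upd True by blast
        thus ?thesis by (simp add: k_def T_def syn[OF True, of t])
      qed
      thus ?thesis using True by simp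
    next
      case False
      hence "X(h := t) \<notin> ell2" for t using upd by blast
      thus ?thesis using False by (simp add: k_def T_def)
    qed
  qed
  finally show ?thesis by (simp add: N_def Q_def)
qed

lemma score_meas [measurable]: "score m c \<in> borel_measurable borel"
  by (rule borel_measurable_continuous_onI[OF continuous_score[OF m]])

lemma score_coord_powr:
  assumes "q \<ge> 0"
  shows "integrable \<nu> (\<lambda>x. \<bar>score m (\<mu> h) (x \<bullet> e h)\<bar> powr q)"
proof -
  have "\<bar>score m (\<mu> h) t\<bar> powr q \<le> (1 / \<mu> h) powr q * \<bar>t\<bar> powr ((2 * m - 1) * q)" for t
    using \<mu>[of h] assms by (cases "t = 0") (auto simp: score_def abs_mult powr_divide powr_powr powr_one_eq_one)
  note le = this
  show ?thesis
  proof (rule Bochner_Integration.integrable_bound)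
    show "integrable \<nu> (\<lambda>x. (1 / \<mu> h) powr q * \<bar>x \<bullet> e h\<bar> powr ((2 * m - 1) * q))"
    proof (rule integrable_mult_right)
      have "0 \<le> (2 * m - 1) * q" using m assms by simp
      thus "integrable \<nu> (\<lambda>x. \<bar>x \<bullet> e h\<bar> powr ((2 * m - 1) * q))"
        using coord_moment[of "(2 * m - 1) * q" h] by (simp add: has_bochner_integral_iff)
    qed
    show "AE x in \<nu>. norm (\<bar>score m (\<mu> h) (x \<bullet> e h)\<bar> powr q) \<le> norm ((1 / \<mu> h) powr q * \<bar>x \<bullet> e h\<bar> powr ((2 * m - 1) * q))"
      using le by (simp add: abs_mult)
  qed measurable
qed

lemma integrable_bounded_mult_score:
  fixes f :: "'a \<Rightarrow> real"
  assumes [measurable]: "f \<in> borel_measurable borel" and bd: "\<And>x. \<bar>f x\<bar> \<le> B"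
  shows "integrable \<nu> (\<lambda>x. f x * score m (\<mu> h) (x \<bullet> e h))"
proof (rule Bochner_Integration.integrable_bound)
  have B: "B \<ge> 0" using bd[of 0] by linarith
  show "integrable \<nu> (\<lambda>x. B * \<bar>score m (\<mu> h) (x \<bullet> e h)\<bar> powr 1)"
    by (intro integrable_mult_right score_coord_powr) simp
  show "AE x in \<nu>. norm (f x * score m (\<mu> h) (x \<bullet> e h)) \<le> norm (B * \<bar>score m (\<mu> h) (x \<bullet> e h)\<bar> powr 1)"
    using bd B by (auto simp: abs_mult intro!: mult_right_mono)
qed measurable

text \<open>On almost every line in direction \<open>e h\<close> this is the one-dimensional formula. Differentiability is
  demanded in this direction only, so that indicators of sets invariant under it may be used as factors.\<close>

lemma integration_by_parts_coord:
  fixes f f' :: "'a \<Rightarrow> real"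
  assumes f_meas [measurable]: "f \<in> borel_measurable borel" "f' \<in> borel_measurable borel"
    and der: "\<And>x. ((\<lambda>t. f (x + t *\<^sub>R e h)) has_real_derivative f' x) (at 0)"
    and cont: "\<And>x. continuous_on UNIV (\<lambda>t. f' (x + t *\<^sub>R e h))"
    and bd: "\<And>x. \<bar>f x\<bar> \<le> B" "\<And>x. \<bar>f' x\<bar> \<le> B"
  shows "(\<integral>x. f' x \<partial>\<nu>) = (\<integral>x. f x * score m (\<mu> h) (x \<bullet> e h) \<partial>\<nu>)"
proof -
  have i1: "integrable \<nu> f'"
    by (rule integrable_const_bound[where B=B]) (auto simp: bd)
  have i2: "integrable \<nu> (\<lambda>x. f x * score m (\<mu> h) (x \<bullet> e h))"
    by (rule integrable_bounded_mult_score[OF f_meas(1) bd(1)])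
  have line: "indicator ell2 (X(h := 0)) * (\<integral>t. f' (synth (X(h := 0)) + t *\<^sub>R e h) \<partial>nu1 m (\<mu> h))
     = indicator ell2 (X(h := 0)) * (\<integral>t. f (synth (X(h := 0)) + t *\<^sub>R e h) *
         score m (\<mu> h) ((synth (X(h := 0)) + t *\<^sub>R e h) \<bullet> e h) \<partial>nu1 m (\<mu> h))" for X
  proof (cases "X(h := 0) \<in> ell2")
    case True
    define y where "y = synth (X(h := 0))"
    have yt: "(y + t *\<^sub>R e h) \<bullet> e h = t" for t
      using synth_inner[OF True, of h] by (simp add: y_def inner_add_left orth)
    have "(\<integral>t. f' (y + t *\<^sub>R e h) \<partial>nu1 m (\<mu> h)) = (\<integral>t. f (y + t *\<^sub>R e h) * score m (\<mu> h) t \<partial>nu1 m (\<mu> h))"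
    proof (rule nu1_integration_by_parts[OF m \<mu>])
      fix t
      have "((\<lambda>s. f ((y + t *\<^sub>R e h) + s *\<^sub>R e h)) has_real_derivative f' (y + t *\<^sub>R e h)) (at 0)"
        by (rule der)
      also have "(\<lambda>s. f ((y + t *\<^sub>R e h) + s *\<^sub>R e h)) = (\<lambda>s. (\<lambda>r. f (y + r *\<^sub>R e h)) (s + t))"
        by (simp add: scaleR_add_left add_ac)
      finally show "((\<lambda>r. f (y + r *\<^sub>R e h)) has_real_derivative f' (y + t *\<^sub>R e h)) (at t)"
        using DERIV_shift[of "\<lambda>r. f (y + r *\<^sub>R e h)" _ 0 t] by simp
    qed (use cont bd in auto)
    thus ?thesis unfolding y_def[symmetric] yt by simp
  qed simp
  show ?thesis
    unfolding integral_along_coord[OF i1, of h] integral_along_coord[OF i2, of h] line ..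
qed

end

section \<open>Uniqueness of the closed gradient\<close>

text \<open>A bounded smooth function whose steepness \<open>j\<close> makes it approach the indicator of \<open>{a<..}\<close> off the
  point \<open>a\<close>, which is a null set for every coordinate.\<close>

definition logistic :: "real \<Rightarrow> real \<Rightarrow> real \<Rightarrow> real" where
  "logistic j a t = 1 / (1 + exp (- (j * (t - a))))"

lemma logistic_bounds: "0 \<le> logistic j a t" "logistic j a t \<le> 1"
  unfolding logistic_def by (auto simp: divide_simps add_pos_pos)

lemma logistic_deriv:
  "(logistic j a has_real_derivative j * logistic j a t * (1 - logistic j a t)) (at t)"
proof -
  define E where "E = exp (- (j * (t - a)))"
  have E: "1 + E > 0" by (simp add: E_def add_pos_pos)
  have "((\<lambda>t. 1 / (1 + exp (- (j * (t - a))))) has_real_derivative j * E / (1 + E)\<^sup>2) (at t)"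
    using E unfolding E_def
    by (auto intro!: derivative_eq_intros simp: power2_eq_square)
  moreover have "j * E / (1 + E)\<^sup>2 = j * (1 / (1 + E)) * (1 - 1 / (1 + E))"
    using E by (simp add: field_simps power2_eq_square)
  ultimately show ?thesis by (simp add: logistic_def[abs_def] E_def)
qed

lemma continuous_logistic: "continuous_on UNIV (logistic j a)"
  by (rule DERIV_continuous_on[OF DERIV_subset[OF logistic_deriv]]) simp

lemma logistic_tendsto:
  assumes "t \<noteq> a"
  shows "(\<lambda>n. logistic (real n) a t) \<longlonglongrightarrow> of_bool (a < t)"
proof (cases "a < t")
  case True
  have "filterlim (\<lambda>n. - (real n * (t - a))) at_bot sequentially"
    using True by (intro filterlim_uminus_at_bot[THEN iffD2])
       (simp add: filterlim_at_top_mult_tendsto_pos[OF tendsto_const _ filterlim_real_sequentially])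
  hence "(\<lambda>n. exp (- (real n * (t - a)))) \<longlonglongrightarrow> 0"
    by (rule filterlim_compose[OF exp_at_bot])
  hence "(\<lambda>n. 1 / (1 + exp (- (real n * (t - a))))) \<longlonglongrightarrow> 1 / (1 + 0)"
    by (intro tendsto_intros) auto
  thus ?thesis using True by (simp add: logistic_def)
next
  case False
  have "filterlim (\<lambda>n. real n * (a - t)) at_top sequentially"
    using False assms
    by (intro filterlim_at_top_mult_tendsto_pos[OF tendsto_const _ filterlim_real_sequentially]) auto
  hence "filterlim (\<lambda>n. 1 + exp (real n * (a - t))) at_top sequentially"
    by (intro filterlim_tendsto_add_at_top[OF tendsto_const] filterlim_compose[OF exp_at_top])
  hence "(\<lambda>n. 1 / (1 + exp (real n * (a - t)))) \<longlonglongrightarrow> 0"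
    by (intro tendsto_divide_0[OF tendsto_const] filterlim_at_top_imp_at_infinity)
  moreover have "- (real n * (t - a)) = real n * (a - t)" for n by (simp add: algebra_simps)
  ultimately show ?thesis using False by (simp add: logistic_def)
qed

context exp_power_product
begin

lemma Lp_bounded:
  fixes f :: "'a \<Rightarrow> 'b::{real_normed_vector, second_countable_topology}"
  assumes [measurable]: "f \<in> borel_measurable borel" and bd: "\<And>x. norm (f x) \<le> B" and q: "q \<ge> 0"
  shows "f \<in> Lp q \<nu>"
  unfolding Lp_def
proof (intro CollectI conjI)
  show "integrable \<nu> (\<lambda>x. norm (f x) powr q)"
    by (rule integrable_const_bound[where B="B powr q"]) (use bd q in \<open>auto intro!: powr_mono2\<close>)
qed measurable

lemma Lp_imp_integrable:
  fixes f :: "'a \<Rightarrow> 'b::{real_inner, second_countable_topology}"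
  assumes "f \<in> Lp p \<nu>" "p > 1"
  shows "integrable \<nu> (\<lambda>x. f x \<bullet> v)"
  by (rule Lp_inner_integrable[OF assms(1) Lp_bounded[where B="norm v"] assms(2)])
     (use assms in auto)

text \<open>Integration by parts for the product of \<open>\<phi>\<close> with a test function that is smooth in the direction
  \<open>e h\<close> and merely measurable in the others.\<close>

lemma ibp_test_function:
  fixes \<rho> \<rho>' :: "real \<Rightarrow> real"
  assumes \<phi>: "\<phi> \<in> Cb1" and A [measurable]: "A \<in> sets borel"
    and inv: "\<And>x t. x + t *\<^sub>R e h \<in> A \<longleftrightarrow> x \<in> A"
    and \<rho>: "\<And>t. (\<rho> has_real_derivative \<rho>' t) (at t)" "continuous_on UNIV \<rho>'"
    and bd: "\<And>t. \<bar>\<rho> t\<bar> \<le> C" "\<And>t. \<bar>\<rho>' t\<bar> \<le> C"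
  shows "(\<integral>x. (grad \<phi> x \<bullet> e h) * (indicator A x * \<rho> (x \<bullet> e h)) \<partial>\<nu>) =
     (\<integral>x. \<phi> x * (indicator A x * \<rho> (x \<bullet> e h) * score m (\<mu> h) (x \<bullet> e h) - indicator A x * \<rho>' (x \<bullet> e h)) \<partial>\<nu>)"
proof -
  obtain B where B: "B \<ge> 0" "\<And>x. \<bar>\<phi> x\<bar> \<le> B" "\<And>x. norm (grad \<phi> x) \<le> B"
    using Cb1_bounds[OF \<phi>] by blast
  have C: "C \<ge> 0" using bd(1)[of 0] by linarith
  have cont_\<rho>: "continuous_on UNIV \<rho>"
    by (rule DERIV_continuous_on[OF DERIV_subset[OF \<rho>(1)]]) simp
  note cont = Cb1_continuous[OF \<phi>] cont_\<rho> \<rho>(2)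
  have [measurable]: "\<phi> \<in> borel_measurable borel" "grad \<phi> \<in> borel_measurable borel"
    "\<rho> \<in> borel_measurable borel" "\<rho>' \<in> borel_measurable borel"
    using cont by (auto intro: borel_measurable_continuous_onI)
  define a where "a x = (grad \<phi> x \<bullet> e h) * (indicator A x * \<rho> (x \<bullet> e h))" for x
  define b where "b x = \<phi> x * (indicator A x * \<rho>' (x \<bullet> e h))" for x
  define f where "f x = \<phi> x * (indicator A x * \<rho> (x \<bullet> e h))" for x
  have [measurable]: "a \<in> borel_measurable borel" "b \<in> borel_measurable borel" "f \<in> borel_measurable borel"
    unfolding a_def[abs_def] b_def[abs_def] f_def[abs_def] by measurable
  have grad_bd: "\<bar>grad \<phi> x \<bullet> e h\<bar> \<le> B" for x
    using abs_coord_le_norm[of "grad \<phi> x" h] B(3)[of x] by linarith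
  have bds: "\<bar>a x\<bar> \<le> B * C" "\<bar>b x\<bar> \<le> B * C" "\<bar>f x\<bar> \<le> B * C" for x
    using grad_bd[of x] B C bd unfolding a_def b_def f_def
    by (auto simp: abs_mult indicator_def intro!: mult_mono)
  have eh: "(x + t *\<^sub>R e h) \<bullet> e h = x \<bullet> e h + t" for x t
    by (simp add: inner_add_left orth)
  have ind: "indicator A (x + t *\<^sub>R e h) = (indicator A x :: real)" for x t
    using inv by (simp add: indicator_def)
  have "(\<integral>x. a x + b x \<partial>\<nu>) = (\<integral>x. f x * score m (\<mu> h) (x \<bullet> e h) \<partial>\<nu>)"
  proof (rule integration_by_parts_coord)
    fix x
    have d1: "((\<lambda>t. \<phi> (x + t *\<^sub>R e h)) has_real_derivative grad \<phi> x \<bullet> e h) (at 0)"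
      by (rule Cb1_line[OF \<phi>])
    have d2: "((\<lambda>t. \<rho> (x \<bullet> e h + t)) has_real_derivative \<rho>' (x \<bullet> e h)) (at 0)"
      using DERIV_shift[of \<rho> _ 0 "x \<bullet> e h"] \<rho>(1)[of "x \<bullet> e h"] by (simp add: add.commute)
    have d3: "((\<lambda>t. \<phi> (x + t *\<^sub>R e h) * \<rho> (x \<bullet> e h + t)) has_real_derivative
        (grad \<phi> x \<bullet> e h) * \<rho> (x \<bullet> e h) + \<phi> x * \<rho>' (x \<bullet> e h)) (at 0)"
      using DERIV_mult[OF d1 d2] by (simp add: mult.commute)
    have "((\<lambda>t. indicator A x * (\<phi> (x + t *\<^sub>R e h) * \<rho> (x \<bullet> e h + t))) has_real_derivative
        indicator A x * ((grad \<phi> x \<bullet> e h) * \<rho> (x \<bullet> e h) + \<phi> x * \<rho>' (x \<bullet> e h))) (at 0)"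
      by (rule DERIV_cmult[OF d3])
    moreover have "(\<lambda>t. f (x + t *\<^sub>R e h)) = (\<lambda>t. indicator A x * (\<phi> (x + t *\<^sub>R e h) * \<rho> (x \<bullet> e h + t)))"
      by (simp add: f_def eh ind mult_ac)
    moreover have "a x + b x = indicator A x * ((grad \<phi> x \<bullet> e h) * \<rho> (x \<bullet> e h) + \<phi> x * \<rho>' (x \<bullet> e h))"
      by (simp add: a_def b_def algebra_simps)
    ultimately show "((\<lambda>t. f (x + t *\<^sub>R e h)) has_real_derivative a x + b x) (at 0)" by simp
    have "continuous_on UNIV (\<lambda>t. grad \<phi> (x + t *\<^sub>R e h) \<bullet> e h * (indicator A x * \<rho> (x \<bullet> e h + t))
        + \<phi> (x + t *\<^sub>R e h) * (indicator A x * \<rho>' (x \<bullet> e h + t)))"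
      by (intro continuous_intros continuous_on_compose2[OF cont(1)] continuous_on_compose2[OF cont(2)]
          continuous_on_compose2[OF cont(3)] continuous_on_compose2[OF cont(4)]) auto
    thus "continuous_on UNIV (\<lambda>t. a (x + t *\<^sub>R e h) + b (x + t *\<^sub>R e h))"
      by (simp add: a_def b_def eh ind)
    show "\<bar>f x\<bar> \<le> 2 * (B * C)" using bds(3)[of x] B C by (smt (verit) mult_nonneg_nonneg)
    show "\<bar>a x + b x\<bar> \<le> 2 * (B * C)" using bds(1,2)[of x] by linarith
  qed measurable
  moreover have "integrable \<nu> a" "integrable \<nu> b"
    by (rule integrable_const_bound[where B="B * C"]; use bds in simp)+
  moreover have "integrable \<nu> (\<lambda>x. f x * score m (\<mu> h) (x \<bullet> e h))"
    by (rule integrable_bounded_mult_score[where B="B * C"]) (use bds in auto)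
  ultimately have "(\<integral>x. a x \<partial>\<nu>) = (\<integral>x. f x * score m (\<mu> h) (x \<bullet> e h) - b x \<partial>\<nu>)" by simp
  also have "\<dots> = (\<integral>x. \<phi> x * (indicator A x * \<rho> (x \<bullet> e h) * score m (\<mu> h) (x \<bullet> e h) - indicator A x * \<rho>' (x \<bullet> e h)) \<partial>\<nu>)"
    by (rule Bochner_Integration.integral_cong) (auto simp: f_def b_def algebra_simps)
  finally show ?thesis by (simp add: a_def)
qed

text \<open>The right-hand side depends on \<open>\<phi>\<close> alone: pairing with test functions determines \<open>F\<close>. The formula
  passes from the approximating smooth functions to the limit because the test function and its
  counterpart on the right belong to the dual exponent.\<close>

lemma M_graph_test_function:
  fixes \<rho> \<rho>' :: "real \<Rightarrow> real"
  assumes M: "M_graph \<nu> R p \<phi> F" and p: "p > 1" and A [measurable]: "A \<in> sets borel"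
    and inv: "\<And>x t. x + t *\<^sub>R e h \<in> A \<longleftrightarrow> x \<in> A"
    and \<rho>: "\<And>t. (\<rho> has_real_derivative \<rho>' t) (at t)" "continuous_on UNIV \<rho>'"
    and bd: "\<And>t. \<bar>\<rho> t\<bar> \<le> C" "\<And>t. \<bar>\<rho>' t\<bar> \<le> C"
  shows "(\<integral>x. (F x \<bullet> e h) * (indicator A x * \<rho> (x \<bullet> e h)) \<partial>\<nu>) = sqrt (lam h) *
     (\<integral>x. \<phi> x * (indicator A x * \<rho> (x \<bullet> e h) * score m (\<mu> h) (x \<bullet> e h) - indicator A x * \<rho>' (x \<bullet> e h)) \<partial>\<nu>)"
proof -
  define q where "q = p / (p - 1)"
  have q: "q > 0" using p by (simp add: q_def)
  obtain \<psi> where \<psi>: "\<And>n. \<psi> n \<in> Cb1" "Lp_tendsto p \<nu> \<psi> \<phi>" "Lp_tendsto p \<nu> (\<lambda>n x. R (grad (\<psi> n) x)) F"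
    using M unfolding M_graph_def by blast
  have C: "C \<ge> 0" using bd(1)[of 0] by linarith
  have cont_\<rho>: "continuous_on UNIV \<rho>"
    by (rule DERIV_continuous_on[OF DERIV_subset[OF \<rho>(1)]]) simp
  have [measurable]: "\<rho> \<in> borel_measurable borel" "\<rho>' \<in> borel_measurable borel"
    using cont_\<rho> \<rho>(2) by (auto intro: borel_measurable_continuous_onI)
  define u where "u x = indicator A x * \<rho> (x \<bullet> e h)" for x
  define v where "v x = indicator A x * \<rho>' (x \<bullet> e h)" for x
  define w where "w x = u x * score m (\<mu> h) (x \<bullet> e h) - v x" for x
  have [measurable]: "u \<in> borel_measurable borel" "v \<in> borel_measurable borel"
    unfolding u_def[abs_def] v_def[abs_def] by measurable
  have uv: "\<bar>u x\<bar> \<le> C" "\<bar>v x\<bar> \<le> C" for x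
    using bd C by (auto simp: u_def v_def indicator_def)
  have "(\<lambda>x. u x *\<^sub>R e h) \<in> Lp q \<nu>"
    by (rule Lp_bounded[where B=C]) (use uv q in auto)
  hence l1: "(\<lambda>n. \<integral>x. R (grad (\<psi> n) x) \<bullet> (u x *\<^sub>R e h) \<partial>\<nu>) \<longlonglongrightarrow> (\<integral>x. F x \<bullet> (u x *\<^sub>R e h) \<partial>\<nu>)"
    unfolding q_def by (rule Lp_tendsto_inner[OF \<psi>(3) _ p])
  have "(\<lambda>x. u x * score m (\<mu> h) (x \<bullet> e h)) \<in> Lp q \<nu>"
    unfolding Lp_def
  proof (intro CollectI conjI)
    show "integrable \<nu> (\<lambda>x. norm (u x * score m (\<mu> h) (x \<bullet> e h)) powr q)"
    proof (rule Bochner_Integration.integrable_bound)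
      show "integrable \<nu> (\<lambda>x. C powr q * \<bar>score m (\<mu> h) (x \<bullet> e h)\<bar> powr q)"
        using q by (intro integrable_mult_right score_coord_powr) auto
      have "\<bar>u x\<bar> powr q \<le> C powr q" for x using uv q by (intro powr_mono2) auto
      thus "AE x in \<nu>. norm (norm (u x * score m (\<mu> h) (x \<bullet> e h)) powr q)
             \<le> norm (C powr q * \<bar>score m (\<mu> h) (x \<bullet> e h)\<bar> powr q)"
        by (intro AE_I2) (simp add: abs_mult powr_mult mult_right_mono)
    qed measurable
  qed measurable
  moreover have "v \<in> Lp q \<nu>" by (rule Lp_bounded[where B=C]) (use uv q in auto)
  ultimately have "w \<in> Lp q \<nu>" unfolding w_def[abs_def] by (rule Lp_diff[OF _ _ q])
  hence l2: "(\<lambda>n. \<integral>x. \<psi> n x \<bullet> w x \<partial>\<nu>) \<longlonglongrightarrow> (\<integral>x. \<phi> x \<bullet> w x \<partial>\<nu>)"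
    unfolding q_def by (rule Lp_tendsto_inner[OF \<psi>(2) _ p])
  have "(\<integral>x. R (grad (\<psi> n) x) \<bullet> (u x *\<^sub>R e h) \<partial>\<nu>) = sqrt (lam h) * (\<integral>x. \<psi> n x \<bullet> w x \<partial>\<nu>)" for n
  proof -
    have "(\<integral>x. R (grad (\<psi> n) x) \<bullet> (u x *\<^sub>R e h) \<partial>\<nu>) = (\<integral>x. sqrt (lam h) * ((grad (\<psi> n) x \<bullet> e h) * u x) \<partial>\<nu>)"
      by (rule Bochner_Integration.integral_cong) (auto simp: R_coord mult_ac)
    also have "\<dots> = sqrt (lam h) * (\<integral>x. (grad (\<psi> n) x \<bullet> e h) * u x \<partial>\<nu>)" by simp
    also have "(\<integral>x. (grad (\<psi> n) x \<bullet> e h) * u x \<partial>\<nu>) = (\<integral>x. \<psi> n x \<bullet> w x \<partial>\<nu>)"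
      using ibp_test_function[OF \<psi>(1)[of n] A inv \<rho> bd] by (simp add: u_def v_def w_def)
    finally show ?thesis .
  qed
  hence "(\<lambda>n. sqrt (lam h) * (\<integral>x. \<psi> n x \<bullet> w x \<partial>\<nu>)) \<longlonglongrightarrow> (\<integral>x. F x \<bullet> (u x *\<^sub>R e h) \<partial>\<nu>)"
    using l1 by simp
  moreover have "(\<lambda>n. sqrt (lam h) * (\<integral>x. \<psi> n x \<bullet> w x \<partial>\<nu>)) \<longlonglongrightarrow> sqrt (lam h) * (\<integral>x. \<phi> x \<bullet> w x \<partial>\<nu>)"
    by (intro tendsto_mult_left l2)
  ultimately have "(\<integral>x. F x \<bullet> (u x *\<^sub>R e h) \<partial>\<nu>) = sqrt (lam h) * (\<integral>x. \<phi> x \<bullet> w x \<partial>\<nu>)"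
    by (rule LIMSEQ_unique)
  thus ?thesis by (simp add: u_def v_def w_def mult_ac)
qed

text \<open>Closability of \<open>R\<close> composed with the gradient. Two candidates for the image of \<open>\<phi>\<close> have equal
  pairings with every test function, so the coordinates of their difference integrate to zero over
  cylinders, the indicator of a half-space in direction \<open>e h\<close> being a limit of logistic functions.\<close>

lemma M_graph_unique:
  assumes M: "M_graph \<nu> R p \<phi> F" "M_graph \<nu> R p \<phi> F'" and p: "p > 1"
  shows "AE x in \<nu>. F x = F' x"
proof -
  have Lp: "F \<in> Lp p \<nu>" "F' \<in> Lp p \<nu>" using M by (auto simp: M_graph_def Lp_tendsto_def)
  have "AE x in \<nu>. F x \<bullet> e h - F' x \<bullet> e h = 0" for h
  proof (rule AE_eq_0_if_cylinder_integrals)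
    have iF: "integrable \<nu> (\<lambda>x. F x \<bullet> e h)" "integrable \<nu> (\<lambda>x. F' x \<bullet> e h)"
      using Lp p by (auto intro: Lp_imp_integrable)
    show iD: "integrable \<nu> (\<lambda>x. F x \<bullet> e h - F' x \<bullet> e h)"
      using iF by simp
    note [measurable] = borel_measurable_integrable[OF iD] borel_measurable_integrable[OF iF(1)] borel_measurable_integrable[OF iF(2)]
    have test: "(\<integral>x. (indicator A x * \<rho> (x \<bullet> e h)) * (F x \<bullet> e h - F' x \<bullet> e h) \<partial>\<nu>) = 0"
      if A [measurable]: "A \<in> sets borel" and inv: "\<And>x t. x + t *\<^sub>R e h \<in> A \<longleftrightarrow> x \<in> A"
        and \<rho>: "\<And>t. (\<rho> has_real_derivative \<rho>' t) (at t)" "continuous_on UNIV \<rho>'"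
        and bd: "\<And>t. \<bar>\<rho> t\<bar> \<le> C" "\<And>t. \<bar>\<rho>' t\<bar> \<le> C" for A \<rho> \<rho>' C
    proof -
      have [measurable]: "\<rho> \<in> borel_measurable borel"
        by (intro borel_measurable_continuous_onI DERIV_continuous_on[OF DERIV_subset[OF \<rho>(1)]]) simp
      have C: "C \<ge> 0" using bd(1)[of 0] by linarith
      have i: "integrable \<nu> (\<lambda>x. (G x \<bullet> e h) * (indicator A x * \<rho> (x \<bullet> e h)))"
        if "integrable \<nu> (\<lambda>x. G x \<bullet> e h)" for G
      proof (rule Bochner_Integration.integrable_bound)
        have [measurable]: "(\<lambda>x. G x \<bullet> e h) \<in> borel_measurable \<nu>" by (rule borel_measurable_integrable[OF that])
        show "(\<lambda>x. (G x \<bullet> e h) * (indicator A x * \<rho> (x \<bullet> e h))) \<in> borel_measurable \<nu>" by measurable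
        show "integrable \<nu> (\<lambda>x. C * (G x \<bullet> e h))" using that by simp
        have "\<bar>indicator A x * \<rho> (x \<bullet> e h)\<bar> \<le> C" for x using bd C by (auto simp: indicator_def)
        thus "AE x in \<nu>. norm ((G x \<bullet> e h) * (indicator A x * \<rho> (x \<bullet> e h))) \<le> norm (C * (G x \<bullet> e h))"
          using C by (intro AE_I2)
            (simp add: abs_mult[of "G _ \<bullet> e h"] abs_mult[of C] mult.commute[of "\<bar>G _ \<bullet> e h\<bar>"] mult_right_mono)
      qed
      have "(\<integral>x. (F x \<bullet> e h) * (indicator A x * \<rho> (x \<bullet> e h)) \<partial>\<nu>) = (\<integral>x. (F' x \<bullet> e h) * (indicator A x * \<rho> (x \<bullet> e h)) \<partial>\<nu>)"
        using M_graph_test_function[OF M(1) p A inv \<rho> bd] M_graph_test_function[OF M(2) p A inv \<rho> bd] by simp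
      hence "(\<integral>x. (F x \<bullet> e h) * (indicator A x * \<rho> (x \<bullet> e h)) - (F' x \<bullet> e h) * (indicator A x * \<rho> (x \<bullet> e h)) \<partial>\<nu>) = 0"
        using i[OF iF(1)] i[OF iF(2)] by simp
      thus ?thesis by (simp only: left_diff_distrib[symmetric] mult.commute)
    qed
    fix B assume "B \<in> coord_cylinders"
    then obtain K a where K: "finite K" and B: "B = {x. \<forall>k\<in>K. a k < x \<bullet> e k}"
      unfolding coord_cylinders_def by blast
    \<comment> \<open>The constraint in direction \<open>e h\<close>, if present, is removed: the remaining cylinder is invariant under that direction, and the logistic functions restore the constraint in the limit.\<close>
    define A where "A = {x. \<forall>k\<in>K - {h}. a k < x \<bullet> e k}"
    have "A \<in> coord_cylinders" unfolding A_def coord_cylinders_def using K by blast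
    hence A [measurable]: "A \<in> sets borel" unfolding sets_borel_eq_coord_cylinders by (rule sigma_sets.Basic)
    have inv: "x + t *\<^sub>R e h \<in> A \<longleftrightarrow> x \<in> A" for x t
      unfolding A_def by (auto simp: inner_add_left orth)
    show "(\<integral>x. indicator B x * (F x \<bullet> e h - F' x \<bullet> e h) \<partial>\<nu>) = 0"
    proof (cases "h \<in> K")
      case False
      hence "A = B" by (auto simp: A_def B)
      thus ?thesis using test[OF A inv, of "\<lambda>_. 1" "\<lambda>_. 0" 1] by simp
    next
      case True
      have "(\<integral>x. (indicator A x * logistic (real n) (a h) (x \<bullet> e h)) * (F x \<bullet> e h - F' x \<bullet> e h) \<partial>\<nu>) = 0" for n
      proof (rule test[OF A inv logistic_deriv])
        show "continuous_on UNIV (\<lambda>t. real n * logistic (real n) (a h) t * (1 - logistic (real n) (a h) t))"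
          by (intro continuous_intros continuous_logistic)
        fix t
        have l: "0 \<le> logistic (real n) (a h) t" "logistic (real n) (a h) t \<le> 1" by (rule logistic_bounds)+
        show "\<bar>logistic (real n) (a h) t\<bar> \<le> real n + 1" using l by simp
        have "logistic (real n) (a h) t * (1 - logistic (real n) (a h) t) \<le> 1 * 1"
          using l by (intro mult_mono) auto
        hence "real n * (logistic (real n) (a h) t * (1 - logistic (real n) (a h) t)) \<le> real n * 1"
          by (intro mult_left_mono) auto
        thus "\<bar>real n * logistic (real n) (a h) t * (1 - logistic (real n) (a h) t)\<bar> \<le> real n + 1"
          using l by (simp add: abs_mult mult.assoc)
      qed
      moreover have "(\<lambda>n. \<integral>x. (indicator A x * logistic (real n) (a h) (x \<bullet> e h)) * (F x \<bullet> e h - F' x \<bullet> e h) \<partial>\<nu>)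
          \<longlonglongrightarrow> (\<integral>x. indicator B x * (F x \<bullet> e h - F' x \<bullet> e h) \<partial>\<nu>)"
      proof (rule integral_dominated_convergence)
        show "integrable \<nu> (\<lambda>x. \<bar>F x \<bullet> e h - F' x \<bullet> e h\<bar>)" using iD by (rule integrable_abs)
        have [measurable]: "logistic (real n) (a h) \<in> borel_measurable borel" for n
          by (rule borel_measurable_continuous_onI[OF continuous_logistic])
        show "(\<lambda>x. (indicator A x * logistic (real n) (a h) (x \<bullet> e h)) * (F x \<bullet> e h - F' x \<bullet> e h)) \<in> borel_measurable \<nu>" for n
          by measurable
        have "B \<in> sets borel" using \<open>B \<in> coord_cylinders\<close> unfolding sets_borel_eq_coord_cylinders by (rule sigma_sets.Basic)
        thus "(\<lambda>x. indicator B x * (F x \<bullet> e h - F' x \<bullet> e h)) \<in> borel_measurable \<nu>" by measurable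
        show "AE x in \<nu>. (\<lambda>n. (indicator A x * logistic (real n) (a h) (x \<bullet> e h)) * (F x \<bullet> e h - F' x \<bullet> e h))
            \<longlonglongrightarrow> indicator B x * (F x \<bullet> e h - F' x \<bullet> e h)"
          using AE_coord_neq[of h "a h"]
        proof eventually_elim
          case (elim x)
          have "indicator B x = indicator A x * (of_bool (a h < x \<bullet> e h) :: real)"
            using True by (auto simp: A_def B indicator_def)
          thus ?case by (simp only:) (intro tendsto_mult tendsto_const logistic_tendsto elim)
        qed
        show "AE x in \<nu>. norm ((indicator A x * logistic (real n) (a h) (x \<bullet> e h)) * (F x \<bullet> e h - F' x \<bullet> e h)) \<le> \<bar>F x \<bullet> e h - F' x \<bullet> e h\<bar>" for n
        proof (rule AE_I2)
          fix x
          have "\<bar>indicator A x * logistic (real n) (a h) (x \<bullet> e h)\<bar> \<le> 1"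
            using logistic_bounds[of "real n" "a h" "x \<bullet> e h"] by (auto simp: indicator_def)
          thus "norm ((indicator A x * logistic (real n) (a h) (x \<bullet> e h)) * (F x \<bullet> e h - F' x \<bullet> e h)) \<le> \<bar>F x \<bullet> e h - F' x \<bullet> e h\<bar>"
            unfolding real_norm_def abs_mult[of "indicator A x * _"] by (rule mult_left_le_one_le[rotated 2]) auto
        qed
      qed
      ultimately show ?thesis by (simp add: LIMSEQ_const_iff)
    qed
  qed simp
  hence "AE x in \<nu>. \<forall>h. F x \<bullet> e h - F' x \<bullet> e h = 0" by (simp add: AE_all_countable)
  thus ?thesis by eventually_elim (auto intro: eq_if_coords_eq)
qed

lemma M_graph_cong_AE:
  assumes "M_graph \<nu> R p \<phi> F" "AE x in \<nu>. \<phi> x = \<phi>' x" "\<phi>' \<in> borel_measurable \<nu>"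
  shows "M_graph \<nu> R p \<phi>' F"
  using assms unfolding M_graph_def by (blast intro: Lp_tendsto_cong_AE)

end

section \<open>Smooth approximation of the squared norm and of linear functionals\<close>

lemma abs_divide_le_abs:
  fixes a c :: real
  assumes "c \<ge> 1"
  shows "\<bar>a / c\<bar> \<le> \<bar>a\<bar>"
  using assms mult_left_mono[of 1 c "\<bar>a\<bar>"] by (simp add: abs_divide divide_le_eq)

text \<open>Composing with \<open>t \<mapsto> t / (1 + t / k)\<close> keeps the function below the original one, which later provides
  the integrable majorant, and makes it bounded with bounded gradient.\<close>

lemma Cb1_saturated_square_norm:
  fixes k :: real
  assumes k: "k > 0"
  defines "\<psi> \<equiv> (\<lambda>x::'a::real_inner. (norm x)\<^sup>2 / (1 + (norm x)\<^sup>2 / k))"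
    and "D \<equiv> (\<lambda>x::'a. (2 / (1 + (norm x)\<^sup>2 / k)\<^sup>2) *\<^sub>R x)"
  shows "\<psi> \<in> Cb1" "grad \<psi> = D"
proof -
  have pos: "1 + (norm x)\<^sup>2 / k \<ge> 1" for x :: 'a using k by simp
  have der: "GDERIV \<psi> x :> D x" for x
  proof -
    have d1: "GDERIV (\<lambda>x. (norm x)\<^sup>2) x :> 2 *\<^sub>R x"
      unfolding gderiv_def power2_norm_eq_inner
      by (auto intro!: derivative_eq_intros simp: inner_commute)
    have d2: "((\<lambda>t. t / (1 + t / k)) has_real_derivative 1 / (1 + (norm x)\<^sup>2 / k)\<^sup>2) (at ((norm x)\<^sup>2))"
    proof -
      have "1 + s / k \<noteq> 0 \<Longrightarrow> ((\<lambda>t. t / (1 + t / k)) has_real_derivative 1 / (1 + s / k)\<^sup>2) (at s)" for s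
        using k by (auto intro!: derivative_eq_intros simp: power2_eq_square)
      thus ?thesis using pos[of x] by simp
    qed
    show ?thesis using GDERIV_DERIV_compose[OF d1 d2] by (simp add: \<psi>_def D_def)
  qed
  have cont: "continuous_on UNIV D"
    unfolding D_def using pos k by (intro continuous_intros) (auto simp: add_nonneg_eq_0_iff)
  have bd1: "\<bar>\<psi> x\<bar> \<le> k" for x
  proof -
    have "(norm x)\<^sup>2 \<le> k * (1 + (norm x)\<^sup>2 / k)" using k by (simp add: field_simps)
    moreover have c: "1 + (norm x)\<^sup>2 / k > 0" using pos[of x] by linarith
    ultimately have "\<psi> x \<le> k" unfolding \<psi>_def by (simp only: pos_divide_le_eq[OF c])
    moreover have "\<psi> x \<ge> 0" unfolding \<psi>_def using c by (intro divide_nonneg_pos) auto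
    ultimately show ?thesis by simp
  qed
  have bd2: "norm (D x) \<le> 2 * (1 + k)" for x
  proof -
    define c where "c = 1 + (norm x)\<^sup>2 / k"
    have c: "c \<ge> 1" using pos by (simp add: c_def)
    have "norm x \<le> 1 + (norm x)\<^sup>2"
      using zero_le_power2[of "norm x - 1/2"] by (simp add: power2_eq_square algebra_simps)
    also have "\<dots> \<le> (1 + k) * c" using k by (simp add: c_def field_simps)
    also have "\<dots> \<le> (1 + k) * c\<^sup>2" using c k by (intro mult_left_mono) (auto simp: power2_eq_square)
    finally have "norm x / c\<^sup>2 \<le> 1 + k" using c by (simp add: divide_le_eq)
    thus ?thesis by (simp add: D_def c_def[symmetric])
  qed
  show "\<psi> \<in> Cb1" "grad \<psi> = D" using Cb1I[OF der cont bd1 bd2] by auto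
qed

lemma Cb1_saturated_linear:
  fixes k :: real and u :: "'a::real_inner"
  assumes k: "k > 0"
  defines "\<psi> \<equiv> (\<lambda>x. (x \<bullet> u) / (1 + (x \<bullet> u)\<^sup>2 / k))"
    and "D \<equiv> (\<lambda>x. ((1 - (x \<bullet> u)\<^sup>2 / k) / (1 + (x \<bullet> u)\<^sup>2 / k)\<^sup>2) *\<^sub>R u)"
  shows "\<psi> \<in> Cb1" "grad \<psi> = D" "\<bar>(1 - (x \<bullet> u)\<^sup>2 / k) / (1 + (x \<bullet> u)\<^sup>2 / k)\<^sup>2\<bar> \<le> 1"
proof -
  have pos: "1 + t\<^sup>2 / k \<ge> 1" for t :: real using k by simp
  have le1: "\<bar>(1 - t\<^sup>2 / k) / (1 + t\<^sup>2 / k)\<^sup>2\<bar> \<le> 1" for t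
  proof -
    define s where "s = t\<^sup>2 / k"
    have s: "s \<ge> 0" using k by (simp add: s_def)
    have "\<bar>1 - s\<bar> \<le> 1 + s" using s by simp
    also have "\<dots> \<le> (1 + s)\<^sup>2" using s by (simp add: power2_eq_square)
    finally show ?thesis using s unfolding s_def[symmetric] by (simp add: abs_divide divide_le_eq)
  qed
  thus "\<bar>(1 - (x \<bullet> u)\<^sup>2 / k) / (1 + (x \<bullet> u)\<^sup>2 / k)\<^sup>2\<bar> \<le> 1" .
  have der: "GDERIV \<psi> x :> D x" for x
  proof -
    have d1: "GDERIV (\<lambda>x. x \<bullet> u) x :> u"
      unfolding gderiv_def by (auto intro!: derivative_eq_intros)
    have d2: "((\<lambda>t. t / (1 + t\<^sup>2 / k)) has_real_derivative (1 - (x \<bullet> u)\<^sup>2 / k) / (1 + (x \<bullet> u)\<^sup>2 / k)\<^sup>2) (at (x \<bullet> u))"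
    proof -
      have "((\<lambda>t. t / (1 + t\<^sup>2 / k)) has_real_derivative (1 - s\<^sup>2 / k) / (1 + s\<^sup>2 / k)\<^sup>2) (at s)" for s
      proof -
        have "1 + s * s / k \<noteq> 0" using pos[of s] by (simp add: power2_eq_square)
        thus ?thesis using k by (auto intro!: derivative_eq_intros simp: power2_eq_square)
      qed
      thus ?thesis .
    qed
    show ?thesis using GDERIV_DERIV_compose[OF d1 d2] by (simp add: \<psi>_def D_def)
  qed
  have cont: "continuous_on UNIV D"
    unfolding D_def using pos k by (intro continuous_intros) (auto simp: add_nonneg_eq_0_iff)
  have bd1: "\<bar>\<psi> x\<bar> \<le> 1 + k" for x
  proof -
    define t where "t = \<bar>x \<bullet> u\<bar>"
    have "t \<le> 1 + t\<^sup>2"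
      using zero_le_power2[of "t - 1/2"] by (simp add: power2_eq_square algebra_simps)
    also have "\<dots> \<le> (1 + k) * (1 + t\<^sup>2 / k)" using k by (simp add: field_simps)
    finally have "t \<le> (1 + k) * (1 + (x \<bullet> u)\<^sup>2 / k)" by (simp add: t_def)
    thus ?thesis using pos[of "x \<bullet> u"] unfolding \<psi>_def abs_divide t_def
      by (simp add: divide_le_eq)
  qed
  have bd2: "norm (D x) \<le> 1 * norm u" for x
    unfolding D_def norm_scaleR using le1 by (intro mult_right_mono) auto
  show "\<psi> \<in> Cb1" "grad \<psi> = D" using Cb1I[OF der cont bd1 bd2] by auto
qed

lemma tendsto_saturation: "(\<lambda>n. 1 + c / real (Suc n)) \<longlonglongrightarrow> 1"
proof -
  have "(\<lambda>n. 1 + c * (1 / real (Suc n))) \<longlonglongrightarrow> 1 + c * 0"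
    by (intro tendsto_intros LIMSEQ_Suc[OF lim_1_over_n])
  thus ?thesis by simp
qed

context exp_power_product
begin

lemma Cb1_measurable:
  fixes \<phi> :: "'a \<Rightarrow> real"
  assumes "\<phi> \<in> Cb1" shows "\<phi> \<in> borel_measurable borel" "grad \<phi> \<in> borel_measurable borel"
  using Cb1_continuous[OF assms] by (auto intro: borel_measurable_continuous_onI)

text \<open>Dominated convergence for the functions and for their gradients at once.\<close>

lemma M_graphI:
  assumes \<psi>: "\<And>n. \<psi> n \<in> Cb1" and p: "p > 1"
    and lim: "\<And>x. (\<lambda>n. \<psi> n x) \<longlonglongrightarrow> \<phi> x" "\<And>x. (\<lambda>n. grad (\<psi> n) x) \<longlonglongrightarrow> D x"
    and bd: "\<And>n x. \<bar>\<psi> n x\<bar> \<le> H x" "\<And>n x. norm (grad (\<psi> n) x) \<le> H' x"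
    and int: "integrable \<nu> (\<lambda>x. H x powr p)" "integrable \<nu> (\<lambda>x. H' x powr p)"
    and meas [measurable]: "\<phi> \<in> borel_measurable borel" "D \<in> borel_measurable borel"
  shows "M_graph \<nu> R p \<phi> (\<lambda>x. R (D x))"
proof -
  note [measurable] = Cb1_measurable[OF \<psi>]
  obtain K where K: "K > 0" "\<And>x. norm (R x) \<le> norm x * K"
    using bounded_linear.pos_bounded[OF bounded_linear_R] by blast
  have "Lp_tendsto p \<nu> \<psi> \<phi>"
    by (rule Lp_tendsto_dominated[OF _ _ lim(1) _ int(1)]) (use bd p in auto)
  moreover have "Lp_tendsto p \<nu> (\<lambda>n x. R (grad (\<psi> n) x)) (\<lambda>x. R (D x))"
  proof (rule Lp_tendsto_dominated)
    show "(\<lambda>n. R (grad (\<psi> n) x)) \<longlonglongrightarrow> R (D x)" for x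
      by (rule bounded_linear.tendsto[OF bounded_linear_R lim(2)])
    show "norm (R (grad (\<psi> n) x)) \<le> K * H' x" for n x
    proof -
      have "norm (R (grad (\<psi> n) x)) \<le> norm (grad (\<psi> n) x) * K" by (rule K(2))
      also have "\<dots> \<le> H' x * K" using bd(2) K(1) by (intro mult_right_mono) auto
      finally show ?thesis by (simp only: mult.commute)
    qed
    have "integrable \<nu> (\<lambda>x. K powr p * H' x powr p)" using int(2) by simp
    moreover have "H' x \<ge> 0" for x using bd(2)[of 0 x] norm_ge_zero order_trans by blast
    ultimately show "integrable \<nu> (\<lambda>x. (K * H' x) powr p)" using K(1) by (simp add: powr_mult)
  qed (use p in auto)
  ultimately show ?thesis using \<psi> unfolding M_graph_def by blast
qed

text \<open>The witness is the same for every \<open>p\<close>, so it is a common value of all the operators.\<close>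

lemma M_graph_square_norm:
  assumes p: "p > 1"
  shows "M_graph \<nu> R p (\<lambda>x. (norm x)\<^sup>2) (\<lambda>x. R (2 *\<^sub>R x))"
proof (rule M_graphI[OF Cb1_saturated_square_norm(1) p])
  fix n and x :: 'a
  let ?k = "real (Suc n)"
  have c: "1 + (norm x)\<^sup>2 / ?k \<ge> 1" by simp
  show "\<bar>(norm x)\<^sup>2 / (1 + (norm x)\<^sup>2 / ?k)\<bar> \<le> (norm x)\<^sup>2"
    using abs_divide_le_abs[OF c, of "(norm x)\<^sup>2"] by simp
  have "norm (grad (\<lambda>x. (norm x)\<^sup>2 / (1 + (norm x)\<^sup>2 / ?k)) x) = 2 * norm x / (1 + (norm x)\<^sup>2 / ?k)\<^sup>2"
    by (subst Cb1_saturated_square_norm(2)) auto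
  also have "\<dots> \<le> 2 * norm x"
    using abs_divide_le_abs[OF one_le_power[OF c, of 2], of "2 * norm x"] by simp
  finally show "norm (grad (\<lambda>x. (norm x)\<^sup>2 / (1 + (norm x)\<^sup>2 / ?k)) x) \<le> 2 * norm x" .
next
  fix x :: 'a
  have "(\<lambda>n. (norm x)\<^sup>2 / (1 + (norm x)\<^sup>2 / real (Suc n))) \<longlonglongrightarrow> (norm x)\<^sup>2 / 1"
    by (intro tendsto_divide tendsto_const tendsto_saturation) simp
  thus "(\<lambda>n. (norm x)\<^sup>2 / (1 + (norm x)\<^sup>2 / real (Suc n))) \<longlonglongrightarrow> (norm x)\<^sup>2" by simp
  have "(\<lambda>n. (2 / (1 + (norm x)\<^sup>2 / real (Suc n))\<^sup>2) *\<^sub>R x) \<longlonglongrightarrow> (2 / 1\<^sup>2) *\<^sub>R x"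
    by (intro tendsto_scaleR tendsto_divide tendsto_power tendsto_const tendsto_saturation) simp
  thus "(\<lambda>n. grad (\<lambda>x. (norm x)\<^sup>2 / (1 + (norm x)\<^sup>2 / real (Suc n))) x) \<longlonglongrightarrow> 2 *\<^sub>R x"
    by (subst Cb1_saturated_square_norm(2)) auto
next
  have "(\<lambda>x::'a. ((norm x)\<^sup>2) powr p) = (\<lambda>x. norm x powr (2 * p))"
    by (rule ext) (simp add: powr_powr flip: powr_numeral)
  thus "integrable \<nu> (\<lambda>x. ((norm x)\<^sup>2) powr p)" using norm_moment[of "2 * p"] p by simp
  have "integrable \<nu> (\<lambda>x. 2 powr p * norm x powr p)" using norm_moment[of p] p by simp
  thus "integrable \<nu> (\<lambda>x. (2 * norm x) powr p)" by (simp add: powr_mult)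
qed auto

lemma M_graph_linear:
  assumes p: "p > 1"
  shows "M_graph \<nu> R p (\<lambda>x. x \<bullet> u) (\<lambda>x. R u)"
proof (rule M_graphI[OF Cb1_saturated_linear(1) p])
  fix n and x :: 'a
  let ?k = "real (Suc n)"
  have c: "1 + (x \<bullet> u)\<^sup>2 / ?k \<ge> 1" by simp
  have "\<bar>(x \<bullet> u) / (1 + (x \<bullet> u)\<^sup>2 / ?k)\<bar> \<le> \<bar>x \<bullet> u\<bar>"
    by (rule abs_divide_le_abs[OF c])
  also have "\<dots> \<le> norm x * norm u" by (rule Cauchy_Schwarz_ineq2)
  finally show "\<bar>(x \<bullet> u) / (1 + (x \<bullet> u)\<^sup>2 / ?k)\<bar> \<le> norm x * norm u" .
  show "norm (grad (\<lambda>x. (x \<bullet> u) / (1 + (x \<bullet> u)\<^sup>2 / ?k)) x) \<le> norm u"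
    using mult_right_mono[OF Cb1_saturated_linear(3)[of ?k x u], of "norm u"]
    by (subst Cb1_saturated_linear(2)) auto
next
  fix x :: 'a
  have "(\<lambda>n. (x \<bullet> u) / (1 + (x \<bullet> u)\<^sup>2 / real (Suc n))) \<longlonglongrightarrow> (x \<bullet> u) / 1"
    by (intro tendsto_divide tendsto_const tendsto_saturation) simp
  thus "(\<lambda>n. (x \<bullet> u) / (1 + (x \<bullet> u)\<^sup>2 / real (Suc n))) \<longlonglongrightarrow> x \<bullet> u" by simp
  have "(\<lambda>n. 1 + - (x \<bullet> u)\<^sup>2 / real (Suc n)) \<longlonglongrightarrow> 1" by (rule tendsto_saturation)
  hence "(\<lambda>n. ((1 - (x \<bullet> u)\<^sup>2 / real (Suc n)) / (1 + (x \<bullet> u)\<^sup>2 / real (Suc n))\<^sup>2) *\<^sub>R u) \<longlonglongrightarrow> (1 / 1\<^sup>2) *\<^sub>R u"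
    by (intro tendsto_scaleR tendsto_divide tendsto_power tendsto_const tendsto_saturation) auto
  thus "(\<lambda>n. grad (\<lambda>x. (x \<bullet> u) / (1 + (x \<bullet> u)\<^sup>2 / real (Suc n))) x) \<longlonglongrightarrow> u"
    by (subst Cb1_saturated_linear(2)) auto
next
  have "integrable \<nu> (\<lambda>x. norm x powr p * norm u powr p)" using norm_moment[of p] p by simp
  thus "integrable \<nu> (\<lambda>x. (norm x * norm u) powr p)" by (simp add: powr_mult)
qed auto

end

section \<open>The divergence formula\<close>

context exp_power_product
begin

lemma R_e: "R (e h) = sqrt (lam h) *\<^sub>R e h"
  by (rule eq_if_coords_eq) (simp add: R_coord orth)

lemma R_sums:
  "(\<lambda>h. lam h * (x \<bullet> e h) * (y \<bullet> e h)) sums (R x \<bullet> R y)"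
proof -
  have "(R x \<bullet> e h) * (R y \<bullet> e h) = lam h * (x \<bullet> e h) * (y \<bullet> e h)" for h
    using lam_pos[of h] by (simp add: R_coord less_imp_le)
  thus ?thesis using inner_sums[of "R x" "R y"] by simp
qed

lemma norm_R_line:
  "(norm (R (x + t *\<^sub>R e h)))\<^sup>2 = (norm (R x))\<^sup>2 + 2 * (lam h * (x \<bullet> e h)) * t + lam h * t\<^sup>2"
proof -
  interpret R: bounded_linear R by (rule bounded_linear_R)
  have s: "sqrt (lam h) * sqrt (lam h) = lam h" using lam_pos[of h] by (simp add: less_imp_le)
  have "(norm (R (x + t *\<^sub>R e h)))\<^sup>2 = (norm (R x))\<^sup>2 + 2 * ((sqrt (lam h) * sqrt (lam h)) * (x \<bullet> e h)) * t
          + (sqrt (lam h) * sqrt (lam h)) * t\<^sup>2"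
    unfolding R.add R.scaleR R_e power2_norm_eq_inner
    by (simp add: inner_add_left inner_add_right orth R_coord inner_commute[of "e h"] power2_eq_square algebra_simps)
  thus ?thesis unfolding s .
qed

lemma continuous_R: "continuous_on S R"
  by (intro linear_continuous_on bounded_linear_R)

text \<open>Here \<open>v\<close> is \<open>sqrt (lam h)\<close> times the \<open>h\<close>-th coordinate of \<open>R x / (2 (\<epsilon> + \<parallel>R x\<parallel>\<^sup>2))\<close>, and \<open>v'\<close> is
  its derivative in the direction \<open>e h\<close>. The parameter \<open>\<epsilon>\<close> keeps both of them bounded.\<close>

lemma ibp_regularised:
  fixes \<epsilon> :: real and h :: nat
  assumes \<phi>: "\<phi> \<in> Cb1" and \<epsilon>: "\<epsilon> > 0"
  defines "c \<equiv> (\<lambda>x. \<epsilon> + (norm (R x))\<^sup>2)"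
  defines "v \<equiv> (\<lambda>x. lam h * (x \<bullet> e h) / (2 * c x))"
    and "v' \<equiv> (\<lambda>x. lam h / (2 * c x) - (lam h * (x \<bullet> e h))\<^sup>2 / (c x)\<^sup>2)"
  shows "integrable \<nu> (\<lambda>x. (grad \<phi> x \<bullet> e h) * v x)"
    and "integrable \<nu> (\<lambda>x. \<phi> x * (v x * score m (\<mu> h) (x \<bullet> e h) - v' x))"
    and "(\<integral>x. (grad \<phi> x \<bullet> e h) * v x \<partial>\<nu>) = (\<integral>x. \<phi> x * (v x * score m (\<mu> h) (x \<bullet> e h) - v' x) \<partial>\<nu>)"
proof -
  obtain B where B: "B \<ge> 0" "\<And>x. \<bar>\<phi> x\<bar> \<le> B" "\<And>x. norm (grad \<phi> x) \<le> B"
    using Cb1_bounds[OF \<phi>] by blast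
  have c0: "c x > 0" "\<epsilon> \<le> c x" for x using \<epsilon> by (auto simp: c_def add_pos_nonneg)
  have contc: "continuous_on UNIV c" unfolding c_def by (intro continuous_intros continuous_R)
  have contv: "continuous_on UNIV v"
    unfolding v_def using c0 by (intro continuous_intros contc) (auto simp: less_imp_neq[symmetric])
  have contv': "continuous_on UNIV v'"
    unfolding v'_def using c0 by (intro continuous_intros contc) (auto simp: less_imp_neq[symmetric])
  note cont = Cb1_continuous[OF \<phi>] contv contv'
  have [measurable]: "\<phi> \<in> borel_measurable borel" "grad \<phi> \<in> borel_measurable borel"
    "v \<in> borel_measurable borel" "v' \<in> borel_measurable borel"
    using cont by (auto intro: borel_measurable_continuous_onI)
  define s where "s = sqrt (lam h)"
  have s: "s > 0" "lam h = s * s" using lam_pos[of h] by (auto simp: s_def)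
  have Rx: "lam h * (x \<bullet> e h) = s * (R x \<bullet> e h)" for x
    unfolding R_coord s_def[symmetric] by (simp only: s(2) mult.assoc)
  define C where "C = s * (1 / \<epsilon> + 1) + lam h / \<epsilon> + lam h / \<epsilon>"
  have C0: "0 \<le> s * (1 / \<epsilon> + 1)" "0 \<le> lam h / \<epsilon>" using s \<epsilon> lam_pos[of h] by auto
  have bdv: "\<bar>v x\<bar> \<le> C" for x
  proof -
    \<comment> \<open>\<open>r \<le> 1 + r\<^sup>2\<close> turns the quotient \<open>r / (\<epsilon> + r\<^sup>2)\<close> into one that is bounded by \<open>1 / \<epsilon> + 1\<close>.\<close>
    have "norm (R x) \<le> 1 + (norm (R x))\<^sup>2"
      using zero_le_power2[of "norm (R x) - 1/2"] by (simp add: power2_eq_square algebra_simps)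
    also have "\<dots> \<le> (1 / \<epsilon> + 1) * c x" using \<epsilon> by (simp add: c_def field_simps)
    finally have n: "norm (R x) \<le> (1 / \<epsilon> + 1) * c x" .
    have "\<bar>lam h * (x \<bullet> e h)\<bar> \<le> s * norm (R x)"
      using abs_coord_le_norm[of "R x" h] s(1) by (simp add: Rx abs_mult)
    also have "\<dots> \<le> s * ((1 / \<epsilon> + 1) * c x)" using n s(1) by (intro mult_left_mono) auto
    also have "\<dots> = (s * (1 / \<epsilon> + 1)) * c x" by (simp only: mult.assoc)
    also have "\<dots> \<le> (s * (1 / \<epsilon> + 1)) * (2 * c x)"
      using C0(1) c0(1)[of x] by (intro mult_left_mono) auto
    finally have "\<bar>v x\<bar> \<le> s * (1 / \<epsilon> + 1)"
      using c0(1)[of x] unfolding v_def abs_divide by (simp add: pos_divide_le_eq)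
    thus ?thesis using C0 by (simp add: C_def)
  qed
  have bdv': "\<bar>v' x\<bar> \<le> C" for x
  proof -
    have "lam h / (2 * c x) \<le> lam h / \<epsilon>"
      using c0[of x] \<epsilon> lam_pos[of h] by (intro divide_left_mono) auto
    moreover have "lam h / (2 * c x) \<ge> 0" using c0[of x] lam_pos[of h] by simp
    moreover have "(lam h * (x \<bullet> e h))\<^sup>2 / (c x)\<^sup>2 \<le> lam h / \<epsilon>"
    proof -
      have "(lam h * (x \<bullet> e h))\<^sup>2 = lam h * (R x \<bullet> e h)\<^sup>2"
        unfolding Rx by (simp add: s power2_eq_square)
      also have "\<dots> \<le> lam h * (norm (R x))\<^sup>2"
        using power_mono[OF abs_coord_le_norm[of "R x" h] abs_ge_zero, of 2] lam_pos[of h]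
        by (intro mult_left_mono) auto
      also have "\<dots> \<le> lam h * c x" using lam_pos[of h] \<epsilon> by (intro mult_left_mono) (auto simp: c_def)
      finally have "(lam h * (x \<bullet> e h))\<^sup>2 / (c x)\<^sup>2 \<le> lam h * c x / (c x)\<^sup>2"
        by (intro divide_right_mono) auto
      also have "\<dots> = lam h / c x" using c0(1)[of x] by (simp add: power2_eq_square)
      also have "\<dots> \<le> lam h / \<epsilon>" using c0[of x] \<epsilon> lam_pos[of h] by (intro divide_left_mono) auto
      finally show ?thesis .
    qed
    moreover have "0 \<le> (lam h * (x \<bullet> e h))\<^sup>2 / (c x)\<^sup>2" by simp
    ultimately show ?thesis using C0 unfolding C_def v'_def by linarith
  qed
  have C: "C \<ge> 0" using bdv[of 0] by linarith
  have grad_bd: "\<bar>grad \<phi> x \<bullet> e h\<bar> \<le> B" for x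
    using abs_coord_le_norm[of "grad \<phi> x" h] B(3)[of x] by linarith
  define f where "f x = \<phi> x * v x" for x
  define f1 where "f1 x = (grad \<phi> x \<bullet> e h) * v x" for x
  define f2 where "f2 x = \<phi> x * v' x" for x
  have [measurable]: "f \<in> borel_measurable borel" "f1 \<in> borel_measurable borel" "f2 \<in> borel_measurable borel"
    unfolding f_def[abs_def] f1_def[abs_def] f2_def[abs_def] by measurable
  have bds: "\<bar>f x\<bar> \<le> B * C" "\<bar>f1 x\<bar> \<le> B * C" "\<bar>f2 x\<bar> \<le> B * C" for x
    unfolding f_def f1_def f2_def abs_mult
    by (rule mult_mono; use grad_bd B C bdv bdv' in auto)+
  have eh: "(x + t *\<^sub>R e h) \<bullet> e h = x \<bullet> e h + t" for x t
    by (simp add: inner_add_left orth)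
  have integration_by_parts_coord: "(\<integral>x. f1 x + f2 x \<partial>\<nu>) = (\<integral>x. f x * score m (\<mu> h) (x \<bullet> e h) \<partial>\<nu>)"
  proof (rule integration_by_parts_coord)
    fix x
    have dc: "((\<lambda>t. c (x + t *\<^sub>R e h)) has_real_derivative 2 * (lam h * (x \<bullet> e h))) (at 0)"
      unfolding c_def norm_R_line by (auto intro!: derivative_eq_intros)
    have dx: "((\<lambda>t. lam h * ((x + t *\<^sub>R e h) \<bullet> e h)) has_real_derivative lam h) (at 0)"
      unfolding eh by (auto intro!: derivative_eq_intros)
    have dv: "((\<lambda>t. v (x + t *\<^sub>R e h)) has_real_derivative v' x) (at 0)"
    proof -
      have "((\<lambda>t. lam h * ((x + t *\<^sub>R e h) \<bullet> e h) / (2 * c (x + t *\<^sub>R e h))) has_real_derivative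
          (lam h * (2 * c x) - lam h * (x \<bullet> e h) * (2 * (2 * (lam h * (x \<bullet> e h))))) / ((2 * c x) * (2 * c x))) (at 0)"
        using DERIV_divide[OF dx DERIV_cmult[OF dc, of 2]] c0(1)[of x] by simp
      moreover have "(l * (2 * z) - y * (2 * (2 * y))) / ((2 * z) * (2 * z)) = l / (2 * z) - y\<^sup>2 / z\<^sup>2"
        if "z > 0" for l y z :: real
        using that by (simp add: field_simps power2_eq_square)
      ultimately show ?thesis by (simp only: v_def v'_def c0(1))
    qed
    show "((\<lambda>t. f (x + t *\<^sub>R e h)) has_real_derivative f1 x + f2 x) (at 0)"
      using DERIV_mult[OF Cb1_line[OF \<phi>, of x "e h"] dv] by (simp add: f_def f1_def f2_def mult.commute)
    show "continuous_on UNIV (\<lambda>t. f1 (x + t *\<^sub>R e h) + f2 (x + t *\<^sub>R e h))"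
      unfolding f1_def f2_def
      by (intro continuous_intros continuous_on_compose2[OF cont(1)] continuous_on_compose2[OF cont(2)]
          continuous_on_compose2[OF cont(3)] continuous_on_compose2[OF cont(4)]) auto
    have BC: "0 \<le> B * C" using B C by simp
    show "\<bar>f x\<bar> \<le> 2 * (B * C)" using bds(1)[of x] BC by linarith
    show "\<bar>f1 x + f2 x\<bar> \<le> 2 * (B * C)" using bds(2,3)[of x] by linarith
  qed measurable
  have i: "integrable \<nu> f1" "integrable \<nu> f2"
    by (rule integrable_const_bound[where B="B * C"]; use bds in simp)+
  have i3: "integrable \<nu> (\<lambda>x. f x * score m (\<mu> h) (x \<bullet> e h))"
    by (rule integrable_bounded_mult_score[where B="B * C"]) (use bds in auto)
  have eq: "(\<lambda>x. \<phi> x * (v x * score m (\<mu> h) (x \<bullet> e h) - v' x)) = (\<lambda>x. f x * score m (\<mu> h) (x \<bullet> e h) - f2 x)"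
    by (simp add: f_def f2_def fun_eq_iff algebra_simps)
  show "integrable \<nu> (\<lambda>x. (grad \<phi> x \<bullet> e h) * v x)" using i(1) by (simp add: f1_def[abs_def])
  show "integrable \<nu> (\<lambda>x. \<phi> x * (v x * score m (\<mu> h) (x \<bullet> e h) - v' x))" unfolding eq using i i3 by simp
  show "(\<integral>x. (grad \<phi> x \<bullet> e h) * v x \<partial>\<nu>) = (\<integral>x. \<phi> x * (v x * score m (\<mu> h) (x \<bullet> e h) - v' x) \<partial>\<nu>)"
    unfolding eq using integration_by_parts_coord i i3 by (simp add: f1_def[abs_def])
qed

text \<open>The value of the adjoint at \<open>R x / (2 \<parallel>R x\<parallel>\<^sup>2)\<close>, obtained from \<open>ibp_regularised\<close> by summing over
  \<open>h\<close> and letting \<open>\<epsilon>\<close> tend to zero.\<close>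

definition adjoint_value :: "'a \<Rightarrow> real" where
  "adjoint_value x = (score_sum x - suminf lam) / (2 * (norm (R x))\<^sup>2) + (norm (R (R x)))\<^sup>2 / ((norm (R x))\<^sup>2)\<^sup>2"

lemma RR_sums: "(\<lambda>h. (lam h * (x \<bullet> e h))\<^sup>2) sums (norm (R (R x)))\<^sup>2"
proof -
  have "(R (R x) \<bullet> e h)\<^sup>2 = (lam h * (x \<bullet> e h))\<^sup>2" for h
    using lam_pos[of h] by (simp add: R_coord less_imp_le flip: mult.assoc)
  thus ?thesis using norm_sums[of "R (R x)"] by simp
qed

lemma AE_R_nonzero: "AE x in \<nu>. R x \<noteq> 0"
  using AE_coord_neq[of 0 0]
proof eventually_elim
  case (elim x)
  hence "R x \<bullet> e 0 \<noteq> 0" using lam_pos[of 0] by (simp add: R_coord)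
  thus ?case by auto
qed

lemma mult_score: "t * score m (\<mu> h) t = \<bar>t\<bar> powr (2 * m) / \<mu> h"
  by (cases "t = 0") (simp_all add: score_def sgn_if powr_diff)

lemma score_sum_measurable [measurable]: "score_sum \<in> borel_measurable borel"
  unfolding score_sum_def[abs_def] by measurable

lemma adjoint_value_measurable [measurable]: "adjoint_value \<in> borel_measurable borel"
  unfolding adjoint_value_def[abs_def] by measurable

text \<open>The regularisation parameter \<open>1 / (n + 1)\<close> and the number \<open>n\<close> of summands are coupled, so that one
  application of dominated convergence on each side performs both limits. On the left the partial sum is
  the inner product of \<open>R x\<close> with a truncation of \<open>R (grad \<phi> x)\<close> and hence at most a multiple of
  \<open>\<parallel>R x\<parallel>\<close>, which leaves \<open>1 / \<parallel>R x\<parallel>\<close> as majorant. On the right the numerators are bounded by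
  \<open>score_sum\<close>, the trace of the covariance, and a multiple of \<open>\<parallel>R x\<parallel>\<^sup>2\<close>, and the majorant is integrable by the moment bounds.\<close>

lemma divergence_formula:
  assumes \<phi>: "\<phi> \<in> Cb1"
  shows "(\<integral>x. R (grad \<phi> x) \<bullet> ((1 / (2 * (norm (R x))\<^sup>2)) *\<^sub>R R x) \<partial>\<nu>) = (\<integral>x. \<phi> x * adjoint_value x \<partial>\<nu>)"
proof -
  obtain B where B: "B \<ge> 0" "\<And>x. \<bar>\<phi> x\<bar> \<le> B" "\<And>x. norm (grad \<phi> x) \<le> B"
    using Cb1_bounds[OF \<phi>] by blast
  obtain K where K: "K > 0" "\<And>x. norm (R x) \<le> norm x * K"
    using bounded_linear.pos_bounded[OF bounded_linear_R] by blast
  note [measurable] = Cb1_measurable[OF \<phi>]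
  define c where "c n x = 1 / real (Suc n) + (norm (R x))\<^sup>2" for n x
  define T where "T = suminf lam"
  have T0: "T \<ge> 0" unfolding T_def using lam_pos summable_lam by (intro suminf_nonneg) (auto intro: less_imp_le)
  define b where "b h x = lam h * \<bar>x \<bullet> e h\<bar> powr (2 * m) / \<mu> h" for h x
  have b0: "b h x \<ge> 0" for h x using lam_pos[of h] \<mu>[of h] by (simp add: b_def)
  define L where "L n x = (\<Sum>h<n. (grad \<phi> x \<bullet> e h) * (lam h * (x \<bullet> e h) / (2 * c n x)))" for n x
  define Q where "Q n x = (\<Sum>h<n. \<phi> x * (lam h * (x \<bullet> e h) / (2 * c n x) * score m (\<mu> h) (x \<bullet> e h)
       - (lam h / (2 * c n x) - (lam h * (x \<bullet> e h))\<^sup>2 / (c n x)\<^sup>2)))" for n x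
  have [measurable]: "c n \<in> borel_measurable borel" for n unfolding c_def[abs_def] by measurable
  have [measurable]: "L n \<in> borel_measurable borel" for n unfolding L_def[abs_def] by measurable
  have [measurable]: "Q n \<in> borel_measurable borel" for n unfolding Q_def[abs_def] by measurable
  have c0: "c n x > 0" "(norm (R x))\<^sup>2 \<le> c n x" for n x by (auto simp: c_def add_pos_nonneg)
  have eps: "1 / real (Suc n) > 0" for n by simp
  have LQ: "(\<integral>x. L n x \<partial>\<nu>) = (\<integral>x. Q n x \<partial>\<nu>)" for n
    unfolding L_def Q_def c_def using ibp_regularised[OF \<phi> eps[of n]]
    by (subst (1 2) Bochner_Integration.integral_sum) auto
  have c_lim: "(\<lambda>n. c n x) \<longlonglongrightarrow> (norm (R x))\<^sup>2" for x
    unfolding c_def using tendsto_add[OF LIMSEQ_Suc[OF lim_1_over_n] tendsto_const] by simp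
  have L_eq: "L n x = (\<Sum>h<n. lam h * (grad \<phi> x \<bullet> e h) * (x \<bullet> e h)) / (2 * c n x)" for n x
    unfolding L_def sum_divide_distrib by (intro sum.cong) auto
  have Q_eq: "Q n x = \<phi> x * (((\<Sum>h<n. b h x) - (\<Sum>h<n. lam h)) / (2 * c n x)
      + (\<Sum>h<n. (lam h * (x \<bullet> e h))\<^sup>2) / (c n x)\<^sup>2)" for n x
  proof -
    have "lam h * (x \<bullet> e h) / (2 * c n x) * score m (\<mu> h) (x \<bullet> e h) = b h x / (2 * c n x)" for h
    proof -
      have "lam h * (x \<bullet> e h) / (2 * c n x) * score m (\<mu> h) (x \<bullet> e h)
          = lam h * ((x \<bullet> e h) * score m (\<mu> h) (x \<bullet> e h)) / (2 * c n x)"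
        by simp
      thus ?thesis by (simp only: mult_score b_def times_divide_eq_right)
    qed
    hence "lam h * (x \<bullet> e h) / (2 * c n x) * score m (\<mu> h) (x \<bullet> e h)
        - (lam h / (2 * c n x) - (lam h * (x \<bullet> e h))\<^sup>2 / (c n x)\<^sup>2)
      = b h x / (2 * c n x) - lam h / (2 * c n x) + (lam h * (x \<bullet> e h))\<^sup>2 / (c n x)\<^sup>2" for h
      by simp
    hence "Q n x = (\<Sum>h<n. \<phi> x * (b h x / (2 * c n x) - lam h / (2 * c n x) + (lam h * (x \<bullet> e h))\<^sup>2 / (c n x)\<^sup>2))"
      unfolding Q_def by (simp only:)
    thus ?thesis
      by (simp only: sum_distrib_left[symmetric] sum.distrib sum_subtractf sum_divide_distrib diff_divide_distrib)
  qed
  have limL: "(\<lambda>n. \<integral>x. L n x \<partial>\<nu>) \<longlonglongrightarrow> (\<integral>x. (R (grad \<phi> x) \<bullet> R x) / (2 * (norm (R x))\<^sup>2) \<partial>\<nu>)"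
  proof (rule integral_dominated_convergence)
    show "integrable \<nu> (\<lambda>x. (B * K) * norm (R x) powr (- 1))"
      by (intro integrable_mult_right integrable_norm_R_inverse_powr) simp
    show "AE x in \<nu>. (\<lambda>n. L n x) \<longlonglongrightarrow> (R (grad \<phi> x) \<bullet> R x) / (2 * (norm (R x))\<^sup>2)"
      using AE_R_nonzero
    proof eventually_elim
      case (elim x)
      show ?case unfolding L_eq
        using R_sums[of "grad \<phi> x" x] elim unfolding sums_def
        by (intro tendsto_divide tendsto_mult tendsto_const c_lim) auto
    qed
    show "AE x in \<nu>. norm (L n x) \<le> (B * K) * norm (R x) powr (- 1)" for n
      using AE_R_nonzero
    proof eventually_elim
      case (elim x)
      \<comment> \<open>The truncation of \<open>R (grad \<phi> x)\<close>: the partial sum equals \<open>y \<bullet> R x\<close>, and truncation does not increase the norm.\<close>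
      define y where "y = (\<Sum>h<n. (R (grad \<phi> x) \<bullet> e h) *\<^sub>R e h)"
      have N: "norm (R x) > 0" using elim by simp
      have "(norm y)\<^sup>2 = (\<Sum>h<n. (R (grad \<phi> x) \<bullet> e h)\<^sup>2)" unfolding y_def by (rule norm_sum_e) simp
      also have "\<dots> \<le> (norm (R (grad \<phi> x)))\<^sup>2"
        using sum_le_suminf[OF sums_summable[OF norm_sums[of "R (grad \<phi> x)"]], of "{..<n}"]
          sums_unique[OF norm_sums[of "R (grad \<phi> x)"]] by simp
      finally have "norm y \<le> norm (R (grad \<phi> x))" by (rule power2_le_imp_le) simp
      also have "\<dots> \<le> norm (grad \<phi> x) * K" by (rule K(2))
      also have "\<dots> \<le> B * K" using B(3) K(1) by (intro mult_right_mono) auto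
      finally have y: "norm y \<le> B * K" .
      have "(\<Sum>h<n. lam h * (grad \<phi> x \<bullet> e h) * (x \<bullet> e h)) = y \<bullet> R x"
      proof -
        have "lam h * (grad \<phi> x \<bullet> e h) * (x \<bullet> e h) = (R (grad \<phi> x) \<bullet> e h) * (R x \<bullet> e h)" for h
          using lam_pos[of h] by (simp add: R_coord less_imp_le)
        thus ?thesis by (simp add: y_def inner_sum_left inner_commute[of "e _" "R x"])
      qed
      hence "\<bar>L n x\<bar> = \<bar>y \<bullet> R x\<bar> / (2 * c n x)"
        unfolding L_eq using c0(1)[of n x] by (simp add: abs_divide)
      also have "\<dots> \<le> \<bar>y \<bullet> R x\<bar> / (norm (R x))\<^sup>2"
        using c0(1)[of n x] c0(2)[of x n] N by (intro divide_left_mono) auto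
      also have "\<dots> \<le> (norm y * norm (R x)) / (norm (R x))\<^sup>2"
        by (intro divide_right_mono Cauchy_Schwarz_ineq2) auto
      also have "\<dots> \<le> (B * K * norm (R x)) / (norm (R x))\<^sup>2"
        using y by (intro divide_right_mono mult_right_mono) auto
      also have "\<dots> = (B * K) * norm (R x) powr (- 1)"
        using N by (simp add: powr_minus_divide power2_eq_square)
      finally show ?case by simp
    qed
  qed measurable
  have limQ: "(\<lambda>n. \<integral>x. Q n x \<partial>\<nu>) \<longlonglongrightarrow> (\<integral>x. \<phi> x * adjoint_value x \<partial>\<nu>)"
  proof (rule integral_dominated_convergence)
    define H where "H x = B * ((\<bar>score_sum x\<bar> powr 2 + norm (R x) powr (- 4)) + (T + K\<^sup>2) * norm (R x) powr (- 2))" for x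
    show "integrable \<nu> H"
    proof -
      have "integrable \<nu> (\<lambda>x. \<bar>score_sum x\<bar> powr 2)" by (rule score_sum_moments(2)) simp
      moreover have "integrable \<nu> (\<lambda>x. norm (R x) powr (- 4))"
        "integrable \<nu> (\<lambda>x. norm (R x) powr (- 2))"
        by (rule integrable_norm_R_inverse_powr; simp)+
      ultimately show ?thesis
        unfolding H_def[abs_def]
        by (intro integrable_mult_right Bochner_Integration.integrable_add)
    qed
    show "AE x in \<nu>. (\<lambda>n. Q n x) \<longlonglongrightarrow> \<phi> x * adjoint_value x"
      using AE_R_nonzero score_sum_moments(1)
    proof eventually_elim
      case (elim x)
      have "(\<lambda>n. \<Sum>h<n. b h x) \<longlonglongrightarrow> score_sum x"
        using summable_LIMSEQ[OF elim(2)] by (simp add: b_def score_sum_def)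
      moreover have "(\<lambda>n. \<Sum>h<n. lam h) \<longlonglongrightarrow> suminf lam" by (rule summable_LIMSEQ[OF summable_lam])
      moreover have "(\<lambda>n. \<Sum>h<n. (lam h * (x \<bullet> e h))\<^sup>2) \<longlonglongrightarrow> (norm (R (R x)))\<^sup>2"
        using RR_sums[of x] by (simp add: sums_def)
      ultimately show ?case unfolding Q_eq adjoint_value_def using elim(1)
        by (intro tendsto_mult tendsto_add tendsto_divide tendsto_diff tendsto_power tendsto_const c_lim) auto
    qed
    show "AE x in \<nu>. norm (Q n x) \<le> H x" for n
      using AE_R_nonzero score_sum_moments(1)
    proof eventually_elim
      case (elim x)
      define r where "r = (norm (R x))\<^sup>2"
      define S1 where "S1 = (\<Sum>h<n. b h x)"
      define S2 where "S2 = (\<Sum>h<n. lam h)"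
      define S3 where "S3 = (\<Sum>h<n. (lam h * (x \<bullet> e h))\<^sup>2)"
      have r: "r > 0" using elim by (simp add: r_def)
      have S1: "0 \<le> S1" "S1 \<le> \<bar>score_sum x\<bar>"
      proof -
        show "0 \<le> S1" unfolding S1_def using b0 by (intro sum_nonneg) auto
        have "S1 \<le> score_sum x" unfolding S1_def score_sum_def b_def[symmetric]
          using elim(2) b0 by (intro sum_le_suminf) (auto simp: b_def)
        thus "S1 \<le> \<bar>score_sum x\<bar>" by simp
      qed
      have S2: "0 \<le> S2" "S2 \<le> T"
        unfolding S2_def T_def using lam_pos summable_lam
        by (auto intro!: sum_nonneg sum_le_suminf intro: less_imp_le)
      have S3: "0 \<le> S3" "S3 \<le> K\<^sup>2 * r"
      proof -
        show "0 \<le> S3" unfolding S3_def by (intro sum_nonneg) auto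
        have "S3 \<le> (norm (R (R x)))\<^sup>2" unfolding S3_def
          using sum_le_suminf[OF sums_summable[OF RR_sums[of x]], of "{..<n}"]
            sums_unique[OF RR_sums[of x]] by simp
        also have "\<dots> \<le> (norm (R x) * K)\<^sup>2" using K by (intro power_mono) auto
        finally show "S3 \<le> K\<^sup>2 * r" by (simp add: r_def power_mult_distrib mult.commute)
      qed
      have cr: "r \<le> c n x" "c n x > 0" using c0(1)[of n x] c0(2)[of x n] by (auto simp: r_def)
      have "\<bar>(S1 - S2) / (2 * c n x) + S3 / (c n x)\<^sup>2\<bar> \<le> \<bar>S1 - S2\<bar> / (2 * c n x) + S3 / (c n x)\<^sup>2"
        using S3(1) cr by (intro order_trans[OF abs_triangle_ineq]) (simp add: abs_divide)
      also have "\<dots> \<le> (\<bar>score_sum x\<bar> + T) / r + K\<^sup>2 * r / r\<^sup>2"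
        using S1 S2 S3 cr r by (intro add_mono frac_le power_mono) auto
      also have "\<dots> = \<bar>score_sum x\<bar> * (1 / r) + (T + K\<^sup>2) * (1 / r)"
        using r by (simp add: power2_eq_square field_simps)
      also have "\<bar>score_sum x\<bar> * (1 / r) \<le> \<bar>score_sum x\<bar> powr 2 + (1 / r) powr 2"
        using mult_le_powr_add_powr[of "\<bar>score_sum x\<bar>" "1 / r" 2] r by simp
      also have "(1 / r) powr 2 = norm (R x) powr (- 4)"
        using elim(1) by (simp add: r_def powr_minus_divide powr_divide powr_powr flip: powr_numeral)
      also have "1 / r = norm (R x) powr (- 2)"
        using elim(1) by (simp add: r_def powr_minus_divide)
      finally have "\<bar>(S1 - S2) / (2 * c n x) + S3 / (c n x)\<^sup>2\<bar>
          \<le> \<bar>score_sum x\<bar> powr 2 + norm (R x) powr - 4 + (T + K\<^sup>2) * norm (R x) powr - 2" by simp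
      hence "\<bar>\<phi> x\<bar> * \<bar>(S1 - S2) / (2 * c n x) + S3 / (c n x)\<^sup>2\<bar> \<le> H x"
        unfolding H_def using B by (intro mult_mono) auto
      thus ?case by (simp add: Q_eq S1_def S2_def S3_def abs_mult)
    qed
  qed measurable
  have "(\<integral>x. (R (grad \<phi> x) \<bullet> R x) / (2 * (norm (R x))\<^sup>2) \<partial>\<nu>) = (\<integral>x. \<phi> x * adjoint_value x \<partial>\<nu>)"
    using LIMSEQ_unique[OF limL] limQ LQ by simp
  thus ?thesis by simp
qed

end

section \<open>The squared norm function\<close>

lemma M_graph_Mp:
  assumes "M_graph \<nu> R p \<phi> F"
  shows "M_graph \<nu> R p \<phi> (Mp \<nu> R p \<phi>)"
  unfolding Mp_def using assms by (rule someI[of "M_graph \<nu> R p \<phi>"])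

context exp_power_product
begin

text \<open>This is \<open>G / \<parallel>G\<parallel>\<^sup>2\<close> for \<open>G = 2 R x\<close>.\<close>

definition normalised_gradient :: "'a \<Rightarrow> 'a" where
  "normalised_gradient x = (1 / (2 * (norm (R x))\<^sup>2)) *\<^sub>R R x"

lemma normalised_gradient_Lp:
  assumes "q > 0"
  shows "normalised_gradient \<in> Lp q \<nu>"
  unfolding Lp_def
proof (intro CollectI conjI)
  show [measurable]: "normalised_gradient \<in> borel_measurable \<nu>" unfolding normalised_gradient_def[abs_def] by measurable
  show "integrable \<nu> (\<lambda>x. norm (normalised_gradient x) powr q)"
  proof (rule Bochner_Integration.integrable_bound)
    show "integrable \<nu> (\<lambda>x. norm (R x) powr (- q))"
      using assms by (intro integrable_norm_R_inverse_powr) simp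
    have "norm (normalised_gradient x) \<le> 1 / norm (R x)" for x
      by (simp add: normalised_gradient_def power2_eq_square divide_simps)
    hence "norm (normalised_gradient x) powr q \<le> (1 / norm (R x)) powr q" for x
      using assms by (intro powr_mono2) auto
    moreover have "(1 / norm (R x)) powr q = norm (R x) powr (- q)" for x
      by (simp add: powr_minus_divide powr_divide)
    ultimately show "AE x in \<nu>. norm (norm (normalised_gradient x) powr q) \<le> norm (norm (R x) powr (- q))" by simp
  qed measurable
qed

text \<open>The value is at most \<open>(\<bar>score_sum x\<bar> + const) / \<parallel>R x\<parallel>\<^sup>2\<close>; splitting the product by
  \<open>a * b \<le> a\<^sup>2 + b\<^sup>2\<close> reduces the claim to moments of either sign.\<close>

lemma adjoint_value_Lp:
  assumes q: "q > 0"
  shows "adjoint_value \<in> Lp q \<nu>"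
  unfolding Lp_def
proof (intro CollectI conjI)
  obtain K where K: "K > 0" "\<And>x. norm (R x) \<le> norm x * K"
    using bounded_linear.pos_bounded[OF bounded_linear_R] by blast
  define T where "T = \<bar>suminf lam\<bar> + K\<^sup>2"
  have T: "T \<ge> 0" by (simp add: T_def)
  show "adjoint_value \<in> borel_measurable \<nu>" by measurable
  show "integrable \<nu> (\<lambda>x. norm (adjoint_value x) powr q)"
  proof (rule Bochner_Integration.integrable_bound)
    let ?H = "\<lambda>x. 2 powr (2 * q) * (\<bar>score_sum x\<bar> powr (2 * q) + T powr (2 * q)) + norm (R x) powr (- (4 * q))"
    show "integrable \<nu> ?H"
    proof -
      have "integrable \<nu> (\<lambda>x. \<bar>score_sum x\<bar> powr (2 * q))" by (rule score_sum_moments(2)) (use q in simp)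
      moreover have "integrable \<nu> (\<lambda>x. norm (R x) powr (- (4 * q)))"
        by (rule integrable_norm_R_inverse_powr) (use q in simp)
      ultimately show ?thesis
        by (intro integrable_mult_right Bochner_Integration.integrable_add integrable_const)
    qed
    show "AE x in \<nu>. norm (norm (adjoint_value x) powr q) \<le> norm (?H x)"
      using AE_R_nonzero
    proof eventually_elim
      case (elim x)
      define r where "r = (norm (R x))\<^sup>2"
      have r: "r > 0" using elim by (simp add: r_def)
      have "(norm (R (R x)))\<^sup>2 \<le> (norm (R x) * K)\<^sup>2" using K by (intro power_mono) auto
      hence n: "(norm (R (R x)))\<^sup>2 \<le> K\<^sup>2 * r" by (simp add: r_def power_mult_distrib mult.commute)
      have "\<bar>adjoint_value x\<bar> \<le> \<bar>score_sum x - suminf lam\<bar> / (2 * r) + (norm (R (R x)))\<^sup>2 / r\<^sup>2"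
        unfolding adjoint_value_def r_def[symmetric] using r
        by (intro order_trans[OF abs_triangle_ineq]) (simp add: abs_divide)
      also have "\<dots> \<le> (\<bar>score_sum x\<bar> + \<bar>suminf lam\<bar>) / r + K\<^sup>2 * r / r\<^sup>2"
        using r n by (intro add_mono frac_le) auto
      also have "\<dots> = (\<bar>score_sum x\<bar> + T) * (1 / r)"
        using r by (simp add: T_def power2_eq_square field_simps)
      finally have "\<bar>adjoint_value x\<bar> powr q \<le> ((\<bar>score_sum x\<bar> + T) * (1 / r)) powr q"
        using q by (intro powr_mono2) auto
      also have "\<dots> = (\<bar>score_sum x\<bar> + T) powr q * (1 / r) powr q"
        by (rule powr_mult)
      also have "\<dots> \<le> ((\<bar>score_sum x\<bar> + T) powr q) powr 2 + ((1 / r) powr q) powr 2"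
        using mult_le_powr_add_powr[of "(\<bar>score_sum x\<bar> + T) powr q" "(1 / r) powr q" 2] by simp
      also have "((\<bar>score_sum x\<bar> + T) powr q) powr 2 = (\<bar>score_sum x\<bar> + T) powr (2 * q)"
        by (simp add: powr_powr mult.commute)
      also have "\<dots> \<le> 2 powr (2 * q) * (\<bar>score_sum x\<bar> powr (2 * q) + T powr (2 * q))"
        using T q by (intro powr_add_le) auto
      also have "((1 / r) powr q) powr 2 = norm (R x) powr (- (4 * q))"
      proof -
        have "1 / r = norm (R x) powr (- 2)" using elim by (simp add: r_def powr_minus_divide)
        thus ?thesis by (simp add: powr_powr)
      qed
      finally show ?case by simp
    qed
  qed measurable
qed

text \<open>The divergence formula holds for smooth functions; both sides are continuous under the convergence
  that defines the closed operator, so it holds whichever representative \<open>Mp\<close> selects.\<close>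

lemma adj_dom_if_AE_eq_normalised_gradient:
  assumes p: "p > 1" and F: "AE x in \<nu>. F x = normalised_gradient x" "F \<in> borel_measurable \<nu>"
  shows "F \<in> adj_dom \<nu> R p"
proof -
  have q: "p / (p - 1) > 0" using p by simp
  note fLp = normalised_gradient_Lp[OF q] and aLp = adjoint_value_Lp[OF q]
  have [measurable]: "F \<in> borel_measurable \<nu>" "normalised_gradient \<in> borel_measurable \<nu>"
    using F fLp by (auto simp: Lp_def)
  have "integrable \<nu> (\<lambda>x. norm (F x) powr (p / (p - 1)))"
  proof (rule integrable_cong_AE_imp)
    show "integrable \<nu> (\<lambda>x. norm (normalised_gradient x) powr (p / (p - 1)))" using fLp by (simp add: Lp_def)
    show "AE x in \<nu>. norm (normalised_gradient x) powr (p / (p - 1)) = norm (F x) powr (p / (p - 1))"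
      using F(1) by eventually_elim simp
  qed measurable
  hence FLp: "F \<in> Lp (p / (p - 1)) \<nu>" by (simp add: Lp_def)
  have "(\<integral>x. Mp \<nu> R p \<phi> x \<bullet> F x \<partial>\<nu>) = (\<integral>x. \<phi> x * adjoint_value x \<partial>\<nu>)" if \<phi>: "\<phi> \<in> W1 \<nu> R p" for \<phi>
  proof -
    have M: "M_graph \<nu> R p \<phi> (Mp \<nu> R p \<phi>)"
      using \<phi> by (auto simp: W1_def intro: M_graph_Mp)
    have [measurable]: "Mp \<nu> R p \<phi> \<in> borel_measurable \<nu>"
      using M by (auto simp: M_graph_def Lp_tendsto_def Lp_def)
    obtain \<psi> where \<psi>: "\<And>n. \<psi> n \<in> Cb1" "Lp_tendsto p \<nu> \<psi> \<phi>"
        "Lp_tendsto p \<nu> (\<lambda>n x. R (grad (\<psi> n) x)) (Mp \<nu> R p \<phi>)"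
      using M unfolding M_graph_def by blast
    have "(\<lambda>n. \<integral>x. R (grad (\<psi> n) x) \<bullet> normalised_gradient x \<partial>\<nu>) \<longlonglongrightarrow> (\<integral>x. Mp \<nu> R p \<phi> x \<bullet> normalised_gradient x \<partial>\<nu>)"
      by (rule Lp_tendsto_inner[OF \<psi>(3) fLp p])
    moreover have "(\<lambda>n. \<integral>x. \<psi> n x \<bullet> adjoint_value x \<partial>\<nu>) \<longlonglongrightarrow> (\<integral>x. \<phi> x \<bullet> adjoint_value x \<partial>\<nu>)"
      by (rule Lp_tendsto_inner[OF \<psi>(2) aLp p])
    moreover have "(\<integral>x. R (grad (\<psi> n) x) \<bullet> normalised_gradient x \<partial>\<nu>) = (\<integral>x. \<psi> n x \<bullet> adjoint_value x \<partial>\<nu>)" for n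
      using divergence_formula[OF \<psi>(1)] by (simp add: normalised_gradient_def)
    ultimately have "(\<integral>x. Mp \<nu> R p \<phi> x \<bullet> normalised_gradient x \<partial>\<nu>) = (\<integral>x. \<phi> x \<bullet> adjoint_value x \<partial>\<nu>)"
      by (simp add: LIMSEQ_unique)
    moreover have "(\<integral>x. Mp \<nu> R p \<phi> x \<bullet> F x \<partial>\<nu>) = (\<integral>x. Mp \<nu> R p \<phi> x \<bullet> normalised_gradient x \<partial>\<nu>)"
      by (rule integral_cong_AE) (use F(1) in \<open>auto elim: eventually_mono\<close>)
    ultimately show ?thesis by simp
  qed
  thus ?thesis unfolding adj_dom_def using FLp aLp by blast
qed

text \<open>\<open>M_op\<close> selects an unspecified common value of the operators; closability for the single exponent
  \<open>2\<close> identifies it.\<close>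

lemma M_op_square_norm: "AE x in \<nu>. M_op \<nu> R (\<lambda>x. (norm x)\<^sup>2) x = 2 *\<^sub>R R x"
  and M_op_square_norm_measurable: "M_op \<nu> R (\<lambda>x. (norm x)\<^sup>2) \<in> borel_measurable \<nu>"
proof -
  have "\<exists>F. \<forall>p>1. M_graph \<nu> R p (\<lambda>x. (norm x)\<^sup>2) F"
    using M_graph_square_norm by blast
  hence *: "\<forall>p>1. M_graph \<nu> R p (\<lambda>x. (norm x)\<^sup>2) (M_op \<nu> R (\<lambda>x. (norm x)\<^sup>2))"
    unfolding M_op_def by (rule someI_ex)
  hence 2: "M_graph \<nu> R 2 (\<lambda>x. (norm x)\<^sup>2) (M_op \<nu> R (\<lambda>x. (norm x)\<^sup>2))" by simp
  have "AE x in \<nu>. M_op \<nu> R (\<lambda>x. (norm x)\<^sup>2) x = R (2 *\<^sub>R x)"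
    by (rule M_graph_unique[OF 2 M_graph_square_norm]) auto
  thus "AE x in \<nu>. M_op \<nu> R (\<lambda>x. (norm x)\<^sup>2) x = 2 *\<^sub>R R x"
    by (simp add: bounded_linear.linear[OF bounded_linear_R] linear_scale)
  show "M_op \<nu> R (\<lambda>x. (norm x)\<^sup>2) \<in> borel_measurable \<nu>"
    using 2 by (auto simp: M_graph_def Lp_tendsto_def Lp_def)
qed

text \<open>The \<open>i\<close>-th coordinate is linear, so its image under \<open>M\<close> is a constant vector of norm \<open>2 * lam i\<close>. The
  square function is therefore constant almost everywhere, and finite because a summable sequence is
  square summable.\<close>

lemma W1_vec_if_AE_eq_R:
  assumes q: "q > 1" and F: "AE x in \<nu>. F x = 2 *\<^sub>R R x" and [measurable]: "F \<in> borel_measurable \<nu>"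
  shows "F \<in> W1_vec \<nu> R e q"
proof -
  have G: "M_graph \<nu> R q (\<lambda>x. F x \<bullet> e i) (\<lambda>x. R ((2 * sqrt (lam i)) *\<^sub>R e i))" for i
  proof (rule M_graph_cong_AE[OF M_graph_linear[OF q]])
    show "AE x in \<nu>. x \<bullet> ((2 * sqrt (lam i)) *\<^sub>R e i) = F x \<bullet> e i"
      using F by eventually_elim (simp add: R_coord)
  qed measurable
  have M: "M_graph \<nu> R q (\<lambda>x. F x \<bullet> e i) (Mp \<nu> R q (\<lambda>x. F x \<bullet> e i))" for i
    by (rule M_graph_Mp[OF G])
  have norm_const: "norm (R ((2 * sqrt (lam i)) *\<^sub>R e i)) = 2 * lam i" for i
    using lam_pos[of i]
    by (simp add: linear_scale[OF bounded_linear.linear[OF bounded_linear_R]] R_e less_imp_le)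
  have "AE x in \<nu>. norm (Mp \<nu> R q (\<lambda>y. F y \<bullet> e i) x) = 2 * lam i" for i
    using M_graph_unique[OF M[of i] G[of i] q] unfolding norm_const[symmetric] by eventually_elim simp
  hence ae: "AE x in \<nu>. \<forall>i. norm (Mp \<nu> R q (\<lambda>y. F y \<bullet> e i) x) = 2 * lam i"
    by (simp add: AE_all_countable)
  have sm: "summable (\<lambda>i. (2 * lam i)\<^sup>2)"
  proof -
    have "(\<lambda>i. lam i) \<longlonglongrightarrow> 0" by (rule summable_LIMSEQ_zero[OF summable_lam])
    hence "\<forall>\<^sub>F i in sequentially. lam i < 1" by (rule order_tendstoD) simp
    hence "\<forall>\<^sub>F i in sequentially. norm ((2 * lam i)\<^sup>2) \<le> 4 * lam i"
    proof eventually_elim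
      case (elim i)
      have "lam i * lam i \<le> lam i * 1" using elim lam_pos[of i] by (intro mult_left_mono) auto
      thus ?case by (simp add: power2_eq_square)
    qed
    thus ?thesis by (rule summable_comparison_test_ev[OF _ summable_mult[OF summable_lam]])
  qed
  have [measurable]: "Mp \<nu> R q (\<lambda>y. F y \<bullet> e i) \<in> borel_measurable \<nu>" for i
    using M[of i] by (auto simp: M_graph_def Lp_tendsto_def Lp_def)
  define sq where "sq x = sqrt (\<Sum>i. (norm (Mp \<nu> R q (\<lambda>y. F y \<bullet> e i) x))\<^sup>2)" for x
  have sq_meas [measurable]: "sq \<in> borel_measurable \<nu>" unfolding sq_def[abs_def] by measurable
  have "AE x in \<nu>. norm (sq x) powr q = norm (sqrt (\<Sum>i. (2 * lam i)\<^sup>2)) powr q"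
    using ae by eventually_elim (simp add: sq_def)
  hence "integrable \<nu> (\<lambda>x. norm (sq x) powr q)"
    by (subst integrable_cong_AE[where g="\<lambda>_. norm (sqrt (\<Sum>i. (2 * lam i)\<^sup>2)) powr q"]) auto
  hence "sq \<in> Lp q \<nu>" by (simp add: Lp_def)
  moreover have "AE x in \<nu>. summable (\<lambda>i. (norm (Mp \<nu> R q (\<lambda>y. F y \<bullet> e i) x))\<^sup>2)"
    using ae
  proof eventually_elim
    case (elim x)
    show ?case by (simp only: elim[rule_format] sm)
  qed
  moreover have "(\<lambda>x. F x \<bullet> e i) \<in> W1 \<nu> R q" for i using G by (auto simp: W1_def)
  ultimately show ?thesis by (simp add: W1_vec_def sq_def[abs_def])
qed

lemma square_norm_properties:
  defines "g \<equiv> (\<lambda>x::'a. (norm x)\<^sup>2)"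
  shows "p > 1 \<Longrightarrow> g \<in> W1 \<nu> R p"
    and "p > 1 \<Longrightarrow> (\<lambda>x. M_op \<nu> R g x /\<^sub>R (norm (M_op \<nu> R g x))\<^sup>2) \<in> adj_dom \<nu> R p"
    and "q > 1 \<Longrightarrow> M_op \<nu> R g \<in> W1_vec \<nu> R e q"
proof -
  note [measurable] = M_op_square_norm_measurable
  show "g \<in> W1 \<nu> R p" if "p > 1"
    using M_graph_square_norm[OF that] by (auto simp: W1_def g_def)
  show "(\<lambda>x. M_op \<nu> R g x /\<^sub>R (norm (M_op \<nu> R g x))\<^sup>2) \<in> adj_dom \<nu> R p" if "p > 1"
    unfolding g_def
  proof (rule adj_dom_if_AE_eq_normalised_gradient[OF that])
    show "AE x in \<nu>. M_op \<nu> R (\<lambda>x. (norm x)\<^sup>2) x /\<^sub>R (norm (M_op \<nu> R (\<lambda>x. (norm x)\<^sup>2) x))\<^sup>2 = normalised_gradient x"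
      using M_op_square_norm by eventually_elim (simp add: normalised_gradient_def power2_eq_square divide_simps)
  qed measurable
  show "M_op \<nu> R g \<in> W1_vec \<nu> R e q" if "q > 1"
    unfolding g_def
    by (rule W1_vec_if_AE_eq_R[OF that M_op_square_norm M_op_square_norm_measurable])
qed

end

theorem proposition7p4:
  fixes m :: real
    and \<mu> :: "nat \<Rightarrow> real"
    and e :: "nat \<Rightarrow> 'a::{real_inner, banach, second_countable_topology}"
  assumes "m \<ge> 1"
    and "\<And>h. \<mu> h > 0"
    and "summable (\<lambda>h. \<mu> h powr (1 / m))"
    and "\<And>i j. e i \<bullet> e j = (if i = j then 1 else 0)"
    and "closure (span (range e)) = UNIV"
  shows "let \<nu> = nu m \<mu> e;
             R = sqrt_op (cov_op m \<mu> e);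
             g = (\<lambda>x::'a. (norm x)\<^sup>2);
             Mg = M_op \<nu> R g
         in (\<forall>p>1. g \<in> W1 \<nu> R p \<and> (\<lambda>x. Mg x /\<^sub>R (norm (Mg x))\<^sup>2) \<in> adj_dom \<nu> R p)
            \<and> (\<forall>q>1. Mg \<in> W1_vec \<nu> R e q)"
proof -
  interpret exp_power_product e m \<mu>
    by unfold_locales (use assms in auto)
  show ?thesis
    using square_norm_properties unfolding \<nu>_def R_def by (simp add: Let_def)
qed

end
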